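(* Suppose $\gamma>0$ is such that $\mathcal{H}_{11,\gamma}^-\neq\emptyset$. If there exists $\theta>0$ such that $$\theta\left(\Phi(i\omega)-\gamma^2\begin{bmatrix}0&0\\ 0&I_n\end{bmatrix}\right)-\begin{bmatrix}I_{n_y}&0\\ 0&-I_n\end{bmatrix}>0\quad\forall\omega\in\bar{\mathbf{R}},$$ then $\mathcal{H}_{11,\gamma}^-=\mathcal{H}_{11,\gamma}^\infty$. Consequently, the optimal equalization performance $\gamma_\circ$ is equal to the values of all three convex relaxation problems: $$\gamma_\circ=\gamma_*=\gamma_\circ'=\gamma_\circ''.$$
   Context: Notation. $^\dagger$ is the complex conjugate transpose of a matrix, $^T$ the transpose, $X(s)^H\triangleq X(-s^* )^\dagger$ for a rational matrix function $X$, $I_k$ the $k\times k$ identity matrix. Inequalities between Hermitian matrices are in the positive (semi)definite order. $\bar{\mathbf{R}}=\mathbf{R}\cup\{\pm\infty\}$ (values at $\pm\infty$ are limits). Channel. $n,n_w,n_y,n_d$ are dimensions with $n_y+n_d=n+n_w$. The channel is given by complex matrices $A,B,C,D$, with $A$ Hurwitz, satisfying $A+A^\dagger+BB^\dagger=0$, $B=-C^\dagger D$, $D^\dagger D=DD^\dagger=I_{n+n_w}$, and $(A,B,C,D)$ is a minimal realization of the $(n_y+n_d)\times(n+n_w)$ transfer function $G(s)=D+C(sI-A)^{-1}B$ (so that $G(s)^HG(s)=G(s)G(s)^H=I_{n+n_w}$). $G$ is partitioned as $G=\begin{bmatrix}G_{11}&G_{12}\\ G_{21}&G_{22}\end{bmatrix}$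 with $G_{11}$ of size $n_y\times n$ and $G_{12}$ of size $n_y\times n_w$. $\Sigma_u$ ($n\times n$) and $\Sigma_w$ ($n_w\times n_w$) are Hermitian positive definite matrices (signal and noise intensities). Define $$\Psi(s)=G_{11}(s)\Sigma_u^TG_{11}(s)^H+G_{12}(s)\Sigma_w^TG_{12}(s)^H,$$ $$\Phi(s)=\begin{bmatrix}\Psi(s)&-G_{11}(s)(I_n+\Sigma_u^T)\\ -(I_n+\Sigma_u^T)G_{11}(s)^H&\Sigma_u^T+2I_n\end{bmatrix}.$$ Filters. $\mathcal{H}_p$ is the set of admissible (completely passive, physically realizable) equalizers: stable rational $n_f\times n_f$ transfer functions $H(s)$ in the Hardy space $H_\infty$, $n_f=n_y+n_z\ge n$ (the number $n_z$ of filter environment inputs is not fixed in advance), analytic in $\mathrm{Re}\,s>-\tau$ for some $\tau>0$, and paraunitary: $H(s)^HH(s)=H(s)H(s)^H=I$. Such $H$ is partitioned as $H=\begin{bmatrix}H_{11}&H_{12}\\ H_{21}&H_{22}\end{bmatrix}$ with $H_{11}$ of size $n\times n_y$. The power spectrum density of the equalization error is $$P_e(s)=\begin{bmatrix}H_{11}(s)&I_n\end{bmatrix}\Phi(s)\begin{bmatrix}H_{11}(s)^H\\ I_n\end{bmatrix};$$ the same formula is used for any $n\times n_y$ transfer function $H_{11}$. Conditions on a rational $n\times n_y$ transfer function $H_{11}$: (H1) all poles of $H_{11}$ lie in the open left half-plane and $H_{11}$ is analytic in $\mathrm{Re}\,s>-\tau$ for some $\tau>0$; (PSD$_\gamma$)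 $P_e(i\omega)<\gamma^2I_n$ for all $\omega\in\mathbf{R}$. For $\gamma>0$ define the following sets of rational $n\times n_y$ transfer functions: - $\mathcal{H}_{11,\gamma}^\infty$: elements of the Hardy space $H_\infty$ satisfying (H1) and (PSD$_\gamma$); - $\mathcal{H}_{11,\gamma}$: those satisfying (H1), (PSD$_\gamma$) and $H_{11}(i\omega)H_{11}(i\omega)^\dagger\le I_n$ for all $\omega\in\mathbf{R}$; - $\mathcal{H}_{11,\gamma}^-$: proper ones satisfying (H1), (PSD$_\gamma$) and $H_{11}(i\omega)H_{11}(i\omega)^\dagger<I_n$ for all $\omega\in\bar{\mathbf{R}}$. Values: $\gamma_\circ$ is the infimum of all $\gamma>0$ for which there exists $H\in\mathcal{H}_p$ whose $P_e$ satisfies (PSD$_\gamma$); $\gamma_*=\inf\{\gamma>0:\mathcal{H}_{11,\gamma}^\infty\ne\emptyset\}$; $\gamma_\circ'=\inf\{\gamma>0:\mathcal{H}_{11,\gamma}\ne\emptyset\}$; $\gamma_\circ''=\inf\{\gamma>0:\mathcal{H}_{11,\gamma}^-\ne\emptyset\}$. *)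

theory Defs
  imports
    "HOL-Complex_Analysis.Complex_Analysis"
    "HOL-Library.Extended_Real"
    "Jordan_Normal_Form.Matrix"
    "Jordan_Normal_Form.Char_Poly"
    "Jordan_Normal_Form.Gauss_Jordan_Elimination"
    "Jordan_Normal_Form.Schur_Decomposition"
begin

unbundle no vec_syntax
unbundle no inner_syntax

text \<open>\<open>\<bullet>c\<close> conjugates its right argument, so \<open>(M v) \<bullet>c v\<close> is \<open>v\<^sup>\<dagger> M v\<close>.\<close>

definition hermitian :: "complex mat \<Rightarrow> bool" where
  "hermitian M \<longleftrightarrow> mat_adjoint M = M"

definition pos_def :: "nat \<Rightarrow> complex mat \<Rightarrow> bool" where
  "pos_def k M \<longleftrightarrow> M \<in> carrier_mat k k \<and> hermitian M \<and>
     (\<forall>v\<in>carrier_vec k. v \<noteq> 0\<^sub>v k \<longrightarrow> Re ((M *\<^sub>v v) \<bullet>c v) > 0)"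

definition pos_semidef :: "nat \<Rightarrow> complex mat \<Rightarrow> bool" where
  "pos_semidef k M \<longleftrightarrow> M \<in> carrier_mat k k \<and> hermitian M \<and>
     (\<forall>v\<in>carrier_vec k. Re ((M *\<^sub>v v) \<bullet>c v) \<ge> 0)"

definition loewner_less :: "nat \<Rightarrow> complex mat \<Rightarrow> complex mat \<Rightarrow> bool" where
  "loewner_less k X Y \<longleftrightarrow> pos_def k (Y - X)"

definition loewner_le :: "nat \<Rightarrow> complex mat \<Rightarrow> complex mat \<Rightarrow> bool" where
  "loewner_le k X Y \<longleftrightarrow> pos_semidef k (Y - X)"


text \<open>A matrix function is a map from complex numbers to complex matrices.  A rational
  function is represented by the quotient of two coprime polynomials, with value \<open>0\<close> at its
  poles (division by zero).  Since the reduced fraction determines all values, two such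
  functions are equal in HOL iff they are equal as rational functions.\<close>

definition rational_fun :: "(complex \<Rightarrow> complex) \<Rightarrow> bool" where
  "rational_fun f \<longleftrightarrow> (\<exists>p q. q \<noteq> 0 \<and> coprime p q \<and> f = (\<lambda>s. poly p s / poly q s))"

definition proper_rational_fun :: "(complex \<Rightarrow> complex) \<Rightarrow> bool" where
  "proper_rational_fun f \<longleftrightarrow>
     (\<exists>p q. q \<noteq> 0 \<and> coprime p q \<and> degree p \<le> degree q \<and> f = (\<lambda>s. poly p s / poly q s))"

definition rational_mat :: "nat \<Rightarrow> nat \<Rightarrow> (complex \<Rightarrow> complex mat) \<Rightarrow> bool" where
  "rational_mat r c X \<longleftrightarrow> (\<forall>s. X s \<in> carrier_mat r c) \<and>
     (\<forall>i<r. \<forall>j<c. rational_fun (\<lambda>s. X s $$ (i, j)))"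

definition proper_rational_mat :: "nat \<Rightarrow> nat \<Rightarrow> (complex \<Rightarrow> complex mat) \<Rightarrow> bool" where
  "proper_rational_mat r c X \<longleftrightarrow> (\<forall>s. X s \<in> carrier_mat r c) \<and>
     (\<forall>i<r. \<forall>j<c. proper_rational_fun (\<lambda>s. X s $$ (i, j)))"

definition mat_pole :: "nat \<Rightarrow> nat \<Rightarrow> (complex \<Rightarrow> complex mat) \<Rightarrow> complex \<Rightarrow> bool" where
  "mat_pole r c X s \<longleftrightarrow> (\<exists>i<r. \<exists>j<c. is_pole (\<lambda>z. X z $$ (i, j)) s)"

definition mat_analytic_on :: "nat \<Rightarrow> nat \<Rightarrow> (complex \<Rightarrow> complex mat) \<Rightarrow> complex set \<Rightarrow> bool" where
  "mat_analytic_on r c X S \<longleftrightarrow> (\<forall>i<r. \<forall>j<c. (\<lambda>s. X s $$ (i, j)) analytic_on S)"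

text \<open>A matrix function belongs to \<open>H\<^sub>\<infinity>\<close> iff its entries do: for matrices of a fixed size,
  boundedness of the entries and of the operator norm coincide.\<close>

definition hardy_inf :: "(complex \<Rightarrow> complex) \<Rightarrow> bool" where
  "hardy_inf f \<longleftrightarrow> f analytic_on {s. Re s > 0} \<and> bounded (f ` {s. Re s > 0})"

definition hardy_inf_mat :: "nat \<Rightarrow> nat \<Rightarrow> (complex \<Rightarrow> complex mat) \<Rightarrow> bool" where
  "hardy_inf_mat r c X \<longleftrightarrow> (\<forall>i<r. \<forall>j<c. hardy_inf (\<lambda>s. X s $$ (i, j)))"

definition sys_conj :: "(complex \<Rightarrow> complex mat) \<Rightarrow> complex \<Rightarrow> complex mat" where
  "sys_conj X s = mat_adjoint (X (- cnj s))"

text \<open>Values on the extended imaginary axis; those at \<open>\<plusminus>\<infinity>\<close> are the entrywise limits.\<close>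

definition axis_value :: "(complex \<Rightarrow> complex mat) \<Rightarrow> ereal \<Rightarrow> complex mat" where
  "axis_value X w = (case w of
       ereal r \<Rightarrow> X (\<i> * complex_of_real r)
     | PInfty \<Rightarrow> Matrix.mat (dim_row (X 0)) (dim_col (X 0))
         (\<lambda>ij. Lim at_top (\<lambda>r. X (\<i> * complex_of_real r) $$ ij))
     | MInfty \<Rightarrow> Matrix.mat (dim_row (X 0)) (dim_col (X 0))
         (\<lambda>ij. Lim at_bot (\<lambda>r. X (\<i> * complex_of_real r) $$ ij)))"

definition block11 :: "nat \<Rightarrow> nat \<Rightarrow> (complex \<Rightarrow> complex mat) \<Rightarrow> complex \<Rightarrow> complex mat" where
  "block11 r c X s = (case split_block (X s) r c of (X11, X12, X21, X22) \<Rightarrow> X11)"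

definition block12 :: "nat \<Rightarrow> nat \<Rightarrow> (complex \<Rightarrow> complex mat) \<Rightarrow> complex \<Rightarrow> complex mat" where
  "block12 r c X s = (case split_block (X s) r c of (X11, X12, X21, X22) \<Rightarrow> X12)"


definition hurwitz :: "complex mat \<Rightarrow> bool" where
  "hurwitz A \<longleftrightarrow> (\<forall>k. eigenvalue A k \<longrightarrow> Re k < 0)"

text \<open>\<open>D + C (s I - A)\<^sup>-\<^sup>1 B\<close>; meaningful when \<open>s\<close> is not an eigenvalue of \<open>A\<close>.\<close>

definition transfer_function ::
    "complex mat \<Rightarrow> complex mat \<Rightarrow> complex mat \<Rightarrow> complex mat \<Rightarrow> complex \<Rightarrow> complex mat" where
  "transfer_function A B C D s =
     D + C * the (mat_inverse (s \<cdot>\<^sub>m 1\<^sub>m (dim_row A) - A)) * B"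

definition state_space ::
    "nat \<Rightarrow> nat \<Rightarrow> nat \<Rightarrow> complex mat \<Rightarrow> complex mat \<Rightarrow> complex mat \<Rightarrow> complex mat \<Rightarrow> bool" where
  "state_space \<nu> m p A B C D \<longleftrightarrow> A \<in> carrier_mat \<nu> \<nu> \<and> B \<in> carrier_mat \<nu> m \<and>
     C \<in> carrier_mat p \<nu> \<and> D \<in> carrier_mat p m"

definition minimal_realization ::
    "nat \<Rightarrow> nat \<Rightarrow> nat \<Rightarrow> complex mat \<Rightarrow> complex mat \<Rightarrow> complex mat \<Rightarrow> complex mat \<Rightarrow> bool" where
  "minimal_realization \<nu> m p A B C D \<longleftrightarrow> state_space \<nu> m p A B C D \<and>
     (\<forall>\<nu>' A' B' C' D'. state_space \<nu>' m p A' B' C' D' \<and>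
        (\<forall>s. \<not> eigenvalue A s \<and> \<not> eigenvalue A' s \<longrightarrow>
           transfer_function A' B' C' D' s = transfer_function A B C D s) \<longrightarrow> \<nu> \<le> \<nu>')"

definition channel :: "nat \<Rightarrow> nat \<Rightarrow> nat \<Rightarrow> nat \<Rightarrow> nat \<Rightarrow>
    complex mat \<Rightarrow> complex mat \<Rightarrow> complex mat \<Rightarrow> complex mat \<Rightarrow> bool" where
  "channel n n\<^sub>w n\<^sub>y n\<^sub>d \<nu> A B C D \<longleftrightarrow>
     n\<^sub>y + n\<^sub>d = n + n\<^sub>w \<and>
     minimal_realization \<nu> (n + n\<^sub>w) (n\<^sub>y + n\<^sub>d) A B C D \<and>
     hurwitz A \<and>
     A + mat_adjoint A + B * mat_adjoint B = 0\<^sub>m \<nu> \<nu> \<and>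
     B = - (mat_adjoint C * D) \<and>
     mat_adjoint D * D = 1\<^sub>m (n + n\<^sub>w) \<and> D * mat_adjoint D = 1\<^sub>m (n + n\<^sub>w)"

definition Psi :: "(complex \<Rightarrow> complex mat) \<Rightarrow> (complex \<Rightarrow> complex mat) \<Rightarrow>
    complex mat \<Rightarrow> complex mat \<Rightarrow> complex \<Rightarrow> complex mat" where
  "Psi G11 G12 Su Sw s =
     G11 s * Su\<^sup>T * sys_conj G11 s + G12 s * Sw\<^sup>T * sys_conj G12 s"

definition Phi :: "nat \<Rightarrow> (complex \<Rightarrow> complex mat) \<Rightarrow> (complex \<Rightarrow> complex mat) \<Rightarrow>
    complex mat \<Rightarrow> complex mat \<Rightarrow> complex \<Rightarrow> complex mat" where
  "Phi n G11 G12 Su Sw s = four_block_mat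
     (Psi G11 G12 Su Sw s)                  (- (G11 s * (1\<^sub>m n + Su\<^sup>T)))
     (- ((1\<^sub>m n + Su\<^sup>T) * sys_conj G11 s))   (Su\<^sup>T + 2 \<cdot>\<^sub>m 1\<^sub>m n)"

definition channel_Phi :: "nat \<Rightarrow> nat \<Rightarrow> complex mat \<Rightarrow> complex mat \<Rightarrow> complex mat \<Rightarrow>
    complex mat \<Rightarrow> complex mat \<Rightarrow> complex mat \<Rightarrow> complex \<Rightarrow> complex mat" where
  "channel_Phi n n\<^sub>y A B C D Su Sw =
     (let G = transfer_function A B C D in Phi n (block11 n\<^sub>y n G) (block12 n\<^sub>y n G) Su Sw)"


text \<open>\<open>error_psd n \<Phi> X\<close> is \<open>[X I] \<Phi> [X\<^sup>H; I]\<close>; the row block is the upper half of a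
  block matrix without lower rows.\<close>

definition error_psd :: "nat \<Rightarrow> (complex \<Rightarrow> complex mat) \<Rightarrow> (complex \<Rightarrow> complex mat) \<Rightarrow>
    complex \<Rightarrow> complex mat" where
  "error_psd n \<Phi> X s =
     four_block_mat (X s) (1\<^sub>m n) (0\<^sub>m 0 (dim_col (X s))) (0\<^sub>m 0 n) * \<Phi> s
       * (sys_conj X s @\<^sub>r 1\<^sub>m n)"

definition cond_PSD :: "nat \<Rightarrow> (complex \<Rightarrow> complex mat) \<Rightarrow> real \<Rightarrow> (complex \<Rightarrow> complex mat) \<Rightarrow> bool"
  where
  "cond_PSD n \<Phi> \<gamma> X \<longleftrightarrow> (\<forall>w::real. loewner_less n
     (error_psd n \<Phi> X (\<i> * complex_of_real w)) (complex_of_real (\<gamma>\<^sup>2) \<cdot>\<^sub>m 1\<^sub>m n))"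

definition cond_H1 :: "nat \<Rightarrow> nat \<Rightarrow> (complex \<Rightarrow> complex mat) \<Rightarrow> bool" where
  "cond_H1 r c X \<longleftrightarrow> (\<forall>s. mat_pole r c X s \<longrightarrow> Re s < 0) \<and>
     (\<exists>\<tau>>0. mat_analytic_on r c X {s. Re s > - \<tau>})"

text \<open>Identity of rational matrix functions: it is required off the poles of either factor.\<close>

definition paraunitary :: "nat \<Rightarrow> (complex \<Rightarrow> complex mat) \<Rightarrow> bool" where
  "paraunitary k X \<longleftrightarrow> (\<forall>s. \<not> mat_pole k k X s \<and> \<not> mat_pole k k X (- cnj s) \<longrightarrow>
     sys_conj X s * X s = 1\<^sub>m k \<and> X s * sys_conj X s = 1\<^sub>m k)"

definition admissible_equalizers :: "nat \<Rightarrow> nat \<Rightarrow> (complex \<Rightarrow> complex mat) set" where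
  "admissible_equalizers n n\<^sub>y = {H. \<exists>n\<^sub>z n\<^sub>f. n\<^sub>f = n\<^sub>y + n\<^sub>z \<and> n \<le> n\<^sub>f \<and>
     rational_mat n\<^sub>f n\<^sub>f H \<and> hardy_inf_mat n\<^sub>f n\<^sub>f H \<and> cond_H1 n\<^sub>f n\<^sub>f H \<and> paraunitary n\<^sub>f H}"

definition filters_hardy ::
    "nat \<Rightarrow> nat \<Rightarrow> (complex \<Rightarrow> complex mat) \<Rightarrow> real \<Rightarrow> (complex \<Rightarrow> complex mat) set" where
  "filters_hardy n n\<^sub>y \<Phi> \<gamma> = {X. rational_mat n n\<^sub>y X \<and> hardy_inf_mat n n\<^sub>y X \<and>
     cond_H1 n n\<^sub>y X \<and> cond_PSD n \<Phi> \<gamma> X}"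

definition filters_contr ::
    "nat \<Rightarrow> nat \<Rightarrow> (complex \<Rightarrow> complex mat) \<Rightarrow> real \<Rightarrow> (complex \<Rightarrow> complex mat) set" where
  "filters_contr n n\<^sub>y \<Phi> \<gamma> = {X. rational_mat n n\<^sub>y X \<and>
     cond_H1 n n\<^sub>y X \<and> cond_PSD n \<Phi> \<gamma> X \<and>
     (\<forall>w::real. loewner_le n
        (X (\<i> * complex_of_real w) * mat_adjoint (X (\<i> * complex_of_real w))) (1\<^sub>m n))}"

definition filters_strict ::
    "nat \<Rightarrow> nat \<Rightarrow> (complex \<Rightarrow> complex mat) \<Rightarrow> real \<Rightarrow> (complex \<Rightarrow> complex mat) set" where
  "filters_strict n n\<^sub>y \<Phi> \<gamma> = {X. proper_rational_mat n n\<^sub>y X \<and>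
     cond_H1 n n\<^sub>y X \<and> cond_PSD n \<Phi> \<gamma> X \<and>
     (\<forall>w::ereal. loewner_less n (axis_value X w * mat_adjoint (axis_value X w)) (1\<^sub>m n))}"

text \<open>The infima are taken in the extended reals, so that an infeasible problem has value
  \<open>\<infinity>\<close>.\<close>

definition gamma_opt :: "nat \<Rightarrow> nat \<Rightarrow> (complex \<Rightarrow> complex mat) \<Rightarrow> ereal" where
  "gamma_opt n n\<^sub>y \<Phi> = (INF \<gamma>\<in>{\<gamma>::real. \<gamma> > 0 \<and>
     (\<exists>H\<in>admissible_equalizers n n\<^sub>y. cond_PSD n \<Phi> \<gamma> (block11 n n\<^sub>y H))}. ereal \<gamma>)"

definition gamma_hardy :: "nat \<Rightarrow> nat \<Rightarrow> (complex \<Rightarrow> complex mat) \<Rightarrow> ereal" where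
  "gamma_hardy n n\<^sub>y \<Phi> =
     (INF \<gamma>\<in>{\<gamma>::real. \<gamma> > 0 \<and> filters_hardy n n\<^sub>y \<Phi> \<gamma> \<noteq> {}}. ereal \<gamma>)"

definition gamma_contr :: "nat \<Rightarrow> nat \<Rightarrow> (complex \<Rightarrow> complex mat) \<Rightarrow> ereal" where
  "gamma_contr n n\<^sub>y \<Phi> =
     (INF \<gamma>\<in>{\<gamma>::real. \<gamma> > 0 \<and> filters_contr n n\<^sub>y \<Phi> \<gamma> \<noteq> {}}. ereal \<gamma>)"

definition gamma_strict :: "nat \<Rightarrow> nat \<Rightarrow> (complex \<Rightarrow> complex mat) \<Rightarrow> ereal" where
  "gamma_strict n n\<^sub>y \<Phi> =
     (INF \<gamma>\<in>{\<gamma>::real. \<gamma> > 0 \<and> filters_strict n n\<^sub>y \<Phi> \<gamma> \<noteq> {}}. ereal \<gamma>)"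

end

theory Submission
  imports Defs
begin

text \<open>
  All four values are compared through inclusions between filter classes. Strictly contractive filters
  are contractive, contractive filters belong to \<open>H\<^sub>\<infinity>\<close>, and the block \<open>H\<^sub>1\<^sub>1\<close> of an admissible equalizer
  belongs to \<open>H\<^sub>\<infinity>\<close> as well. Two implications close the circle.

  The multiplier condition makes every \<open>H\<^sub>\<infinity>\<close> filter of level at most \<open>\<gamma>\<close> strictly contractive
  (\<open>hardy_subset_strict\<close>). Compressing the condition by \<open>[X I]\<close> gives
  \<open>\<theta> (P\<^sub>e - \<gamma>\<^sup>2 I) + I - X X\<^sup>* > 0\<close>, and \<open>P\<^sub>e \<le> \<gamma>\<^sup>2 I\<close>. At infinity the same argument applies to limits,
  which exist because the filter is proper and the transfer function of the channel tends to \<open>D\<close>.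

  Every strictly contractive stable rational \<open>X\<close> is the block \<open>H\<^sub>1\<^sub>1\<close> of an admissible equalizer
  (\<open>strict_contraction_dilates\<close>), so the relaxations are exact. One first factors \<open>I - X X\<^sup>H = F F\<^sup>H\<close>
  with a stable rational \<open>F\<close>. Here \<open>F\<close> may have any number of columns, since the number of
  environment inputs is free: after the Cayley transform and clearing of denominators, the left side
  is a positive definite trigonometric matrix polynomial on the unit circle, and Fejer quadrature at
  roots of unity writes it as a finite sum of squares (\<open>trig_poly_pd_sum_of_squares\<close>). The row
  \<open>E = [X F]\<close> is co-isometric on the axis, and with a scalar inner function \<open>b\<close> that clears the poles of
  \<open>E\<^sup>H\<close>, the Halmos matrix with block rows \<open>[E 0]\<close> and \<open>[b (I - E\<^sup>H E), b E\<^sup>H]\<close> is stable and inner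
  (\<open>inner_dilation\<close>).
\<close>

section \<open>Positive definite kernels\<close>

text \<open>Matrices enter here through their entries, as functions of two indices: the size can then be
  an induction variable, and limits are taken entry by entry.\<close>

definition qform :: "nat \<Rightarrow> (nat \<Rightarrow> nat \<Rightarrow> complex) \<Rightarrow> (nat \<Rightarrow> complex) \<Rightarrow> complex" where
  "qform k M v = (\<Sum>i<k. \<Sum>j<k. cnj (v i) * M i j * v j)"

definition herm_kernel :: "nat \<Rightarrow> (nat \<Rightarrow> nat \<Rightarrow> complex) \<Rightarrow> bool" where
  "herm_kernel k M \<longleftrightarrow> (\<forall>i<k. \<forall>j<k. M j i = cnj (M i j))"

definition pd_kernel :: "nat \<Rightarrow> (nat \<Rightarrow> nat \<Rightarrow> complex) \<Rightarrow> bool" where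
  "pd_kernel k M \<longleftrightarrow> herm_kernel k M \<and> (\<forall>v. (\<exists>i<k. v i \<noteq> 0) \<longrightarrow> Re (qform k M v) > 0)"

definition schur_complement :: "nat \<Rightarrow> (nat \<Rightarrow> nat \<Rightarrow> complex) \<Rightarrow> nat \<Rightarrow> nat \<Rightarrow> complex" where
  "schur_complement k M i j = M i j - M i k * M k j / M k k"

lemma herm_kernelD: "herm_kernel k M \<Longrightarrow> i < k \<Longrightarrow> j < k \<Longrightarrow> M j i = cnj (M i j)"
  unfolding herm_kernel_def by blast

lemma herm_kernel_diag_real:
  assumes "herm_kernel k M" "i < k"
  shows "M i i = complex_of_real (Re (M i i))"
proof -
  have "M i i = cnj (M i i)" by (rule herm_kernelD[OF assms(1,2,2)])
  then show ?thesis by (metis Reals_cnj_iff of_real_Re)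
qed

lemma herm_kernel_schur:
  assumes "herm_kernel (Suc k) M"
  shows "herm_kernel k (schur_complement k M)"
  unfolding herm_kernel_def
proof (intro allI impI)
  fix i j assume "i < k" "j < k"
  then have "cnj (M k k) = M k k" "cnj (M i j) = M j i" "cnj (M k j) = M j k" "cnj (M i k) = M k i"
    by (auto intro!: herm_kernelD[OF assms, symmetric])
  then show "schur_complement k M j i = cnj (schur_complement k M i j)"
    unfolding schur_complement_def by simp
qed

text \<open>Completing the square in the last variable. This makes the Schur complement the tool for both
  facts needed about positive definiteness, that it yields a factorization and that it is an open
  condition.\<close>

lemma qform_Suc:
  assumes "herm_kernel (Suc k) M" "M k k \<noteq> 0"
  defines "w \<equiv> \<lambda>v. v k + (\<Sum>j<k. M k j * v j) / M k k"
  shows "qform (Suc k) M v = qform k (schur_complement k M) v + M k k * (w v * cnj (w v))"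
proof -
  define b where "b = (\<Sum>j<k. M k j * v j)"
  have cb: "cnj b = (\<Sum>i<k. cnj (v i) * M i k)"
  proof -
    have "cnj b = (\<Sum>j<k. cnj (M k j) * cnj (v j))" by (simp add: b_def cnj_sum)
    also have "\<dots> = (\<Sum>i<k. cnj (v i) * M i k)"
      by (intro sum.cong refl) (simp add: herm_kernelD[OF assms(1), of k, symmetric] mult.commute)
    finally show ?thesis .
  qed
  have ck: "cnj (M k k) = M k k" by (rule herm_kernelD[OF assms(1), symmetric]) simp_all
  have 1: "qform (Suc k) M v = qform k M v + cnj b * v k + cnj (v k) * b + cnj (v k) * M k k * v k"
    unfolding cb unfolding b_def qform_def
    by (simp add: sum.distrib sum_distrib_left sum_distrib_right mult.assoc)
  have "cnj b * b / M k k = (\<Sum>i<k. \<Sum>j<k. cnj (v i) * (M i k * M k j / M k k) * v j)"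
    unfolding cb unfolding b_def sum_product sum_divide_distrib
    by (intro sum.cong) (auto simp: algebra_simps)
  then have 2: "qform k (schur_complement k M) v = qform k M v - cnj b * b / M k k"
    by (simp add: qform_def schur_complement_def algebra_simps sum_subtractf)
  have 3: "w v = v k + b / M k k" by (simp add: w_def b_def)
  show ?thesis unfolding 1 2 3 using assms(2) ck by (simp add: field_simps)
qed

lemma pd_kernel_Suc:
  "pd_kernel (Suc k) M \<longleftrightarrow>
     herm_kernel (Suc k) M \<and> Re (M k k) > 0 \<and> pd_kernel k (schur_complement k M)"
proof (cases "herm_kernel (Suc k) M")
  case herm: True
  have real: "M k k = complex_of_real (Re (M k k))"
    by (rule herm_kernel_diag_real[OF herm]) simp
  show ?thesis
  proof
    assume pd: "pd_kernel (Suc k) M"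
    have pos: "Re (M k k) > 0"
    proof -
      define v where "v = (\<lambda>i. if i = k then 1 else 0 :: complex)"
      have "qform (Suc k) M v = M k k"
        by (simp add: qform_def v_def)
      moreover have "\<exists>i<Suc k. v i \<noteq> 0" by (auto simp: v_def)
      ultimately show ?thesis using pd by (metis pd_kernel_def)
    qed
    then have nz: "M k k \<noteq> 0" by auto
    have "Re (qform k (schur_complement k M) v) > 0" if v: "\<exists>i<k. v i \<noteq> 0" for v
    proof -
      \<comment> \<open>This choice of the last coordinate makes the completed square vanish.\<close>
    define u where "u = v(k := - (\<Sum>j<k. M k j * v j) / M k k)"
      have eq: "qform k (schur_complement k M) u = qform k (schur_complement k M) v"
        by (simp add: qform_def u_def)
      have "(\<Sum>j<k. M k j * u j) = (\<Sum>j<k. M k j * v j)" by (simp add: u_def)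
      then have "qform (Suc k) M u = qform k (schur_complement k M) v"
        unfolding qform_Suc[OF herm nz] eq by (simp add: u_def)
      moreover have "\<exists>i<Suc k. u i \<noteq> 0" using v by (auto simp: u_def less_Suc_eq)
      ultimately show ?thesis using pd by (metis pd_kernel_def)
    qed
    then show "herm_kernel (Suc k) M \<and> Re (M k k) > 0 \<and> pd_kernel k (schur_complement k M)"
      using herm pos herm_kernel_schur[OF herm] by (auto simp: pd_kernel_def)
  next
    assume *: "herm_kernel (Suc k) M \<and> Re (M k k) > 0 \<and> pd_kernel k (schur_complement k M)"
    then have nz: "M k k \<noteq> 0" by auto
    have sq: "Re (M k k * (z * cnj z)) = Re (M k k) * (cmod z)\<^sup>2" for z
      by (subst real) (simp only: complex_norm_square[symmetric] of_real_mult[symmetric] Re_complex_of_real)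
    have "Re (qform (Suc k) M v) > 0" if v: "\<exists>i<Suc k. v i \<noteq> 0" for v
    proof (cases "\<exists>i<k. v i \<noteq> 0")
      case True
      then have "Re (qform k (schur_complement k M) v) > 0" using * by (auto simp: pd_kernel_def)
      moreover have "Re (M k k) * (cmod z)\<^sup>2 \<ge> 0" for z using * by simp
      ultimately show ?thesis unfolding qform_Suc[OF herm nz] plus_complex.sel sq
        by (meson add_pos_nonneg)
    next
      case False
      then have "v k \<noteq> 0" using v less_Suc_eq by auto
      moreover have "qform k (schur_complement k M) v = 0" "(\<Sum>j<k. M k j * v j) = 0"
        using False by (simp_all add: qform_def)
      ultimately show ?thesis unfolding qform_Suc[OF herm nz] plus_complex.sel sq
        using * by simp
    qed
    then show "pd_kernel (Suc k) M" using herm by (simp add: pd_kernel_def)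
  qed
qed (simp add: pd_kernel_def)

text \<open>A Cholesky factorization: the column belonging to the last variable is split off, and the
  Schur complement is factored by induction.\<close>

lemma pd_kernel_factor:
  assumes "pd_kernel k M"
  shows "\<exists>S. \<forall>i<k. \<forall>j<k. M i j = (\<Sum>l<k. S i l * cnj (S j l))"
  using assms
proof (induction k arbitrary: M)
  case (Suc k)
  have herm: "herm_kernel (Suc k) M" and pos: "Re (M k k) > 0" and pd: "pd_kernel k (schur_complement k M)"
    using Suc.prems by (auto simp: pd_kernel_Suc)
  obtain S where S: "\<And>i j. i < k \<Longrightarrow> j < k \<Longrightarrow> schur_complement k M i j = (\<Sum>l<k. S i l * cnj (S j l))"
    using Suc.IH[OF pd] by auto
  define r where "r = complex_of_real (sqrt (Re (M k k)))"
  have rr: "r * r = M k k"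
  proof -
    have "r * r = complex_of_real (Re (M k k))"
      unfolding r_def of_real_mult[symmetric] using pos by simp
    then show ?thesis using herm_kernel_diag_real[OF herm, of k] by simp
  qed
  have r: "cnj r = r" "r \<noteq> 0" using pos by (auto simp: r_def)
  define T where "T i l = (if i < k then if l < k then S i l else M i k / r
    else if l < k then 0 else r)" for i l
  have "M i j = (\<Sum>l<Suc k. T i l * cnj (T j l))" if "i < Suc k" "j < Suc k" for i j
  proof -
    consider "i < k" "j < k" | "i < k" "j = k" | "i = k" "j < k" | "i = k" "j = k"
      using \<open>i < Suc k\<close> \<open>j < Suc k\<close> by linarith
    then show ?thesis
    proof cases
      case 1
      have "M k j = cnj (M j k)" by (rule herm_kernelD[OF herm]) (use 1 in auto)
      then have "M i j = schur_complement k M i j + (M i k / r) * cnj (M j k / r)"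
        using rr r by (simp add: schur_complement_def)
      then show ?thesis using S[OF 1] 1 by (simp add: T_def)
    next
      case 2 then show ?thesis using r by (simp add: T_def)
    next
      case 3
      have "M k j = cnj (M j k)" by (rule herm_kernelD[OF herm]) (use 3 in auto)
      then show ?thesis using 3 r by (simp add: T_def)
    next
      case 4 then show ?thesis using r rr by (simp add: T_def)
    qed
  qed
  then show ?case by blast
qed simp

text \<open>Positive definiteness is an open condition: the last pivot and the Schur complement depend
  continuously on the entries. It will allow coefficients to be perturbed below.\<close>

lemma pd_kernel_eventually:
  assumes "pd_kernel k M" "\<And>x. herm_kernel k (N x)"
    and "\<And>i j. i < k \<Longrightarrow> j < k \<Longrightarrow> ((\<lambda>x. N x i j) \<longlongrightarrow> M i j) F"
  shows "eventually (\<lambda>x. pd_kernel k (N x)) F"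
  using assms
proof (induction k arbitrary: M N)
  case 0
  then show ?case by (simp add: pd_kernel_def)
next
  case (Suc k)
  have pos: "Re (M k k) > 0" and pd: "pd_kernel k (schur_complement k M)"
    using Suc.prems(1) by (auto simp: pd_kernel_Suc)
  have nz: "M k k \<noteq> 0" using pos by auto
  have "eventually (\<lambda>x. pd_kernel k (schur_complement k (N x))) F"
  proof (rule Suc.IH[OF pd])
    show "herm_kernel k (schur_complement k (N x))" for x
      by (rule herm_kernel_schur[OF Suc.prems(2)])
    show "((\<lambda>x. schur_complement k (N x) i j) \<longlongrightarrow> schur_complement k M i j) F" if "i < k" "j < k" for i j
      unfolding schur_complement_def
      by (intro tendsto_intros Suc.prems(3) nz) (use that in auto)
  qed
  moreover have "eventually (\<lambda>x. Re (N x k k) > 0) F"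
    by (rule order_tendstoD(1)[OF tendsto_Re[OF Suc.prems(3)[of k k]] pos]) auto
  ultimately show ?case
    by eventually_elim (use Suc.prems(2) in \<open>auto simp: pd_kernel_Suc\<close>)
qed

lemma pd_kernel_cong:
  assumes "\<And>i j. i < k \<Longrightarrow> j < k \<Longrightarrow> M i j = N i j"
  shows "pd_kernel k M = pd_kernel k N"
proof -
  have "qform k M v = qform k N v" for v using assms by (simp add: qform_def)
  moreover have "herm_kernel k M = herm_kernel k N" unfolding herm_kernel_def using assms by metis
  ultimately show ?thesis by (simp add: pd_kernel_def)
qed

lemma dim_mat_adjoint [simp]:
  "dim_row (mat_adjoint A) = dim_col A" "dim_col (mat_adjoint A) = dim_row A"
  by (simp_all add: mat_adjoint_def)

lemma mat_adjoint_carrier [simp, intro]: "A \<in> carrier_mat r c \<Longrightarrow> mat_adjoint A \<in> carrier_mat c r"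
  unfolding carrier_mat_def by simp

lemma mat_adjoint_index [simp]:
  "i < dim_col A \<Longrightarrow> j < dim_row A \<Longrightarrow> mat_adjoint A $$ (i, j) = cnj (A $$ (j, i))"
  by (simp add: mat_adjoint_def mat_of_rows_def)

lemma qform_vec:
  assumes "A \<in> carrier_mat k k" "v \<in> carrier_vec k"
  shows "(A *\<^sub>v v) \<bullet>c v = qform k (\<lambda>i j. A $$ (i, j)) (vec_index v)"
proof -
  have [simp]: "dim_row A = k" "dim_col A = k" "dim_vec v = k" using assms by auto
  have "(A *\<^sub>v v) \<bullet>c v = (\<Sum>i<k. vec_index (A *\<^sub>v v) i * cnj (vec_index v i))"
    unfolding scalar_prod_def lessThan_atLeast0 by (intro sum.cong) simp_all
  also have "\<dots> = (\<Sum>i<k. (\<Sum>j<k. A $$ (i, j) * vec_index v j) * cnj (vec_index v i))"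
    by (intro sum.cong) (simp_all add: scalar_prod_def lessThan_atLeast0)
  also have "\<dots> = qform k (\<lambda>i j. A $$ (i, j)) (vec_index v)"
    unfolding qform_def sum_distrib_right by (intro sum.cong) (simp_all add: mult_ac)
  finally show ?thesis .
qed

lemma hermitian_iff_kernel:
  assumes "A \<in> carrier_mat k k"
  shows "hermitian A \<longleftrightarrow> herm_kernel k (\<lambda>i j. A $$ (i, j))"
proof
  assume h: "hermitian A"
  show "herm_kernel k (\<lambda>i j. A $$ (i, j))"
    unfolding herm_kernel_def
  proof (intro allI impI)
    fix i j assume ij: "i < k" "j < k"
    have "A $$ (j, i) = mat_adjoint A $$ (j, i)" using h by (simp add: hermitian_def)
    also have "\<dots> = cnj (A $$ (i, j))" by (rule mat_adjoint_index) (use ij assms in auto)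
    finally show "A $$ (j, i) = cnj (A $$ (i, j))" .
  qed
next
  assume h: "herm_kernel k (\<lambda>i j. A $$ (i, j))"
  show "hermitian A" unfolding hermitian_def
  proof (rule eq_matI)
    fix i j assume "i < dim_row A" "j < dim_col A"
    then have "i < k" "j < k" using assms by auto
    then have "cnj (A $$ (j, i)) = A $$ (i, j)" by (intro herm_kernelD[OF h, symmetric])
    then show "mat_adjoint A $$ (i, j) = A $$ (i, j)" using assms \<open>i < k\<close> \<open>j < k\<close> by simp
  qed (use assms in auto)
qed

lemma pos_def_iff_kernel:
  "pos_def k A \<longleftrightarrow> A \<in> carrier_mat k k \<and> pd_kernel k (\<lambda>i j. A $$ (i, j))"
proof (cases "A \<in> carrier_mat k k")
  case A: True
  have "(\<forall>v\<in>carrier_vec k. v \<noteq> 0\<^sub>v k \<longrightarrow> Re ((A *\<^sub>v v) \<bullet>c v) > 0) \<longleftrightarrow>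
    (\<forall>v. (\<exists>i<k. v i \<noteq> 0) \<longrightarrow> Re (qform k (\<lambda>i j. A $$ (i, j)) v) > 0)" (is "?L \<longleftrightarrow> ?R")
  proof
    assume L: ?L
    show ?R
    proof (intro allI impI)
      fix v :: "nat \<Rightarrow> complex" assume v: "\<exists>i<k. v i \<noteq> 0"
      obtain i where i: "i < k" "v i \<noteq> 0" using v by blast
      have "Matrix.vec k v \<noteq> 0\<^sub>v k"
      proof
        assume "Matrix.vec k v = 0\<^sub>v k"
        then have "vec_index (Matrix.vec k v) i = vec_index (0\<^sub>v k) i" by simp
        then show False using i by simp
      qed
      moreover have "Matrix.vec k v \<in> carrier_vec k" by simp
      ultimately have "Re ((A *\<^sub>v Matrix.vec k v) \<bullet>c Matrix.vec k v) > 0" using L by blast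
      moreover have "qform k (\<lambda>i j. A $$ (i, j)) (vec_index (Matrix.vec k v)) = qform k (\<lambda>i j. A $$ (i, j)) v"
        by (simp add: qform_def)
      ultimately show "Re (qform k (\<lambda>i j. A $$ (i, j)) v) > 0" using qform_vec[OF A, of "Matrix.vec k v"] by simp
    qed
  next
    assume R: ?R
    show ?L
    proof (intro ballI impI)
      fix v :: "complex vec" assume v: "v \<in> carrier_vec k" "v \<noteq> 0\<^sub>v k"
      have "\<exists>i<k. vec_index v i \<noteq> 0"
      proof (rule ccontr)
        assume "\<not> ?thesis"
        then have "v = 0\<^sub>v k" using v(1) by (intro eq_vecI) auto
        then show False using v(2) by simp
      qed
      then show "Re ((A *\<^sub>v v) \<bullet>c v) > 0" using R qform_vec[OF A v(1)] by auto
    qed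
  qed
  then show ?thesis unfolding pos_def_def pd_kernel_def hermitian_iff_kernel[OF A] using A by simp
qed (simp add: pos_def_def)

section \<open>Sums of squares on the unit circle\<close>

definition unity_root :: "nat \<Rightarrow> nat \<Rightarrow> complex" where
  "unity_root M m = cis (2 * pi * real m / real M)"

lemma norm_unity_root [simp]: "cmod (unity_root M m) = 1"
  by (simp add: unity_root_def)

text \<open>A geometric sum whose ratio is an \<open>M\<close>-th root of unity. The ratio equals 1 only when
  \<open>M\<close> divides \<open>k - l\<close>, and the size restriction leaves only \<open>k = l\<close>.\<close>

lemma sum_unity_root_powers:
  assumes "k < M + l" "l < M + k"
  shows "(\<Sum>m<M. unity_root M m ^ k * cnj (unity_root M m) ^ l) = (if k = l then of_nat M else 0)"
proof -
  have M: "M > 0" using assms by linarith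
  define \<zeta> where "\<zeta> = cis (2 * pi * (real k - real l) / real M)"
  have term_eq: "unity_root M m ^ k * cnj (unity_root M m) ^ l = \<zeta> ^ m" for m
  proof -
    have "unity_root M m ^ k * cnj (unity_root M m) ^ l
        = cis (real k * (2 * pi * real m / real M)) * cis (real l * (- (2 * pi * real m / real M)))"
      by (simp add: unity_root_def cis_cnj Complex.DeMoivre)
    also have "\<dots> = cis (real m * (2 * pi * (real k - real l) / real M))"
      unfolding cis_mult by (rule arg_cong[of _ _ cis]) (use M in \<open>simp add: field_simps\<close>)
    finally show ?thesis by (simp add: \<zeta>_def Complex.DeMoivre)
  qed
  show ?thesis
  proof (cases "k = l")
    case True
    then have "\<zeta> = 1" by (simp add: \<zeta>_def)
    then show ?thesis unfolding term_eq using True by simp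
  next
    case False
    have "\<zeta> \<noteq> 1"
    proof
      assume "\<zeta> = 1"
      then have "cos (2 * pi * (real k - real l) / real M) = 1" by (simp add: \<zeta>_def complex_eq_iff)
      then obtain i :: int where "2 * pi * (real k - real l) / real M = of_int i * 2 * pi"
        using cos_one_2pi_int by blast
      then have "2 * pi * (real k - real l) = 2 * pi * (of_int i * real M)" using M by (simp add: field_simps)
      then have "real k - real l = of_int i * real M" by (subst (asm) mult_cancel_left) simp
      then have "of_int (int k - int l) = (of_int (i * int M) :: real)" by simp
      then have e: "int k - int l = i * int M" using of_int_eq_iff by blast
      then have "i \<noteq> 0" using False by auto
      then have "1 * int M \<le> \<bar>i\<bar> * int M" by (intro mult_right_mono) auto
      then have "int M \<le> \<bar>i * int M\<bar>" by (simp add: abs_mult)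
      then show False using e assms by linarith
    qed
    moreover have "\<zeta> ^ M = 1"
    proof -
      have "\<zeta> ^ M = cis (2 * pi * of_int (int k - int l))" using M unfolding \<zeta>_def Complex.DeMoivre by simp
      then show ?thesis using cis_multiple_2pi[of "of_int (int k - int l)"] by simp
    qed
    ultimately show ?thesis unfolding term_eq using False by (simp add: sum_gp_strict)
  qed
qed

lemma count_shifted_pairs:
  fixes a b N :: nat
  assumes "a < N" "b < N"
  shows "(\<Sum>t<N. \<Sum>u<N. if a + u = b + t then 1 else 0 :: nat) = N - (b - a) - (a - b)"
proof -
  have "(\<Sum>u<N. if a + u = b + t then 1 else 0 :: nat) = (if t \<in> {a - b..<N - (b - a)} then 1 else 0)"
    if "t < N" for t
  proof (cases "a \<le> b + t")
    case True
    have "(\<Sum>u<N. if a + u = b + t then 1 else 0 :: nat) = (\<Sum>u<N. if u = b + t - a then 1 else 0)"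
      using True by (intro sum.cong) auto
    also have "\<dots> = (if b + t - a < N then 1 else 0)" by (simp add: sum.delta)
    finally show ?thesis using True assms that by auto
  next
    case False
    then have "(\<Sum>u<N. if a + u = b + t then 1 else 0 :: nat) = 0" by (intro sum.neutral) auto
    then show ?thesis using False by auto
  qed
  then have "(\<Sum>t<N. \<Sum>u<N. if a + u = b + t then 1 else 0 :: nat)
      = (\<Sum>t<N. if t \<in> {a - b..<N - (b - a)} then 1 else 0)" by (intro sum.cong) auto
  also have "\<dots> = card ({..<N} \<inter> {a - b..<N - (b - a)})"
    by (subst sum.inter_restrict[symmetric]) simp_all
  also have "{..<N} \<inter> {a - b..<N - (b - a)} = {a - b..<N - (b - a)}" by auto
  finally show ?thesis by simp
qed

text \<open>On the unit circle, \<open>1 / N\<close> times the squared modulus of this sum is the Fejer kernel.\<close>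

definition dirichlet_sum :: "nat \<Rightarrow> complex \<Rightarrow> complex" where
  "dirichlet_sum N x = (\<Sum>t<N. x ^ t)"

text \<open>Convolution with the Fejer kernel multiplies the frequency \<open>a - b\<close> by
  \<open>1 - \<bar>a - b\<bar> / N\<close>. The integral over the circle may be replaced by the mean over \<open>2 N\<close> nodes,
  because all frequencies in the integrand are smaller than \<open>2 N\<close>. The factor in the conclusion is
  \<open>N - \<bar>a - b\<bar>\<close>, written with truncated subtraction.\<close>

lemma fejer_quadrature:
  assumes z: "cmod z = 1" and ab: "a < N" "b < N"
  shows "(\<Sum>m<2 * N. dirichlet_sum N (z * cnj (unity_root (2 * N) m))
            * cnj (dirichlet_sum N (z * cnj (unity_root (2 * N) m)))
            * (unity_root (2 * N) m ^ a * cnj (unity_root (2 * N) m) ^ b))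
       = of_nat (2 * N) * of_nat (N - (b - a) - (a - b)) * (z ^ a * cnj z ^ b)"
proof -
  let ?w = "unity_root (2 * N)"
  have zz: "z * cnj z = 1" using z by (metis complex_norm_square of_real_1 power_one)
  have "(\<Sum>m<2 * N. dirichlet_sum N (z * cnj (?w m)) * cnj (dirichlet_sum N (z * cnj (?w m))) * (?w m ^ a * cnj (?w m) ^ b))
      = (\<Sum>m<2 * N. \<Sum>t<N. \<Sum>u<N. z ^ t * cnj z ^ u * (?w m ^ (a + u) * cnj (?w m) ^ (b + t)))"
  proof (rule sum.cong[OF refl])
    fix m
    have "dirichlet_sum N (z * cnj (?w m)) * cnj (dirichlet_sum N (z * cnj (?w m))) * (?w m ^ a * cnj (?w m) ^ b)
      = (\<Sum>t<N. \<Sum>u<N. (z * cnj (?w m)) ^ t * (cnj z * ?w m) ^ u * (?w m ^ a * cnj (?w m) ^ b))"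
      unfolding dirichlet_sum_def cnj_sum unfolding sum_product unfolding sum_distrib_right
      by (intro sum.cong refl) simp
    also have "\<dots> = (\<Sum>t<N. \<Sum>u<N. z ^ t * cnj z ^ u * (?w m ^ (a + u) * cnj (?w m) ^ (b + t)))"
      by (intro sum.cong refl) (simp only: power_mult_distrib power_add mult_ac)
    finally show "dirichlet_sum N (z * cnj (?w m)) * cnj (dirichlet_sum N (z * cnj (?w m))) * (?w m ^ a * cnj (?w m) ^ b)
      = (\<Sum>t<N. \<Sum>u<N. z ^ t * cnj z ^ u * (?w m ^ (a + u) * cnj (?w m) ^ (b + t)))" .
  qed
  also have "\<dots> = (\<Sum>t<N. \<Sum>u<N. z ^ t * cnj z ^ u * (\<Sum>m<2 * N. ?w m ^ (a + u) * cnj (?w m) ^ (b + t)))"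
    unfolding sum_distrib_left
    by (subst sum.swap) (intro sum.cong refl sum.swap)
  also have "\<dots> = (\<Sum>t<N. \<Sum>u<N. of_nat (2 * N) * (z ^ a * cnj z ^ b) * of_nat (if a + u = b + t then 1 else 0))"
  proof (intro sum.cong refl)
    fix t u assume tu: "t \<in> {..<N}" "u \<in> {..<N}"
    have s: "(\<Sum>m<2 * N. ?w m ^ (a + u) * cnj (?w m) ^ (b + t)) = (if a + u = b + t then of_nat (2 * N) else 0)"
      by (rule sum_unity_root_powers) (use tu ab in auto)
    have "z ^ t * cnj z ^ u = z ^ a * cnj z ^ b" if e: "a + u = b + t"
    proof -
      have "z ^ t * cnj z ^ u = z ^ t * cnj z ^ u * (z * cnj z) ^ b" by (simp add: zz)
      also have "\<dots> = z ^ (b + t) * cnj z ^ (b + u)" by (simp add: power_mult_distrib power_add mult_ac)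
      also have "\<dots> = z ^ (a + u) * cnj z ^ (b + u)" by (simp add: e)
      also have "\<dots> = z ^ a * cnj z ^ b * (z * cnj z) ^ u" by (simp add: power_mult_distrib power_add mult_ac)
      finally show ?thesis by (simp add: zz)
    qed
    then show "z ^ t * cnj z ^ u * (\<Sum>m<2 * N. ?w m ^ (a + u) * cnj (?w m) ^ (b + t))
      = of_nat (2 * N) * (z ^ a * cnj z ^ b) * of_nat (if a + u = b + t then 1 else 0)"
      unfolding s by simp
  qed
  also have "\<dots> = of_nat (2 * N) * (z ^ a * cnj z ^ b) * of_nat (\<Sum>t<N. \<Sum>u<N. if a + u = b + t then 1 else 0)"
    unfolding of_nat_sum sum_distrib_left ..
  finally show ?thesis unfolding count_shifted_pairs[OF ab] by (simp add: mult_ac)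
qed

text \<open>The weights \<open>N / (N - \<bar>a - b\<bar>)\<close> that undo the damping by the Fejer kernel disappear in the
  limit of large \<open>N\<close>.\<close>

lemma weights_tendsto_1: "(\<lambda>k. of_nat (Suc (D + k)) / of_nat (Suc (D + k) - d - e) :: complex) \<longlonglongrightarrow> 1"
  if "d + e \<le> D" for d e
proof -
  have "(\<lambda>k. 1 + of_real (real (d + e) / real (Suc (D - (d + e)) + k)) :: complex) \<longlonglongrightarrow> 1 + of_real 0"
    by (intro tendsto_intros real_tendsto_divide_at_top[OF tendsto_const]) real_asymp
  moreover have "1 + of_real (real (d + e) / real (Suc (D - (d + e)) + k))
      = (of_nat (Suc (D + k)) / of_nat (Suc (D + k) - d - e) :: complex)" for k
  proof -
    define x where "x = Suc (D - (d + e)) + k"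
    have x: "x > 0" "Suc (D + k) - d - e = x" "Suc (D + k) = x + (d + e)" using that by (auto simp: x_def)
    show ?thesis unfolding x(2) unfolding x(3) x_def[symmetric] using x(1) by (simp add: field_simps)
  qed
  ultimately show ?thesis by simp
qed

text \<open>A weak form of the matrix Fejer-Riesz theorem, in which the factor may be wide. Let \<open>R'\<close> be
  \<open>R\<close> with its coefficients divided by the damping factors of the Fejer kernel. By
  \<open>fejer_quadrature\<close>, \<open>R z\<close> is the sum over the nodes \<open>w\<close> of \<open>R' w\<close> with a weight that is the squared
  modulus of a polynomial in \<open>z\<close>. For large \<open>N\<close> the values \<open>R' w\<close> are positive definite,
  uniformly on the circle by compactness, and a constant factorization at every node gives the
  columns of the factor of \<open>R\<close>.\<close>

lemma trig_poly_pd_sum_of_squares: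
  fixes c :: "nat \<Rightarrow> nat \<Rightarrow> nat \<Rightarrow> nat \<Rightarrow> complex" and D :: nat
  defines "R \<equiv> \<lambda>z i j. \<Sum>a\<le>D. \<Sum>b\<le>D. c i j a b * (z ^ a * cnj z ^ b)"
  assumes herm: "\<And>i j a b. i < n \<Longrightarrow> j < n \<Longrightarrow> c j i b a = cnj (c i j a b)"
    and pd: "\<And>z. cmod z = 1 \<Longrightarrow> pd_kernel n (R z)"
  shows "\<exists>L m (f :: nat \<Rightarrow> nat \<Rightarrow> complex poly). D \<le> L \<and> (\<forall>i l. degree (f i l) \<le> L) \<and>
    (\<forall>z i j. cmod z = 1 \<longrightarrow> i < n \<longrightarrow> j < n \<longrightarrow>
       R z i j = (\<Sum>l<m. poly (f i l) z * cnj (poly (f j l) z)))"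
proof -
  define W where "W N a b = (of_nat N / of_nat (N - (b - a) - (a - b)) :: complex)" for N a b :: nat
  define R' where "R' N z i j = (\<Sum>a\<le>D. \<Sum>b\<le>D. W N a b * c i j a b * (z ^ a * cnj z ^ b))" for N z i j
  have W_sym: "W N b a = W N a b" for N a b
    by (simp add: W_def add.commute)
  have cnj_W: "cnj (W N a b) = W N a b" for N a b by (simp add: W_def)
  have herm': "herm_kernel n (R' N z)" for N z
    unfolding herm_kernel_def
  proof (intro allI impI)
    fix i j assume ij: "i < n" "j < n"
    have "R' N z j i = (\<Sum>a\<le>D. \<Sum>b\<le>D. W N b a * c j i b a * (z ^ b * cnj z ^ a))"
      unfolding R'_def by (rule sum.swap)
    also have "\<dots> = cnj (R' N z i j)"
      unfolding R'_def cnj_sum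
      by (intro sum.cong refl) (simp add: herm[OF ij] W_sym cnj_W mult_ac)
    finally show "R' N z j i = cnj (R' N z i j)" .
  qed
  have "\<exists>k. \<forall>z. cmod z = 1 \<longrightarrow> pd_kernel n (R' (Suc (D + k)) z)"
  proof (rule ccontr)
    assume "\<not> ?thesis"
    then obtain Z where Z: "\<And>k. cmod (Z k) = 1" "\<And>k. \<not> pd_kernel n (R' (Suc (D + k)) (Z k))"
      by metis
    have "\<forall>k. Z k \<in> sphere 0 1" using Z(1) by simp
    then obtain l r where l: "l \<in> sphere 0 1" and r: "strict_mono r" and lim: "(Z \<circ> r) \<longlonglongrightarrow> l"
      by (rule seq_compactE[OF compact_imp_seq_compact[OF compact_sphere]])
    have lim': "(\<lambda>k. Z (r k)) \<longlonglongrightarrow> l" using lim by (simp add: o_def)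
    have "eventually (\<lambda>k. pd_kernel n (R' (Suc (D + r k)) (Z (r k)))) sequentially"
    proof (rule pd_kernel_eventually[OF pd herm'])
      show "cmod l = 1" using l by simp
      fix i j
      have "(\<lambda>k. W (Suc (D + r k)) a b) \<longlonglongrightarrow> 1" if "a \<le> D" "b \<le> D" for a b
        using LIMSEQ_subseq_LIMSEQ[OF weights_tendsto_1[of "b - a" "a - b" D] r] that
        by (simp add: W_def o_def)
      then have "(\<lambda>k. R' (Suc (D + r k)) (Z (r k)) i j) \<longlonglongrightarrow> (\<Sum>a\<le>D. \<Sum>b\<le>D. 1 * c i j a b * (l ^ a * cnj l ^ b))"
        unfolding R'_def by (intro tendsto_intros lim') auto
      then show "(\<lambda>k. R' (Suc (D + r k)) (Z (r k)) i j) \<longlonglongrightarrow> R l i j" by (simp add: R_def)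
    qed
    then show False using Z(2) by simp
  qed
  then obtain k where k: "\<And>z. cmod z = 1 \<Longrightarrow> pd_kernel n (R' (Suc (D + k)) z)" by blast
  define N where "N = Suc (D + k)"
  define w where "w = unity_root (2 * N)"
  have "\<exists>S. \<forall>i<n. \<forall>j<n. R' N (w m) i j = (\<Sum>l<n. S i l * cnj (S j l))" for m
    by (rule pd_kernel_factor) (simp add: N_def k w_def)
  then obtain S where S: "\<And>m i j. i < n \<Longrightarrow> j < n \<Longrightarrow> R' N (w m) i j = (\<Sum>l<n. S m i l * cnj (S m j l))"
    by metis
  \<comment> \<open>The normalization \<open>1 / (2 N\<^sup>2)\<close> of the quadrature, shared by the two factors.\<close>
  define \<rho> where "\<rho> = complex_of_real (1 / sqrt (real (2 * N * N)))"
  have N: "N > 0" by (simp add: N_def)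
  have rho: "\<rho> * cnj \<rho> = 1 / of_nat (2 * N * N)"
  proof -
    define x where "x = real (2 * N * N)"
    have "x > 0" using N by (simp add: x_def)
    then have "1 / sqrt x * (1 / sqrt x) = 1 / x" by simp
    then have "\<rho> * cnj \<rho> = complex_of_real (1 / x)"
      unfolding \<rho>_def x_def[symmetric] complex_cnj_complex_of_real of_real_mult[symmetric] by simp
    then show ?thesis by (simp add: x_def)
  qed
  define g where "g i = (\<lambda>(m, l). \<Sum>t<N. monom (\<rho> * S m i l * cnj (w m) ^ t) t)" for i
  have deg: "degree (g i e) \<le> N" for i e
  proof -
    have "degree (\<Sum>t<N. monom (\<rho> * S m i l * cnj (w m) ^ t) t) \<le> N" for m l
      by (rule degree_sum_le) (auto intro: order_trans[OF degree_monom_le])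
    then show ?thesis by (simp add: g_def split_beta)
  qed
  have g_eval: "poly (g i (m, l)) z = \<rho> * S m i l * dirichlet_sum N (z * cnj (w m))" for i m l z
    by (simp add: g_def dirichlet_sum_def poly_sum poly_monom sum_distrib_left power_mult_distrib mult_ac)
  define I where "I = {..<2 * N} \<times> {..<n}"
  obtain h where h: "bij_betw h {0..<card I} I"
    using ex_bij_betw_nat_finite[of I] by (auto simp: I_def)
  have "R z i j = (\<Sum>l<card I. poly (g i (h l)) z * cnj (poly (g j (h l)) z))"
    if z: "cmod z = 1" and ij: "i < n" "j < n" for z i j
  proof -
    let ?K = "\<lambda>m. dirichlet_sum N (z * cnj (w m))"
    have "(\<Sum>l<card I. poly (g i (h l)) z * cnj (poly (g j (h l)) z))
        = (\<Sum>e\<in>I. poly (g i e) z * cnj (poly (g j e) z))"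
      unfolding lessThan_atLeast0 by (rule sum.reindex_bij_betw[OF h])
    also have "\<dots> = (\<Sum>m<2 * N. \<Sum>l<n. poly (g i (m, l)) z * cnj (poly (g j (m, l)) z))"
      by (simp add: I_def sum.cartesian_product)
    also have "\<dots> = (\<Sum>m<2 * N. (\<rho> * cnj \<rho>) * (?K m * cnj (?K m)) * (\<Sum>l<n. S m i l * cnj (S m j l)))"
      by (simp add: g_eval sum_distrib_left mult_ac)
    also have "\<dots> = (\<Sum>m<2 * N. (\<rho> * cnj \<rho>) * (?K m * cnj (?K m)) * R' N (w m) i j)"
      by (simp add: S[OF ij])
    also have "\<dots> = (\<Sum>m<2 * N. \<Sum>a\<le>D. \<Sum>b\<le>D. (\<rho> * cnj \<rho>) * W N a b * c i j a b * (?K m * cnj (?K m) * (w m ^ a * cnj (w m) ^ b)))"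
      unfolding R'_def sum_distrib_left by (intro sum.cong refl) (simp add: mult_ac)
    also have "\<dots> = (\<Sum>a\<le>D. \<Sum>b\<le>D. (\<rho> * cnj \<rho>) * W N a b * c i j a b * (\<Sum>m<2 * N. ?K m * cnj (?K m) * (w m ^ a * cnj (w m) ^ b)))"
      unfolding sum_distrib_left by (subst sum.swap) (intro sum.cong refl sum.swap)
    also have "\<dots> = R z i j"
      unfolding R_def
    proof (intro sum.cong refl)
      fix a b assume ab: "a \<in> {..D}" "b \<in> {..D}"
      then have ab': "a < N" "b < N" "N - (b - a) - (a - b) > 0" by (auto simp: N_def)
      have q: "(\<Sum>m<2 * N. ?K m * cnj (?K m) * (w m ^ a * cnj (w m) ^ b))
          = of_nat (2 * N) * of_nat (N - (b - a) - (a - b)) * (z ^ a * cnj z ^ b)"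
        unfolding w_def by (rule fejer_quadrature[OF z ab'(1,2)])
      define d where "d = N - (b - a) - (a - b)"
      have "d > 0" using ab'(3) by (simp add: d_def)
      then show "\<rho> * cnj \<rho> * W N a b * c i j a b * (\<Sum>m<2 * N. ?K m * cnj (?K m) * (w m ^ a * cnj (w m) ^ b)) = c i j a b * (z ^ a * cnj z ^ b)"
        unfolding q rho W_def d_def[symmetric] using N by (simp add: field_simps)
    qed
    finally show ?thesis by simp
  qed
  moreover have "D \<le> N" by (simp add: N_def)
  ultimately show ?thesis by (intro exI[of _ N] exI[of _ "card I"] exI[of _ "\<lambda>i l. g i (h l)"] conjI allI impI deg)
qed

section \<open>From the circle to the imaginary axis\<close>

text \<open>The entries of \<open>u u\<^sup>* I - V V\<^sup>*\<close>: positive definiteness says that \<open>V / u\<close> is a strict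
  contraction.\<close>

definition gram_defect :: "nat \<Rightarrow> complex \<Rightarrow> (nat \<Rightarrow> nat \<Rightarrow> complex) \<Rightarrow> nat \<Rightarrow> nat \<Rightarrow> complex" where
  "gram_defect p u V i j = (if i = j then u * cnj u else 0) - (\<Sum>l<p. V i l * cnj (V j l))"

lemma gram_defect_scale:
  "gram_defect p (x * u) (\<lambda>i l. x * V i l) i j = (x * cnj x) * gram_defect p u V i j"
  by (simp add: gram_defect_def sum_distrib_left algebra_simps)

lemma pd_kernel_scale:
  assumes "pd_kernel k M" "x \<noteq> 0"
  shows "pd_kernel k (\<lambda>i j. (x * cnj x) * M i j)"
proof -
  have x: "x * cnj x = complex_of_real ((cmod x)\<^sup>2)" by (rule complex_norm_square[symmetric])
  have "qform k (\<lambda>i j. (x * cnj x) * M i j) v = (x * cnj x) * qform k M v" for v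
    unfolding qform_def sum_distrib_left by (intro sum.cong refl) (simp only: mult_ac)
  then have "Re (qform k (\<lambda>i j. (x * cnj x) * M i j) v) = (cmod x)\<^sup>2 * Re (qform k M v)" for v
    by (simp add: x del: of_real_power)
  moreover have "(cmod x)\<^sup>2 > 0" using assms(2) by simp
  moreover have "herm_kernel k (\<lambda>i j. (x * cnj x) * M i j)"
    unfolding herm_kernel_def
  proof (intro allI impI)
    fix i j assume "i < k" "j < k"
    then have "M j i = cnj (M i j)" using assms(1) by (intro herm_kernelD) (auto simp: pd_kernel_def)
    then show "x * cnj x * M j i = cnj (x * cnj x * M i j)" by simp
  qed
  ultimately show ?thesis using assms(1) by (simp add: pd_kernel_def)
qed

text \<open>For \<open>degree p \<le> D\<close>, the polynomial \<open>(1 + s)\<^sup>D p((1 - s) / (1 + s))\<close>. The map \<open>s \<mapsto> (1 - s) / (1 + s)\<close> is an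
  involution that exchanges the imaginary axis and the unit circle, so the same transform serves in
  both directions.\<close>

definition cayley :: "nat \<Rightarrow> complex poly \<Rightarrow> complex poly" where
  "cayley D p = (\<Sum>k\<le>D. Polynomial.smult (coeff p k) ([:1, -1:] ^ k * [:1, 1:] ^ (D - k)))"

lemma poly_eq_sum_upto: "degree p \<le> D \<Longrightarrow> poly p x = (\<Sum>k\<le>D. coeff p k * x ^ k)"
  for p :: "complex poly"
  unfolding poly_altdef by (rule sum.mono_neutral_left) (auto simp: coeff_eq_0)

lemma degree_cayley: "degree (cayley D p) \<le> D"
  unfolding cayley_def
proof (rule degree_sum_le)
  fix k assume "k \<in> {..D}"
  have "degree ([:1, -1:] ^ k * [:1, 1:] ^ (D - k) :: complex poly)
      \<le> degree ([:1, -1:] :: complex poly) * k + degree ([:1, 1:] :: complex poly) * (D - k)"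
    by (meson add_mono degree_mult_le degree_power_le order_trans)
  also have "\<dots> = D" using \<open>k \<in> {..D}\<close> by simp
  finally show "degree (Polynomial.smult (coeff p k) ([:1, -1:] ^ k * [:1, 1:] ^ (D - k))) \<le> D"
    using degree_smult_le order_trans by blast
qed simp

lemma power_mult_quotient:
  fixes w :: complex
  assumes "w \<noteq> 0" "k \<le> D"
  shows "w ^ D * (v / w) ^ k = v ^ k * w ^ (D - k)"
proof -
  have "w ^ D = w ^ (D - k) * w ^ k" using assms(2) by (simp flip: power_add)
  then show ?thesis using assms(1) by (simp add: power_divide)
qed

lemma poly_cayley:
  assumes "degree p \<le> D" "s \<noteq> -1"
  shows "poly (cayley D p) s = (1 + s) ^ D * poly p ((1 - s) / (1 + s))"
proof -
  have nz: "1 + s \<noteq> 0" using assms(2) by (metis add.inverse_inverse add_eq_0_iff)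
  have "poly (cayley D p) s = (\<Sum>k\<le>D. coeff p k * ((1 - s) ^ k * (1 + s) ^ (D - k)))"
    by (simp add: cayley_def poly_sum poly_power)
  also have "\<dots> = (\<Sum>k\<le>D. (1 + s) ^ D * (coeff p k * ((1 - s) / (1 + s)) ^ k))"
    by (intro sum.cong refl) (simp add: power_mult_quotient[OF nz])
  finally show ?thesis unfolding poly_eq_sum_upto[OF assms(1)] sum_distrib_left .
qed

text \<open>The point \<open>-1\<close> of the circle is the image of infinity, so the value there is the
  coefficient that governs the behaviour at infinity.\<close>

lemma poly_cayley_minus_one: "poly (cayley D p) (-1) = 2 ^ D * coeff p D"
proof -
  have "poly (cayley D p) (-1) = (\<Sum>k\<le>D. if k = D then 2 ^ D * coeff p D else 0)"
    unfolding cayley_def poly_sum by (intro sum.cong refl) (auto simp: poly_power)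
  then show ?thesis by simp
qed

lemma axis_to_circle:
  assumes "Re s = 0"
  shows "s \<noteq> -1" "cmod ((1 - s) / (1 + s)) = 1" "(1 - s) / (1 + s) \<noteq> -1"
    "(1 - (1 - s) / (1 + s)) / (1 + (1 - s) / (1 + s)) = s"
    "1 + (1 - s) / (1 + s) = 2 / (1 + s)"
proof -
  show s: "s \<noteq> -1" using assms by auto
  then have nz: "1 + s \<noteq> 0" by (metis add.inverse_inverse add_eq_0_iff)
  have "cmod (1 - s) = cmod (1 + s)" using assms by (simp add: cmod_def)
  then show "cmod ((1 - s) / (1 + s)) = 1" using nz by (simp add: norm_divide)
  show e: "1 + (1 - s) / (1 + s) = 2 / (1 + s)" using nz by (simp add: field_simps)
  show "(1 - s) / (1 + s) \<noteq> -1" using e nz by auto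
  have "1 - (1 - s) / (1 + s) = 2 * s / (1 + s)" using nz by (simp add: field_simps)
  then show "(1 - (1 - s) / (1 + s)) / (1 + (1 - s) / (1 + s)) = s" using e nz by simp
qed

lemma circle_to_axis:
  assumes "cmod z = 1" "z \<noteq> -1"
  shows "Re ((1 - z) / (1 + z)) = 0"
proof -
  have nz: "1 + z \<noteq> 0" using assms(2) by (metis add.inverse_inverse add_eq_0_iff)
  have "z * cnj z = 1" using assms(1) by (metis complex_norm_square of_real_1 power_one)
  moreover have "1 + cnj z \<noteq> 0" using nz by (metis complex_cnj_add complex_cnj_one complex_cnj_zero_iff)
  ultimately have "cnj ((1 - z) / (1 + z)) = - ((1 - z) / (1 + z))"
    using nz by (simp add: field_simps)
  then have "Re u = 0" if "u = (1 - z) / (1 + z)" for u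
    unfolding that[symmetric] by (simp add: complex_eq_iff)
  then show ?thesis by simp
qed

text \<open>The sum of squares on the axis. The data are moved to the circle, where the assumption at
  infinity supplies the missing point \<open>-1\<close>, and the factor is moved back. The factor may have larger
  degree than the data; clearing denominators then costs the common multiplier \<open>g\<close>, a constant times a
  power of \<open>1 + s\<close>.\<close>

lemma gram_defect_factor_axis:
  fixes q :: "complex poly" and N :: "nat \<Rightarrow> nat \<Rightarrow> complex poly"
  assumes deg: "degree q \<le> D" "\<And>i l. degree (N i l) \<le> D"
    and axis: "\<And>s. Re s = 0 \<Longrightarrow> pd_kernel n (gram_defect p (poly q s) (\<lambda>i l. poly (N i l) s))"
    and infinity: "pd_kernel n (gram_defect p (coeff q D) (\<lambda>i l. coeff (N i l) D))"
  shows "\<exists>g m (F :: nat \<Rightarrow> nat \<Rightarrow> complex poly). (\<forall>s. poly g s = 0 \<longrightarrow> Re s < 0) \<and>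
    (\<forall>s i j. Re s = 0 \<longrightarrow> i < n \<longrightarrow> j < n \<longrightarrow>
       (\<Sum>l<m. poly (F i l) s * cnj (poly (F j l) s))
       = gram_defect p (poly (g * q) s) (\<lambda>i l. poly (g * N i l) s) i j)"
proof -
  define q' where "q' = cayley D q"
  define N' where "N' i l = cayley D (N i l)" for i l
  define c where "c i j a b = (if i = j then coeff q' a * cnj (coeff q' b) else 0)
    - (\<Sum>l<p. coeff (N' i l) a * cnj (coeff (N' j l) b))" for i j a b
  define R where "R z i j = (\<Sum>a\<le>D. \<Sum>b\<le>D. c i j a b * (z ^ a * cnj z ^ b))" for z i j
  have deg': "degree q' \<le> D" "degree (N' i l) \<le> D" for i l
    by (simp_all add: q'_def N'_def degree_cayley)
  have prod: "poly u z * cnj (poly v z) = (\<Sum>a\<le>D. \<Sum>b\<le>D. coeff u a * cnj (coeff v b) * (z ^ a * cnj z ^ b))"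
    if "degree u \<le> D" "degree v \<le> D" for u v :: "complex poly" and z
    unfolding poly_eq_sum_upto[OF that(1)] poly_eq_sum_upto[OF that(2)] cnj_sum sum_product
    by (intro sum.cong refl) (simp add: mult_ac)
  have R: "R z i j = gram_defect p (poly q' z) (\<lambda>i l. poly (N' i l) z) i j" for z i j
  proof -
    have "(\<Sum>l<p. poly (N' i l) z * cnj (poly (N' j l) z))
        = (\<Sum>a\<le>D. \<Sum>b\<le>D. (\<Sum>l<p. coeff (N' i l) a * cnj (coeff (N' j l) b)) * (z ^ a * cnj z ^ b))"
      unfolding prod[OF deg'(2) deg'(2)] sum_distrib_right
      by (subst sum.swap) (intro sum.cong refl sum.swap)
    then show ?thesis
      unfolding gram_defect_def prod[OF deg'(1) deg'(1)] R_def c_def left_diff_distrib sum_subtractf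
      by simp
  qed
  have pd: "pd_kernel n (R z)" if z: "cmod z = 1" for z
  proof (cases "z = -1")
    case True
    have "R z = (\<lambda>i j. (2 ^ D * cnj (2 ^ D)) * gram_defect p (coeff q D) (\<lambda>i l. coeff (N i l) D) i j)"
      unfolding True R q'_def N'_def poly_cayley_minus_one gram_defect_scale by (intro ext) (simp only: R)
    then show ?thesis using pd_kernel_scale[OF infinity, of "2 ^ D"] by simp
  next
    case False
    define s where "s = (1 - z) / (1 + z)"
    have nz: "1 + z \<noteq> 0" using False by (metis add.inverse_inverse add_eq_0_iff)
    have "R z = (\<lambda>i j. ((1 + z) ^ D * cnj ((1 + z) ^ D)) * gram_defect p (poly q s) (\<lambda>i l. poly (N i l) s) i j)"
      unfolding R q'_def N'_def poly_cayley[OF deg(1) False] poly_cayley[OF deg(2) False] s_def[symmetric]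
        gram_defect_scale[symmetric]
      by (intro ext) (simp add: R q'_def N'_def poly_cayley[OF deg(1) False] poly_cayley[OF deg(2) False] s_def)
    moreover have "Re s = 0" unfolding s_def by (rule circle_to_axis[OF z False])
    ultimately show ?thesis using pd_kernel_scale[OF axis, of s "(1 + z) ^ D"] nz by simp
  qed
  have "\<exists>L m (f :: nat \<Rightarrow> nat \<Rightarrow> complex poly). D \<le> L \<and> (\<forall>i l. degree (f i l) \<le> L) \<and>
    (\<forall>z i j. cmod z = 1 \<longrightarrow> i < n \<longrightarrow> j < n \<longrightarrow>
       (\<Sum>a\<le>D. \<Sum>b\<le>D. c i j a b * (z ^ a * cnj z ^ b)) = (\<Sum>l<m. poly (f i l) z * cnj (poly (f j l) z)))"
  proof (rule trig_poly_pd_sum_of_squares)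
    fix i j a b
    show "c j i b a = cnj (c i j a b)" by (simp add: c_def cnj_sum mult.commute)
  next
    fix z :: complex assume "cmod z = 1"
    then have "pd_kernel n (R z)" by (rule pd)
    then show "pd_kernel n (\<lambda>i j. \<Sum>a\<le>D. \<Sum>b\<le>D. c i j a b * (z ^ a * cnj z ^ b))"
      unfolding R_def[abs_def] .
  qed
  then obtain L m and f :: "nat \<Rightarrow> nat \<Rightarrow> complex poly" where L: "D \<le> L" and degf: "\<And>i l. degree (f i l) \<le> L"
    and f: "\<And>z i j. cmod z = 1 \<Longrightarrow> i < n \<Longrightarrow> j < n \<Longrightarrow> R z i j = (\<Sum>l<m. poly (f i l) z * cnj (poly (f j l) z))"
    unfolding R_def[symmetric] by blast
  \<comment> \<open>\<open>(1 + s)\<^sup>L\<close> comes from the transform of the factor, \<open>(1 + z)\<^sup>D = 2\<^sup>D / (1 + s)\<^sup>D\<close> from that of the data.\<close>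
  define g :: "complex poly" where "g = Polynomial.smult (2 ^ D) ([:1, 1:] ^ (L - D))"
  have g: "poly g s = 2 ^ D * (1 + s) ^ (L - D)" for s by (simp add: g_def poly_power)
  have "Re s < 0" if "poly g s = 0" for s
  proof -
    have "1 + s = 0" using that unfolding g by simp
    then have "s = -1" by (metis add.inverse_inverse add_eq_0_iff)
    then show ?thesis by simp
  qed
  moreover have "(\<Sum>l<m. poly (cayley L (f i l)) s * cnj (poly (cayley L (f j l)) s))
       = gram_defect p (poly (g * q) s) (\<lambda>i l. poly (g * N i l) s) i j"
    if s: "Re s = 0" and ij: "i < n" "j < n" for s i j
  proof -
    define z where "z = (1 - s) / (1 + s)"
    note zs = axis_to_circle[OF s, folded z_def]
    have nz: "1 + s \<noteq> 0" using zs(1) by (metis add.inverse_inverse add_eq_0_iff)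
    have G: "poly g s = (1 + s) ^ L * (1 + z) ^ D"
      unfolding g zs(5) power_mult_quotient[OF nz L] ..
    have "(\<Sum>l<m. poly (cayley L (f i l)) s * cnj (poly (cayley L (f j l)) s))
      = ((1 + s) ^ L * cnj ((1 + s) ^ L)) * R z i j"
      unfolding poly_cayley[OF degf zs(1)] z_def[symmetric] f[OF zs(2) ij] sum_distrib_left
      by (intro sum.cong refl) (simp add: mult_ac)
    also have "R z i j = ((1 + z) ^ D * cnj ((1 + z) ^ D)) * gram_defect p (poly q s) (\<lambda>i l. poly (N i l) s) i j"
      unfolding gram_defect_scale[symmetric] R q'_def N'_def poly_cayley[OF deg(1) zs(3)] poly_cayley[OF deg(2) zs(3)] zs(4) ..
    finally show ?thesis
      unfolding poly_mult gram_defect_scale G by (simp add: mult_ac)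
  qed
  ultimately show ?thesis by (intro exI[of _ g] exI[of _ m] exI[of _ "\<lambda>i l. cayley L (f i l)"]) blast
qed

section \<open>Stable rational functions\<close>

text \<open>A common factor lowers the degree of the denominator.\<close>

lemma reduced_fraction_exists:
  fixes p q :: "complex poly"
  assumes "q \<noteq> 0"
  shows "\<exists>p' q' g. p = p' * g \<and> q = q' * g \<and> coprime p' q'"
  using assms
proof (induction "degree q" arbitrary: p q rule: less_induct)
  case less
  show ?case
  proof (cases "coprime p q")
    case True
    then show ?thesis by (intro exI[of _ p] exI[of _ q] exI[of _ 1]) simp
  next
    case False
    then obtain d where d: "d dvd p" "d dvd q" "\<not> is_unit d" unfolding coprime_def by blast
    then obtain p1 q1 where pq: "p = p1 * d" "q = q1 * d" by (metis dvd_def mult.commute)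
    have nz: "q1 \<noteq> 0" "d \<noteq> 0" using pq less.prems by auto
    then have "degree d > 0" using d(3) by (simp add: is_unit_iff_degree)
    then have "degree q1 < degree q" using nz by (simp add: pq degree_mult_eq)
    from less.hyps[OF this nz(1)] obtain p' q' g where "p1 = p' * g" "q1 = q' * g" "coprime p' q'"
      by metis
    then show ?thesis unfolding pq by (intro exI[of _ p'] exI[of _ q'] exI[of _ "g * d"]) (simp add: mult_ac)
  qed
qed

lemma poly_coprime_no_common_root:
  fixes p q :: "complex poly"
  assumes "coprime p q" "poly q s = 0"
  shows "poly p s \<noteq> 0"
proof
  assume "poly p s = 0"
  then have "is_unit [:- s, 1:]"
    using assms by (meson coprime_common_divisor poly_eq_0_iff_dvd)
  then show False by (simp add: is_unit_iff_degree)
qed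

lemma eventually_poly_nonzero:
  fixes q :: "complex poly"
  assumes "q \<noteq> 0"
  shows "eventually (\<lambda>t. poly q t \<noteq> 0) (at s)"
proof -
  have "\<not> s islimpt {t. poly q t = 0}"
    using poly_roots_finite[OF assms] islimpt_finite by blast
  then show ?thesis by (simp add: islimpt_iff_eventually)
qed

lemma eventually_poly_nonzero_at_infinity:
  fixes q :: "complex poly"
  assumes "q \<noteq> 0"
  shows "eventually (\<lambda>t. poly q t \<noteq> 0) at_infinity"
proof -
  have "bounded {t. poly q t = 0}" using poly_roots_finite[OF assms] by (rule finite_imp_bounded)
  then obtain B where "\<And>t. poly q t = 0 \<Longrightarrow> cmod t \<le> B" unfolding bounded_iff by auto
  then show ?thesis unfolding eventually_at_infinity by (intro exI[of _ "B + 1"]) force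
qed

lemma coprime_frac_pole:
  fixes p q :: "complex poly"
  assumes "q \<noteq> 0" "coprime p q" "poly q s = 0"
  shows "is_pole (\<lambda>s. poly p s / poly q s) s"
proof (rule is_pole_divide)
  show "filterlim (poly q) (at 0) (at s)"
    unfolding filterlim_at
  proof
    show "\<forall>\<^sub>F x in at s. poly q x \<in> UNIV \<and> poly q x \<noteq> 0"
      using eventually_poly_nonzero[OF assms(1)] by simp
    have "(poly q \<longlongrightarrow> poly q s) (at s)" by (intro tendsto_intros)
    then show "(poly q \<longlongrightarrow> 0) (at s)" using assms(3) by simp
  qed
qed (use poly_coprime_no_common_root[OF assms(2,3)] in auto)

lemma poly_frac_analytic:
  fixes p q :: "complex poly"
  assumes "\<And>s. s \<in> S \<Longrightarrow> poly q s \<noteq> 0"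
  shows "(\<lambda>s. poly p s / poly q s) analytic_on S"
proof (rule analytic_on_divide)
  have "poly r analytic_on UNIV" for r :: "complex poly"
    by (subst analytic_on_open) (auto intro: holomorphic_intros)
  then show "poly p analytic_on S" "poly q analytic_on S" by (auto intro: analytic_on_subset)
qed (use assms in auto)

text \<open>If the numerator had the larger degree, the reciprocal would tend to 0 at infinity.\<close>

lemma poly_frac_proper_if_bounded:
  fixes p q :: "complex poly"
  assumes "q \<noteq> 0" "filterlim x at_infinity sequentially"
    and bound: "\<And>k. cmod (poly p (x k) / poly q (x k)) \<le> B"
  shows "degree p \<le> degree q"
proof (rule ccontr)
  assume "\<not> degree p \<le> degree q"
  then have q_p: "((\<lambda>s. poly q s / poly p s) \<longlongrightarrow> 0) at_infinity" and p: "p \<noteq> 0"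
    using poly_divide_tendsto_0_at_infinity[of q p] by auto
  have "(\<lambda>k. poly q (x k) / poly p (x k)) \<longlonglongrightarrow> 0"
    by (rule filterlim_compose[OF q_p assms(2)])
  then have lim: "(\<lambda>k. cmod (poly q (x k) / poly p (x k))) \<longlonglongrightarrow> 0"
    by (rule tendsto_norm_zero)
  define C where "C = \<bar>B\<bar> + 1"
  have C: "C > 0" "\<And>k. cmod (poly p (x k) / poly q (x k)) < C"
    using bound by (auto simp: C_def intro!: le_less_trans[OF bound])
  have "eventually (\<lambda>k. cmod (poly q (x k) / poly p (x k)) < 1 / C) sequentially"
    using order_tendstoD(2)[OF lim] C(1) by simp
  moreover have "eventually (\<lambda>k. poly q (x k) \<noteq> 0) sequentially" "eventually (\<lambda>k. poly p (x k) \<noteq> 0) sequentially"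
    by (rule eventually_compose_filterlim[OF eventually_poly_nonzero_at_infinity assms(2)], fact)+
  ultimately have "eventually (\<lambda>k::nat. False) sequentially"
  proof eventually_elim
    case (elim k)
    have "cmod (poly p (x k)) < C * cmod (poly q (x k))"
      using C(2)[of k] elim by (simp add: norm_divide divide_less_eq)
    moreover have "C * cmod (poly q (x k)) < cmod (poly p (x k))"
      using elim C(1) by (simp add: norm_divide field_simps)
    ultimately show False by simp
  qed
  then show False by simp
qed

lemma proper_poly_frac_tendsto:
  fixes p q :: "complex poly"
  assumes "degree p \<le> degree q" "q \<noteq> 0"
  shows "((\<lambda>s. poly p s / poly q s) \<longlongrightarrow> coeff p (degree q) / lead_coeff q) at_infinity"
proof (cases "degree p = degree q")
  case True
  have "((\<lambda>s. (poly p s / s ^ degree p) / (poly q s / s ^ degree q)) \<longlongrightarrow> lead_coeff p / lead_coeff q) at_infinity"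
    by (intro tendsto_divide poly_divide_tendsto_aux) (use assms(2) in auto)
  moreover have "eventually (\<lambda>s::complex. (poly p s / s ^ degree p) / (poly q s / s ^ degree q) = poly p s / poly q s) at_infinity"
    unfolding eventually_at_infinity by (intro exI[of _ 1]) (auto simp: True)
  ultimately show ?thesis unfolding True using Lim_transform_eventually by fastforce
next
  case False
  then have "degree p < degree q" using assms(1) by simp
  then show ?thesis using poly_divide_tendsto_0_at_infinity[of p q] by (simp add: coeff_eq_0)
qed

text \<open>Near infinity the fraction is close to its limit, and the rest of the half-plane is compact.\<close>

lemma proper_poly_frac_bounded:
  fixes p q :: "complex poly"
  assumes "degree p \<le> degree q" "\<And>s. Re s \<ge> 0 \<Longrightarrow> poly q s \<noteq> 0"
  shows "\<exists>B. \<forall>s. Re s \<ge> 0 \<longrightarrow> cmod (poly p s / poly q s) \<le> B"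
proof -
  have "q \<noteq> 0" using assms(2)[of 0] by auto
  define l where "l = coeff p (degree q) / lead_coeff q"
  have "eventually (\<lambda>s. dist (poly p s / poly q s) l < 1) at_infinity"
    using proper_poly_frac_tendsto[OF assms(1) \<open>q \<noteq> 0\<close>] unfolding l_def by (rule tendstoD) simp
  then obtain r where r: "\<And>s. r \<le> cmod s \<Longrightarrow> dist (poly p s / poly q s) l < 1"
    unfolding eventually_at_infinity by blast
  define K where "K = {s. Re s \<ge> 0} \<inter> cball 0 r"
  have "compact ((\<lambda>s. poly p s / poly q s) ` K)"
  proof (rule compact_continuous_image)
    show "compact K" unfolding K_def by (intro closed_Int_compact closed_halfspace_Re_ge compact_cball)
    show "continuous_on K (\<lambda>s. poly p s / poly q s)"
      by (intro continuous_intros) (use assms(2) in \<open>auto simp: K_def\<close>)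
  qed
  then obtain B where B: "\<And>s. s \<in> K \<Longrightarrow> cmod (poly p s / poly q s) \<le> B"
    by (meson bounded_iff compact_imp_bounded imageI)
  have "cmod (poly p s / poly q s) \<le> max B (cmod l + 1)" if "Re s \<ge> 0" for s
  proof (cases "r \<le> cmod s")
    case True
    have "cmod (poly p s / poly q s) \<le> cmod l + dist (poly p s / poly q s) l"
      by (metis add.commute dist_norm norm_triangle_sub)
    then show ?thesis using r[OF True] by linarith
  next
    case False
    then show ?thesis using B[of s] that by (simp add: K_def)
  qed
  then show ?thesis by blast
qed

lemma proper_poly_frac_hardy:
  fixes p q :: "complex poly"
  assumes "degree p \<le> degree q" "\<And>s. Re s \<ge> 0 \<Longrightarrow> poly q s \<noteq> 0"
  shows "hardy_inf (\<lambda>s. poly p s / poly q s)"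
  unfolding hardy_inf_def
proof
  show "(\<lambda>s. poly p s / poly q s) analytic_on {s. Re s > 0}"
    by (rule poly_frac_analytic) (use assms(2) in auto)
  show "bounded ((\<lambda>s. poly p s / poly q s) ` {s. Re s > 0})"
    using proper_poly_frac_bounded[of p q] assms unfolding bounded_iff
    by (metis (no_types, lifting) imageE less_imp_le mem_Collect_eq)
qed

lemma filterlim_of_nat_Suc: "filterlim (\<lambda>k. of_nat (Suc k) :: complex) at_infinity sequentially"
  using filterlim_compose[OF tendsto_of_nat filterlim_Suc] by simp

lemma filterlim_imaginary_at_infinity:
  "filterlim (\<lambda>w. \<i> * complex_of_real w) at_infinity at_top"
  "filterlim (\<lambda>w. \<i> * complex_of_real w) at_infinity at_bot"
proof -
  have "filterlim abs at_top (at_bot :: real filter)"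
    by (subst filterlim_at_bot_mirror) (simp add: filterlim_abs_real)
  then show "filterlim (\<lambda>w. \<i> * complex_of_real w) at_infinity at_top"
    "filterlim (\<lambda>w. \<i> * complex_of_real w) at_infinity at_bot"
    unfolding filterlim_at_infinity_conv_norm_at_top by (simp_all add: norm_mult filterlim_abs_real)
qed

lemma poly_eq_if_eq_on_axis:
  fixes p q :: "complex poly"
  assumes "\<And>s. Re s = 0 \<Longrightarrow> poly p s = poly q s"
  shows "p = q"
proof (rule ccontr)
  assume "p \<noteq> q"
  then have "finite {s. poly (p - q) s = 0}" by (intro poly_roots_finite) simp
  moreover have "range (\<lambda>k::nat. \<i> * of_nat k) \<subseteq> {s. poly (p - q) s = 0}"
    using assms by auto
  ultimately have "finite (range (\<lambda>k::nat. \<i> * (of_nat k :: complex)))" by (rule finite_subset[rotated])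
  moreover have "inj (\<lambda>k::nat. \<i> * (of_nat k :: complex))" by (auto intro: injI)
  ultimately show False using finite_imageD by blast
qed

section \<open>Rational inner matrix functions\<close>

text \<open>The polynomial \<open>s \<mapsto> cnj (p (- cnj s))\<close>. On the imaginary axis it is the conjugate of \<open>p\<close>,
  which makes conjugates available inside rational expressions.\<close>

definition para_conj :: "complex poly \<Rightarrow> complex poly" where
  "para_conj p = pcompose (map_poly cnj p) [:0, -1:]"

lemma poly_para_conj: "poly (para_conj p) s = cnj (poly p (- cnj s))"
proof -
  have "poly (map_poly cnj p) (cnj t) = cnj (poly p t)" for t
    by (induction p) (simp_all add: map_poly_pCons)
  from this[of "- cnj s"] show ?thesis by (simp add: para_conj_def poly_pcompose)
qed

lemma minus_cnj_axis: "Re s = 0 \<Longrightarrow> - cnj s = s"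
  by (simp add: complex_eq_iff)

lemma poly_para_conj_axis: "Re s = 0 \<Longrightarrow> poly (para_conj p) s = cnj (poly p s)"
  by (simp add: poly_para_conj minus_cnj_axis)

lemma hurwitz_poly_margin:
  fixes Q :: "complex poly"
  assumes "\<And>s. poly Q s = 0 \<Longrightarrow> Re s < 0"
  shows "\<exists>\<tau>>0. \<forall>s. Re s > - \<tau> \<longrightarrow> poly Q s \<noteq> 0"
proof -
  have "Q \<noteq> 0" using assms[of 0] by auto
  then have fin: "finite {s. poly Q s = 0}" by (rule poly_roots_finite)
  define \<tau> where "\<tau> = Min (insert 1 ((\<lambda>s. - Re s) ` {s. poly Q s = 0}))"
  have "\<tau> > 0" using fin assms by (simp add: \<tau>_def)
  moreover have "\<tau> \<le> - Re s" if "poly Q s = 0" for s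
    unfolding \<tau>_def using fin that by (intro Min_le) auto
  ultimately show ?thesis by (intro exI[of _ \<tau>]) force
qed

lemma mult_adjoint_index:
  assumes "X \<in> carrier_mat r c" "Y \<in> carrier_mat k c" "i < r" "j < k"
  shows "(X * mat_adjoint Y) $$ (i, j) = (\<Sum>l<c. X $$ (i, l) * cnj (Y $$ (j, l)))"
proof -
  have "(X * mat_adjoint Y) $$ (i, j) = (\<Sum>l<c. X $$ (i, l) * mat_adjoint Y $$ (l, j))"
    using assms by (simp add: scalar_prod_def lessThan_atLeast0)
  also have "\<dots> = (\<Sum>l<c. X $$ (i, l) * cnj (Y $$ (j, l)))"
    using assms by (intro sum.cong refl) simp
  finally show ?thesis .
qed

text \<open>A rational matrix with stable common denominator that is unitary on the imaginary axis is
  inner: its entries are bounded by 1 on the axis, hence proper and bounded on the right half-plane.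
  The identity \<open>H H\<^sup>H = I\<close> extends from the axis as a polynomial identity between numerators. Its
  validity at every point that is not a pole of the reduced entries, including points where the common
  denominator vanishes, follows by continuity.\<close>

lemma inner_rational_admissible:
  fixes P :: "nat \<Rightarrow> nat \<Rightarrow> complex poly" and Q :: "complex poly"
  assumes Q: "\<And>s. poly Q s = 0 \<Longrightarrow> Re s < 0"
    and unitary: "\<And>s i j. Re s = 0 \<Longrightarrow> i < k \<Longrightarrow> j < k \<Longrightarrow>
      (\<Sum>l<k. poly (P i l) s / poly Q s * cnj (poly (P j l) s / poly Q s)) = (if i = j then 1 else 0)"
  shows "\<exists>H. rational_mat k k H \<and> hardy_inf_mat k k H \<and> cond_H1 k k H \<and> paraunitary k H \<and>
    (\<forall>s i j. Re s = 0 \<longrightarrow> i < k \<longrightarrow> j < k \<longrightarrow> H s $$ (i, j) = poly (P i j) s / poly Q s)"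
proof -
  have Q0: "Q \<noteq> 0" using Q[of 0] by auto
  have "\<forall>i j. \<exists>p q g. P i j = p * g \<and> Q = q * g \<and> coprime p q"
    using reduced_fraction_exists[OF Q0] by blast
  then obtain p q g where red: "\<And>i j. P i j = p i j * g i j" "\<And>i j. Q = q i j * g i j"
      "\<And>i j. coprime (p i j) (q i j)"
    by metis
  have q0: "q i j \<noteq> 0" for i j using red(2)[of i j] Q0 by auto
  have q_root: "poly Q s = 0" if "poly (q i j) s = 0" for i j s
    using that by (subst red(2)[of i j]) simp
  have frac: "poly (P i j) s / poly Q s = poly (p i j) s / poly (q i j) s" if "poly Q s \<noteq> 0" for i j s
    using that unfolding red(1)[of i j] by (subst (asm) red(2)[of i j], subst red(2)[of i j]) simp
  define H where "H s = Matrix.mat k k (\<lambda>(i, j). poly (p i j) s / poly (q i j) s)" for s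
  have carrier: "H s \<in> carrier_mat k k" for s by (simp add: H_def)
  have index: "H s $$ (i, j) = poly (p i j) s / poly (q i j) s" if "i < k" "j < k" for s i j
    using that by (simp add: H_def)
  have entry: "(\<lambda>s. H s $$ (i, j)) = (\<lambda>s. poly (p i j) s / poly (q i j) s)" if "i < k" "j < k" for i j
    using index[OF that] by blast
  have axis_nz: "poly Q s \<noteq> 0" if "Re s \<ge> 0" for s using Q[of s] that by auto
  have axis: "H s $$ (i, j) = poly (P i j) s / poly Q s" if "Re s = 0" "i < k" "j < k" for s i j
    using index[OF that(2,3)] frac[OF axis_nz] that(1) by simp
  have "rational_mat k k H"
    unfolding rational_mat_def rational_fun_def using carrier entry q0 red(3) by blast
  moreover have "hardy_inf_mat k k H"
    unfolding hardy_inf_mat_def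
  proof (intro allI impI)
    fix i j assume ij: "i < k" "j < k"
    have bound: "cmod (poly (p i j) s / poly (q i j) s) \<le> 1" if "Re s = 0" for s
    proof -
      let ?h = "\<lambda>l. poly (P i l) s / poly Q s"
      have "complex_of_real (\<Sum>l<k. (cmod (?h l))\<^sup>2) = 1"
        using unitary[OF that ij(1) ij(1)] by (simp only: of_real_sum complex_norm_square refl if_True)
      then have "(\<Sum>l<k. (cmod (?h l))\<^sup>2) = 1" using of_real_eq_1_iff by blast
      moreover have "(cmod (?h j))\<^sup>2 \<le> (\<Sum>l<k. (cmod (?h l))\<^sup>2)"
        using ij(2) by (intro member_le_sum) auto
      ultimately have "(cmod (?h j))\<^sup>2 \<le> 1\<^sup>2" by simp
      then have "cmod (?h j) \<le> 1" by (rule power2_le_imp_le) simp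
      then show ?thesis using frac[OF axis_nz] that by simp
    qed
    have "degree (p i j) \<le> degree (q i j)"
    proof (rule poly_frac_proper_if_bounded[OF q0])
      show "filterlim (\<lambda>k. \<i> * complex_of_real (real k)) at_infinity sequentially"
        by (rule filterlim_compose[OF filterlim_imaginary_at_infinity(1) filterlim_real_sequentially])
      show "cmod (poly (p i j) (\<i> * complex_of_real (real k)) / poly (q i j) (\<i> * complex_of_real (real k))) \<le> 1" for k
        by (rule bound) simp
    qed
    then show "hardy_inf (\<lambda>s. H s $$ (i, j))"
      unfolding entry[OF ij] using q_root axis_nz by (intro proper_poly_frac_hardy) blast+
  qed
  moreover have "cond_H1 k k H"
    unfolding cond_H1_def
  proof
    show "\<forall>s. mat_pole k k H s \<longrightarrow> Re s < 0"
    proof (intro allI impI)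
      fix s assume "mat_pole k k H s"
      then obtain i j where ij: "i < k" "j < k" "is_pole (\<lambda>s. poly (p i j) s / poly (q i j) s) s"
        unfolding mat_pole_def using entry by auto
      have "poly (q i j) s = 0"
      proof (rule ccontr)
        assume "poly (q i j) s \<noteq> 0"
        then have "(\<lambda>s. poly (p i j) s / poly (q i j) s) analytic_on {s}"
          by (intro poly_frac_analytic) auto
        then show False using ij(3) analytic_at_imp_no_pole by blast
      qed
      then show "Re s < 0" using q_root Q by blast
    qed
    obtain \<tau> where "\<tau> > 0" and \<tau>: "\<And>s. Re s > - \<tau> \<Longrightarrow> poly Q s \<noteq> 0"
      using hurwitz_poly_margin[OF Q] by blast
    have "mat_analytic_on k k H {s. Re s > - \<tau>}"
      unfolding mat_analytic_on_def
    proof (intro allI impI)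
      fix i j assume ij: "i < k" "j < k"
      show "(\<lambda>s. H s $$ (i, j)) analytic_on {s. Re s > - \<tau>}"
        unfolding entry[OF ij] by (rule poly_frac_analytic) (use q_root \<tau> in blast)
    qed
    then show "\<exists>\<tau>>0. mat_analytic_on k k H {s. Re s > - \<tau>}" using \<open>\<tau> > 0\<close> by blast
  qed
  moreover have "paraunitary k H"
    unfolding paraunitary_def
  proof (intro allI impI)
    fix s assume np: "\<not> mat_pole k k H s \<and> \<not> mat_pole k k H (- cnj s)"
    have nz: "poly (q i j) t \<noteq> 0" if "\<not> mat_pole k k H t" "i < k" "j < k" for i j t
    proof
      assume "poly (q i j) t = 0"
      then have "is_pole (\<lambda>s. H s $$ (i, j)) t"
        unfolding entry[OF that(2,3)] by (intro coprime_frac_pole q0 red(3))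
      then show False using that unfolding mat_pole_def by blast
    qed
    have HH: "H s * sys_conj H s = 1\<^sub>m k"
    proof (rule eq_matI)
      fix i j assume "i < dim_row (1\<^sub>m k)" "j < dim_col (1\<^sub>m k)"
      then have ij: "i < k" "j < k" by auto
      define \<delta> where "\<delta> = (if i = j then 1 else 0 :: complex)"
      define f where "f t = (\<Sum>l<k. poly (p i l) t / poly (q i l) t
        * cnj (poly (p j l) (- cnj t) / poly (q j l) (- cnj t)))" for t
      have gram: "(\<Sum>l<k. P i l * para_conj (P j l)) = (if i = j then Q * para_conj Q else 0)"
      proof (rule poly_eq_if_eq_on_axis)
        fix t assume t: "Re t = 0"
        have Qt: "poly Q t \<noteq> 0" using axis_nz t by simp
        have "(\<Sum>l<k. poly (P i l) t * cnj (poly (P j l) t))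
          = (\<Sum>l<k. poly (P i l) t / poly Q t * cnj (poly (P j l) t / poly Q t)) * (poly Q t * cnj (poly Q t))"
          unfolding sum_distrib_right using Qt by (intro sum.cong refl) simp
        then show "poly (\<Sum>l<k. P i l * para_conj (P j l)) t = poly (if i = j then Q * para_conj Q else 0) t"
          unfolding unitary[OF t ij] by (simp add: poly_sum poly_para_conj_axis[OF t])
      qed
      have poly_id: "(\<Sum>l<k. poly (P i l) t * cnj (poly (P j l) (- cnj t))) = \<delta> * (poly Q t * cnj (poly Q (- cnj t)))" for t
      proof -
        have "poly (\<Sum>l<k. P i l * para_conj (P j l)) t = poly (if i = j then Q * para_conj Q else 0) t"
          by (simp only: gram)
        then show ?thesis by (cases "i = j") (simp_all add: poly_sum poly_para_conj \<delta>_def)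
      qed
      have f_generic: "f t = \<delta>" if "poly Q t \<noteq> 0" "poly (para_conj Q) t \<noteq> 0" for t
      proof -
        have Q': "poly Q (- cnj t) \<noteq> 0" using that(2) by (simp add: poly_para_conj)
        have "f t = (\<Sum>l<k. poly (P i l) t * cnj (poly (P j l) (- cnj t))) / (poly Q t * cnj (poly Q (- cnj t)))"
          unfolding f_def sum_divide_distrib frac[OF that(1), symmetric] frac[OF Q', symmetric] by simp
        then show ?thesis unfolding poly_id using that(1) Q' by simp
      qed
      have "para_conj Q \<noteq> 0"
      proof
        assume "para_conj Q = 0"
        then have "poly Q 0 = 0" using poly_para_conj[of Q 0] by simp
        then show False using axis_nz[of 0] by simp
      qed
      then have "eventually (\<lambda>t. f t = \<delta>) (at s)"
        by (intro eventually_mono[OF eventually_conj[OF eventually_poly_nonzero[OF Q0] eventually_poly_nonzero]])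
          (auto simp: f_generic)
      then have "(f \<longlongrightarrow> \<delta>) (at s)" by (rule tendsto_eventually)
      moreover have "(f \<longlongrightarrow> f s) (at s)"
      proof -
        have "((\<lambda>t. poly (p j l) (- cnj t)) \<longlongrightarrow> poly (p j l) (- cnj s)) (at s)"
          "((\<lambda>t. poly (q j l) (- cnj t)) \<longlongrightarrow> poly (q j l) (- cnj s)) (at s)" for l
          by (intro tendsto_intros)+
        then show ?thesis
          unfolding f_def using nz np ij by (intro tendsto_intros) auto
      qed
      ultimately have "f s = \<delta>" using tendsto_unique at_neq_bot by blast
      moreover have "(H s * sys_conj H s) $$ (i, j) = f s"
        unfolding sys_conj_def mult_adjoint_index[OF carrier carrier ij] f_def
        using ij by (intro sum.cong refl) (simp add: index)
      ultimately show "(H s * sys_conj H s) $$ (i, j) = 1\<^sub>m k $$ (i, j)" using ij by (simp add: \<delta>_def)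
    qed (use carrier in \<open>auto simp: sys_conj_def\<close>)
    moreover have "sys_conj H s * H s = 1\<^sub>m k"
      by (rule mat_mult_left_right_inverse[OF _ _ HH]) (use carrier in \<open>auto simp: sys_conj_def\<close>)
    ultimately show "sys_conj H s * H s = 1\<^sub>m k \<and> H s * sys_conj H s = 1\<^sub>m k" by blast
  qed
  ultimately show ?thesis using axis by blast
qed

section \<open>Dilation of co-isometries\<close>

lemma mat_adjoint_four_block:
  fixes A B C D :: "complex mat"
  assumes "A \<in> carrier_mat r1 c1" "B \<in> carrier_mat r1 c2" "C \<in> carrier_mat r2 c1" "D \<in> carrier_mat r2 c2"
  shows "mat_adjoint (four_block_mat A B C D)
    = four_block_mat (mat_adjoint A) (mat_adjoint C) (mat_adjoint B) (mat_adjoint D)"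
  using assms by (intro eq_matI) auto

lemma mat_adjoint_mult:
  fixes X Y :: "complex mat"
  assumes "X \<in> carrier_mat r k" "Y \<in> carrier_mat k c"
  shows "mat_adjoint (X * Y) = mat_adjoint Y * mat_adjoint X"
proof (rule eq_matI)
  fix i j assume "i < dim_row (mat_adjoint Y * mat_adjoint X)" "j < dim_col (mat_adjoint Y * mat_adjoint X)"
  then have ij: "i < c" "j < r" using assms by auto
  have "mat_adjoint (X * Y) $$ (i, j) = (\<Sum>l<k. cnj (X $$ (j, l)) * cnj (Y $$ (l, i)))"
    using assms ij by (simp add: scalar_prod_def cnj_sum lessThan_atLeast0)
  also have "\<dots> = (\<Sum>l<k. mat_adjoint Y $$ (i, l) * cnj (X $$ (j, l)))"
    using assms ij by (intro sum.cong refl) (simp add: mult.commute)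
  also have "\<dots> = (mat_adjoint Y * mat_adjoint X) $$ (i, j)"
    using assms ij by (intro mult_adjoint_index[symmetric]) auto
  finally show "mat_adjoint (X * Y) $$ (i, j) = (mat_adjoint Y * mat_adjoint X) $$ (i, j)" .
qed (use assms in auto)

lemma mat_adjoint_adjoint [simp]: "mat_adjoint (mat_adjoint X) = (X :: complex mat)"
  by (intro eq_matI) auto

lemma mat_adjoint_minus:
  fixes X Y :: "complex mat"
  assumes "X \<in> carrier_mat r c" "Y \<in> carrier_mat r c"
  shows "mat_adjoint (X - Y) = mat_adjoint X - mat_adjoint Y"
  using assms by (intro eq_matI) auto

lemma mat_adjoint_smult: "mat_adjoint (b \<cdot>\<^sub>m X) = cnj b \<cdot>\<^sub>m mat_adjoint X"
  by (intro eq_matI) auto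

lemma mat_adjoint_one [simp]: "mat_adjoint (1\<^sub>m k) = (1\<^sub>m k :: complex mat)"
  by (intro eq_matI) auto

lemma mat_adjoint_zero [simp]: "mat_adjoint (0\<^sub>m r c) = (0\<^sub>m c r :: complex mat)"
  by (intro eq_matI) auto

text \<open>The Halmos dilation of a co-isometry \<open>e\<close>, with lower block row multiplied by \<open>b\<close>. On the
  axis \<open>b\<close> will be a scalar inner function that cancels the poles of \<open>e\<^sup>H\<close> in the right half-plane.\<close>

definition halmos :: "nat \<Rightarrow> nat \<Rightarrow> complex \<Rightarrow> complex mat \<Rightarrow> complex mat" where
  "halmos n m b e = four_block_mat e (0\<^sub>m n n) (b \<cdot>\<^sub>m (1\<^sub>m m - mat_adjoint e * e)) (b \<cdot>\<^sub>m mat_adjoint e)"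

text \<open>\<open>e\<^sup>* e\<close> is an orthogonal projection, and the dilation completes it by the complementary
  projection.\<close>

lemma halmos_unitary:
  assumes e: "e \<in> carrier_mat n m" and ee: "e * mat_adjoint e = 1\<^sub>m n" and b: "b * cnj b = 1"
  shows "halmos n m b e * mat_adjoint (halmos n m b e) = 1\<^sub>m (n + m)"
proof -
  define a where "a = mat_adjoint e"
  define p where "p = a * e"
  have a: "a \<in> carrier_mat m n" and p: "p \<in> carrier_mat m m" using e by (auto simp: a_def p_def)
  have adj_p: "mat_adjoint p = p" unfolding p_def a_def using e by (subst mat_adjoint_mult[of _ m n _ m]) auto
  have ep: "e * p = e" unfolding p_def using e a ee
    by (subst assoc_mult_mat[symmetric, of _ n m _ n _ m]) (auto simp: a_def)
  have pa: "p * a = a" unfolding p_def using e a ee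
    by (subst assoc_mult_mat[of _ m n _ m _ n]) (auto simp: a_def)
  have pp: "p * p = p"
  proof -
    have "(a * e) * p = a * (e * p)" using e a p by (intro assoc_mult_mat[of _ m n _ m _ m]) auto
    then show ?thesis unfolding ep by (simp add: p_def[symmetric])
  qed
  have q: "1\<^sub>m m - p \<in> carrier_mat m m" using p by auto
  have adj: "mat_adjoint (halmos n m b e) = four_block_mat a (cnj b \<cdot>\<^sub>m (1\<^sub>m m - p)) (0\<^sub>m n n) (cnj b \<cdot>\<^sub>m e)"
    unfolding halmos_def a_def[symmetric] p_def[symmetric]
    using e a p by (subst mat_adjoint_four_block[of _ n m _ n _ m])
      (auto simp: mat_adjoint_smult mat_adjoint_minus[of _ m m] adj_p, auto simp: a_def)
  have 12: "e * (cnj b \<cdot>\<^sub>m (1\<^sub>m m - p)) + 0\<^sub>m n n * (cnj b \<cdot>\<^sub>m e) = 0\<^sub>m n m"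
  proof -
    have "e * (1\<^sub>m m - p) = 0\<^sub>m n m"
      using e p by (subst mult_minus_distrib_mat[of _ n m _ m]) (auto simp: ep)
    then show ?thesis using e q by (subst mult_smult_distrib[of _ n m _ m]) auto
  qed
  have 21: "b \<cdot>\<^sub>m (1\<^sub>m m - p) * a + b \<cdot>\<^sub>m a * 0\<^sub>m n n = 0\<^sub>m m n"
  proof -
    have "(1\<^sub>m m - p) * a = 0\<^sub>m m n"
      using a p by (subst minus_mult_distrib_mat[of _ m m _ _ n]) (auto simp: pa)
    then show ?thesis using a q by (subst mult_smult_assoc_mat[of _ m m _ n]) auto
  qed
  have 22: "b \<cdot>\<^sub>m (1\<^sub>m m - p) * (cnj b \<cdot>\<^sub>m (1\<^sub>m m - p)) + b \<cdot>\<^sub>m a * (cnj b \<cdot>\<^sub>m e) = 1\<^sub>m m"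
  proof -
    have qp: "(1\<^sub>m m - p) * p = 0\<^sub>m m m"
      using p by (subst minus_mult_distrib_mat[of _ m m _ _ m]) (auto simp: pp)
    have "(1\<^sub>m m - p) * (1\<^sub>m m - p) = (1\<^sub>m m - p) * 1\<^sub>m m - (1\<^sub>m m - p) * p"
      by (rule mult_minus_distrib_mat[OF q _ p]) simp
    also have "\<dots> = 1\<^sub>m m - p" unfolding qp using p by (intro eq_matI) auto
    finally have sq: "(1\<^sub>m m - p) * (1\<^sub>m m - p) = 1\<^sub>m m - p" .
    have A: "b \<cdot>\<^sub>m (1\<^sub>m m - p) * (cnj b \<cdot>\<^sub>m (1\<^sub>m m - p)) = 1\<^sub>m m - p"
      using q p b by (subst mult_smult_assoc_mat[of _ m m _ m], simp, simp, subst mult_smult_distrib[of _ m m _ m])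
        (auto simp: sq intro!: eq_matI simp flip: mult.assoc)
    have B: "b \<cdot>\<^sub>m a * (cnj b \<cdot>\<^sub>m e) = p"
      using a e b by (subst mult_smult_assoc_mat[of _ m n _ m], simp, simp, subst mult_smult_distrib[of _ m n _ m])
        (auto simp: p_def intro!: eq_matI simp flip: mult.assoc)
    show ?thesis unfolding A B using p by (intro eq_matI) auto
  qed
  have "halmos n m b e * mat_adjoint (halmos n m b e) = four_block_mat (e * a + 0\<^sub>m n n * 0\<^sub>m n n)
     (e * (cnj b \<cdot>\<^sub>m (1\<^sub>m m - p)) + 0\<^sub>m n n * (cnj b \<cdot>\<^sub>m e))
     (b \<cdot>\<^sub>m (1\<^sub>m m - p) * a + b \<cdot>\<^sub>m a * 0\<^sub>m n n)
     (b \<cdot>\<^sub>m (1\<^sub>m m - p) * (cnj b \<cdot>\<^sub>m (1\<^sub>m m - p)) + b \<cdot>\<^sub>m a * (cnj b \<cdot>\<^sub>m e))"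
    unfolding adj unfolding halmos_def a_def[symmetric] p_def[symmetric]
    using a e p q by (intro mult_four_block_mat[of _ n m _ n _ m _ _ n _ m]) auto
  also have "\<dots> = four_block_mat (1\<^sub>m n) (0\<^sub>m n m) (0\<^sub>m m n) (1\<^sub>m m)"
    unfolding 12 21 22 using ee by (simp add: a_def)
  finally show ?thesis by (simp add: four_block_one_mat)
qed

text \<open>A row \<open>E / q\<close> that is co-isometric on the axis is completed to a square inner function by the
  Halmos dilation, with phase \<open>b = q\<^sup>H / q\<close>. All entries then have the denominator \<open>q q\<close>, so the
  completion is stable. It has as many additional inputs as \<open>E\<close> has rows, which is admissible because
  the number of environment inputs is free.\<close>

lemma inner_dilation:
  fixes E :: "nat \<Rightarrow> nat \<Rightarrow> complex poly" and q :: "complex poly"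
  assumes q: "\<And>s. poly q s = 0 \<Longrightarrow> Re s < 0"
    and coisometry: "\<And>s i j. Re s = 0 \<Longrightarrow> i < n \<Longrightarrow> j < n \<Longrightarrow>
      (\<Sum>l<m. poly (E i l) s * cnj (poly (E j l) s)) = (if i = j then poly q s * cnj (poly q s) else 0)"
  defines "k \<equiv> n + m"
  shows "\<exists>H. rational_mat k k H \<and> hardy_inf_mat k k H \<and> cond_H1 k k H \<and> paraunitary k H \<and>
    (\<forall>s i j. Re s = 0 \<longrightarrow> i < n \<longrightarrow> j < m \<longrightarrow> H s $$ (i, j) = poly (E i j) s / poly q s)"
proof -
  \<comment> \<open>The entries of the Halmos dilation of \<open>E / q\<close>, multiplied by \<open>q q\<close>.\<close>
  define P where "P i j =
    (if i < n then if j < m then q * E i j else 0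
     else if j < m then (if i - n = j then q * para_conj q else 0) - (\<Sum>r<n. para_conj (E r (i - n)) * E r j)
     else q * para_conj (E (j - m) (i - n)))" for i j
  have nz: "poly q s \<noteq> 0" if "Re s = 0" for s using q[of s] that by auto
  define e where "e s = Matrix.mat n m (\<lambda>(i, j). poly (E i j) s / poly q s)" for s
  define b where "b s = cnj (poly q s) / poly q s" for s
  define h where "h s = halmos n m (b s) (e s)" for s
  have e: "e s \<in> carrier_mat n m" for s by (simp add: e_def)
  have h_carrier: "h s \<in> carrier_mat k k" for s
    using e[of s] unfolding h_def halmos_def k_def by (auto simp: add.commute)
  have ee: "e s * mat_adjoint (e s) = 1\<^sub>m n" if s: "Re s = 0" for s
  proof (rule eq_matI)
    fix i j assume "i < dim_row (1\<^sub>m n)" "j < dim_col (1\<^sub>m n)"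
    then have ij: "i < n" "j < n" by auto
    have "(e s * mat_adjoint (e s)) $$ (i, j)
      = (\<Sum>l<m. poly (E i l) s * cnj (poly (E j l) s)) / (poly q s * cnj (poly q s))"
      unfolding mult_adjoint_index[OF e e ij] sum_divide_distrib
      using ij by (intro sum.cong refl) (simp add: e_def)
    then show "(e s * mat_adjoint (e s)) $$ (i, j) = 1\<^sub>m n $$ (i, j)"
      unfolding coisometry[OF s ij] using ij nz[OF s] by simp
  qed (use e in auto)
  have unitary: "h s * mat_adjoint (h s) = 1\<^sub>m k" if s: "Re s = 0" for s
    unfolding h_def k_def by (rule halmos_unitary[OF e ee[OF s]]) (use nz[OF s] in \<open>simp add: b_def\<close>)
  have h_index: "h s $$ (i, j) = poly (P i j) s / poly (q * q) s" if s: "Re s = 0" and ij: "i < k" "j < k" for s i j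
  proof -
    have dims: "dim_row (e s) = n" "dim_col (e s) = m" using e by auto
    have adj_e: "(mat_adjoint (e s) * e s) $$ (c, d) = (\<Sum>r<n. cnj (poly (E r c) s) * poly (E r d) s) / (poly q s * cnj (poly q s))"
      if "c < m" "d < m" for c d
    proof -
      have "(mat_adjoint (e s) * e s) $$ (c, d) = (\<Sum>r<n. mat_adjoint (e s) $$ (c, r) * e s $$ (r, d))"
        using that dims by (simp add: scalar_prod_def lessThan_atLeast0)
      also have "\<dots> = (\<Sum>r<n. cnj (poly (E r c) s) * poly (E r d) s / (poly q s * cnj (poly q s)))"
        using that dims by (intro sum.cong refl) (simp add: e_def)
      finally show ?thesis by (simp add: sum_divide_distrib)
    qed
    consider "i < n" "j < m" | "i < n" "j \<ge> m" | "i \<ge> n" "j < m" | "i \<ge> n" "j \<ge> m" by linarith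
    then show ?thesis
    proof cases
      case 1
      then show ?thesis using dims nz[OF s] ij
        by (simp add: h_def halmos_def P_def e_def k_def)
    next
      case 2
      then show ?thesis using dims ij by (simp add: h_def halmos_def P_def k_def)
    next
      case 3
      then have c: "i - n < m" using ij by (simp add: k_def)
      have "h s $$ (i, j) = b s * ((if i - n = j then 1 else 0) - (mat_adjoint (e s) * e s) $$ (i - n, j))"
        using 3 dims ij c by (simp add: h_def halmos_def k_def)
      also have "\<dots> = poly (P i j) s / poly (q * q) s"
        unfolding adj_e[OF c 3(2)] using 3 nz[OF s]
        by (simp add: P_def b_def poly_sum poly_para_conj_axis[OF s] field_simps)
      finally show ?thesis .
    next
      case 4
      then have c: "i - n < m" "j - m < n" using ij by (auto simp: k_def)
      have "h s $$ (i, j) = b s * cnj (e s $$ (j - m, i - n))"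
        using 4 dims ij c by (simp add: h_def halmos_def k_def)
      then show ?thesis using 4 c nz[OF s] by (simp add: P_def b_def e_def poly_para_conj_axis[OF s])
    qed
  qed
  have "\<exists>H. rational_mat k k H \<and> hardy_inf_mat k k H \<and> cond_H1 k k H \<and> paraunitary k H \<and>
    (\<forall>s i j. Re s = 0 \<longrightarrow> i < k \<longrightarrow> j < k \<longrightarrow> H s $$ (i, j) = poly (P i j) s / poly (q * q) s)"
  proof (rule inner_rational_admissible)
    show "Re s < 0" if "poly (q * q) s = 0" for s using that q by auto
    fix s i j assume s: "Re s = 0" and ij: "i < k" "j < k"
    have "(\<Sum>l<k. poly (P i l) s / poly (q * q) s * cnj (poly (P j l) s / poly (q * q) s))
        = (h s * mat_adjoint (h s)) $$ (i, j)"
      unfolding mult_adjoint_index[OF h_carrier h_carrier ij]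
      by (intro sum.cong refl) (simp only: h_index[OF s ij(1)] h_index[OF s ij(2)] lessThan_iff)
    then show "(\<Sum>l<k. poly (P i l) s / poly (q * q) s * cnj (poly (P j l) s / poly (q * q) s)) = (if i = j then 1 else 0)"
      unfolding unitary[OF s] using ij by simp
  qed
  then obtain H where H: "rational_mat k k H" "hardy_inf_mat k k H" "cond_H1 k k H" "paraunitary k H"
    "\<And>s i j. Re s = 0 \<Longrightarrow> i < k \<Longrightarrow> j < k \<Longrightarrow> H s $$ (i, j) = poly (P i j) s / poly (q * q) s" by blast
  have "H s $$ (i, j) = poly (E i j) s / poly q s" if "Re s = 0" "i < n" "j < m" for s i j
    using H(5)[of s i j] that nz[of s] by (simp add: k_def P_def)
  then show ?thesis using H by blast
qed

section \<open>Inclusions between the filter classes\<close>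

text \<open>In a reduced fraction every zero of the denominator is a pole.\<close>

lemma stable_denominator:
  assumes "cond_H1 r c X" "i < r" "j < c"
    and "q \<noteq> 0" "coprime p q" "(\<lambda>s. X s $$ (i, j)) = (\<lambda>s. poly p s / poly q s)"
    and "Re s \<ge> 0"
  shows "poly q s \<noteq> 0"
proof
  assume "poly q s = 0"
  then have "is_pole (\<lambda>s. X s $$ (i, j)) s" unfolding assms(6) by (rule coprime_frac_pole[OF assms(4,5)])
  then have "Re s < 0" using assms(1-3) unfolding cond_H1_def mat_pole_def by blast
  then show False using assms(7) by simp
qed

lemma proper_rational_imp_rational: "proper_rational_mat r c X \<Longrightarrow> rational_mat r c X"
  unfolding proper_rational_mat_def rational_mat_def proper_rational_fun_def rational_fun_def by blast

lemma proper_stable_entry: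
  assumes "proper_rational_mat r c X" "cond_H1 r c X" "i < r" "j < c"
  shows "\<exists>p q. degree p \<le> degree q \<and> (\<forall>s. X s $$ (i, j) = poly p s / poly q s) \<and>
    (\<forall>s. Re s \<ge> 0 \<longrightarrow> poly q s \<noteq> 0)"
proof -
  obtain p q where pq: "q \<noteq> 0" "coprime p q" "degree p \<le> degree q"
      "(\<lambda>s. X s $$ (i, j)) = (\<lambda>s. poly p s / poly q s)"
    using assms(1,3,4) unfolding proper_rational_mat_def proper_rational_fun_def by blast
  show ?thesis using pq(3) fun_cong[OF pq(4)] stable_denominator[OF assms(2-4) pq(1,2,4)] by blast
qed

lemma common_denominator:
  assumes "proper_rational_mat r c X" "cond_H1 r c X"
  shows "\<exists>q N. (\<forall>s. poly q s = 0 \<longrightarrow> Re s < 0) \<and> (\<forall>i j. degree (N i j) \<le> degree q) \<and>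
    (\<forall>i j s. i < r \<longrightarrow> j < c \<longrightarrow> Re s \<ge> 0 \<longrightarrow> X s $$ (i, j) = poly (N i j) s / poly q s)"
proof -
  define I where "I = {..<r} \<times> {..<c}"
  have "\<forall>e\<in>I. \<exists>p q. degree p \<le> degree q \<and> (\<forall>s. X s $$ e = poly p s / poly q s) \<and>
    (\<forall>s. Re s \<ge> 0 \<longrightarrow> poly q s \<noteq> 0)"
    unfolding I_def using proper_stable_entry[OF assms] by auto
  then obtain p d where pd: "\<And>e. e \<in> I \<Longrightarrow> degree (p e) \<le> degree (d e)"
      "\<And>e s. e \<in> I \<Longrightarrow> X s $$ e = poly (p e) s / poly (d e) s"
      "\<And>e s. e \<in> I \<Longrightarrow> Re s \<ge> 0 \<Longrightarrow> poly (d e) s \<noteq> 0"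
    by metis
  have fin: "finite I" by (simp add: I_def)
  define q where "q = (\<Prod>e\<in>I. d e)"
  define N where "N i j = (if (i, j) \<in> I then p (i, j) * (\<Prod>e\<in>I - {(i, j)}. d e) else 0)" for i j
  have q_split: "q = d e * (\<Prod>e\<in>I - {e}. d e)" if "e \<in> I" for e
    unfolding q_def by (rule prod.remove[OF fin that])
  have root: "Re s < 0" if "poly q s = 0" for s
    using that pd(3)[of _ s] fin unfolding q_def poly_prod by (meson not_le prod_zero_iff)
  have q0: "q \<noteq> 0" using root[of 0] by auto
  have "degree (N i j) \<le> degree q" for i j
  proof (cases "(i, j) \<in> I")
    case True
    define R where "R = (\<Prod>e\<in>I - {(i, j)}. d e)"
    have q: "q = d (i, j) * R" unfolding R_def by (rule q_split[OF True])
    then have "degree q = degree (d (i, j)) + degree R" using q0 by (auto intro: degree_mult_eq)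
    moreover have "degree (N i j) \<le> degree (p (i, j)) + degree R"
      using True degree_mult_le by (simp add: N_def R_def)
    ultimately show ?thesis using pd(1)[OF True] by linarith
  qed (simp add: N_def)
  moreover have "X s $$ (i, j) = poly (N i j) s / poly q s" if "i < r" "j < c" "Re s \<ge> 0" for i j s
  proof -
    have e: "(i, j) \<in> I" using that by (simp add: I_def)
    have "poly q s \<noteq> 0" using root[of s] that by auto
    then show ?thesis unfolding pd(2)[OF e] using e by (simp add: N_def q_split[OF e])
  qed
  ultimately show ?thesis using root by blast
qed

lemma gram_defect_eq_index:
  assumes "Y \<in> carrier_mat n p" "i < n" "j < n"
  shows "(1\<^sub>m n - Y * mat_adjoint Y) $$ (i, j) = gram_defect p 1 (\<lambda>i l. Y $$ (i, l)) i j"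
  using assms mult_adjoint_index[OF assms(1,1,2,3)] by (simp add: gram_defect_def)

lemma contraction_iff_kernel:
  assumes "Y \<in> carrier_mat n p"
  shows "loewner_less n (Y * mat_adjoint Y) (1\<^sub>m n) \<longleftrightarrow> pd_kernel n (gram_defect p 1 (\<lambda>i l. Y $$ (i, l)))"
proof -
  have "1\<^sub>m n - Y * mat_adjoint Y \<in> carrier_mat n n" using assms by auto
  then show ?thesis unfolding loewner_less_def pos_def_iff_kernel
    using pd_kernel_cong[OF gram_defect_eq_index[OF assms]] by simp
qed

lemma axis_value_real: "axis_value X (ereal w) = X (\<i> * complex_of_real w)"
  by (simp add: axis_value_def)

lemma axis_value_infinity:
  assumes "X 0 \<in> carrier_mat r c"
    and "\<And>i j. i < r \<Longrightarrow> j < c \<Longrightarrow> ((\<lambda>w. X (\<i> * complex_of_real w) $$ (i, j)) \<longlongrightarrow> L i j) F"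
    and F: "F = at_top \<and> e = PInfty \<or> F = at_bot \<and> e = MInfty"
  shows "axis_value X e = Matrix.mat r c (\<lambda>(i, j). L i j)"
proof -
  have dims: "dim_row (X 0) = r" "dim_col (X 0) = c" using assms(1) by auto
  have F_nt: "F \<noteq> bot"
    using F by (elim disjE conjE) (simp_all only: trivial_limit_at_top_linorder trivial_limit_at_bot_linorder not_False_eq_True)
  have "axis_value X e = Matrix.mat r c (\<lambda>ij. Lim F (\<lambda>w. X (\<i> * complex_of_real w) $$ ij))"
    using F dims by (auto simp: axis_value_def)
  then show ?thesis using tendsto_Lim[OF F_nt assms(2)] by (intro eq_matI) auto
qed

lemma sum_lessThan_add: "(\<Sum>l<a + b. f l) = (\<Sum>l<a. f l) + (\<Sum>l<b. f (a + l))" for f :: "nat \<Rightarrow> complex"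
  by (induction b) (simp_all add: add.assoc)

text \<open>With \<open>X = N / q\<close>, strict contractivity on the extended axis makes \<open>q q\<^sup>* I - N N\<^sup>*\<close> positive
  definite there, infinity included. Its factor \<open>F F\<^sup>*\<close> extends \<open>N\<close> to the co-isometric row
  \<open>[g N, F] / (g q)\<close>, which dilates to an inner function. The agreement is asserted on the axis only,
  which is all that the power spectrum density sees.\<close>

lemma strict_contraction_dilates:
  assumes X: "proper_rational_mat n n\<^sub>y X" "cond_H1 n n\<^sub>y X"
    and contr: "\<And>w. loewner_less n (axis_value X w * mat_adjoint (axis_value X w)) (1\<^sub>m n)"
  shows "\<exists>H\<in>admissible_equalizers n n\<^sub>y.
    \<forall>s i j. Re s = 0 \<longrightarrow> i < n \<longrightarrow> j < n\<^sub>y \<longrightarrow> H s $$ (i, j) = X s $$ (i, j)"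
proof -
  have carrier: "X s \<in> carrier_mat n n\<^sub>y" for s using X(1) by (simp add: proper_rational_mat_def)
  obtain q N where root: "\<And>s. poly q s = 0 \<Longrightarrow> Re s < 0" and deg: "\<And>i j. degree (N i j) \<le> degree q"
    and frac: "\<And>i j s. i < n \<Longrightarrow> j < n\<^sub>y \<Longrightarrow> Re s \<ge> 0 \<Longrightarrow> X s $$ (i, j) = poly (N i j) s / poly q s"
    using common_denominator[OF X] by blast
  have q0: "q \<noteq> 0" using root[of 0] by auto
  define D where "D = degree q"
  have pd: "pd_kernel n (gram_defect n\<^sub>y u V)"
    if Y: "Y \<in> carrier_mat n n\<^sub>y" "loewner_less n (Y * mat_adjoint Y) (1\<^sub>m n)"
      and u: "u \<noteq> 0" and V: "\<And>i l. i < n \<Longrightarrow> l < n\<^sub>y \<Longrightarrow> Y $$ (i, l) = V i l / u" for Y u V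
  proof -
    have "pd_kernel n (\<lambda>i j. (u * cnj u) * gram_defect n\<^sub>y 1 (\<lambda>i l. Y $$ (i, l)) i j)"
      using pd_kernel_scale[OF _ u] contraction_iff_kernel[OF Y(1)] Y(2) by blast
    moreover have "(u * cnj u) * gram_defect n\<^sub>y 1 (\<lambda>i l. Y $$ (i, l)) i j = gram_defect n\<^sub>y u V i j"
      if "i < n" "j < n" for i j
      unfolding gram_defect_scale[symmetric] unfolding gram_defect_def using that u V by simp
    ultimately show ?thesis
      using pd_kernel_cong[of n "\<lambda>i j. (u * cnj u) * gram_defect n\<^sub>y 1 (\<lambda>i l. Y $$ (i, l)) i j" "gram_defect n\<^sub>y u V"]
      by blast
  qed
  have "\<exists>g m (F :: nat \<Rightarrow> nat \<Rightarrow> complex poly). (\<forall>s. poly g s = 0 \<longrightarrow> Re s < 0) \<and>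
    (\<forall>s i j. Re s = 0 \<longrightarrow> i < n \<longrightarrow> j < n \<longrightarrow>
       (\<Sum>l<m. poly (F i l) s * cnj (poly (F j l) s))
       = gram_defect n\<^sub>y (poly (g * q) s) (\<lambda>i l. poly (g * N i l) s) i j)"
  proof (rule gram_defect_factor_axis)
    show "degree q \<le> D" "degree (N i l) \<le> D" for i l using deg by (auto simp: D_def)
    show "pd_kernel n (gram_defect n\<^sub>y (poly q s) (\<lambda>i l. poly (N i l) s))" if s: "Re s = 0" for s
    proof (rule pd[OF carrier[of s]])
      have "s = \<i> * complex_of_real (Im s)" using s by (simp add: complex_eq_iff)
      then show "loewner_less n (X s * mat_adjoint (X s)) (1\<^sub>m n)"
        using contr[of "ereal (Im s)"] by (simp add: axis_value_real)
      show "poly q s \<noteq> 0" using root[of s] s by auto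
      show "X s $$ (i, l) = poly (N i l) s / poly q s" if "i < n" "l < n\<^sub>y" for i l
        using frac[OF that] s by simp
    qed
    \<comment> \<open>The entries of \<open>X\<close> at infinity.\<close>
    define L where "L i j = coeff (N i j) D / coeff q D" for i j
    have "((\<lambda>w. X (\<i> * complex_of_real w) $$ (i, j)) \<longlongrightarrow> L i j) at_top" if "i < n" "j < n\<^sub>y" for i j
    proof -
      have "((\<lambda>w. poly (N i j) (\<i> * complex_of_real w) / poly q (\<i> * complex_of_real w)) \<longlongrightarrow> L i j) at_top"
        unfolding L_def D_def
        by (rule filterlim_compose[OF proper_poly_frac_tendsto[OF deg q0] filterlim_imaginary_at_infinity(1)])
      then show ?thesis using frac[OF that] by simp
    qed
    from axis_value_infinity[OF carrier this]
    have inf: "axis_value X PInfty = Matrix.mat n n\<^sub>y (\<lambda>(i, j). L i j)" by simp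
    show "pd_kernel n (gram_defect n\<^sub>y (coeff q D) (\<lambda>i l. coeff (N i l) D))"
      by (rule pd[OF _ contr[of PInfty]], unfold inf) (use q0 in \<open>auto simp: L_def D_def\<close>)
  qed
  then obtain g m and F :: "nat \<Rightarrow> nat \<Rightarrow> complex poly" where g: "\<And>s. poly g s = 0 \<Longrightarrow> Re s < 0"
    and F: "\<And>s i j. Re s = 0 \<Longrightarrow> i < n \<Longrightarrow> j < n \<Longrightarrow> (\<Sum>l<m. poly (F i l) s * cnj (poly (F j l) s))
       = gram_defect n\<^sub>y (poly (g * q) s) (\<lambda>i l. poly (g * N i l) s) i j"
    by blast
  define E where "E i l = (if l < n\<^sub>y then g * N i l else F i (l - n\<^sub>y))" for i l
  have "\<exists>H. rational_mat (n + (n\<^sub>y + m)) (n + (n\<^sub>y + m)) H \<and> hardy_inf_mat (n + (n\<^sub>y + m)) (n + (n\<^sub>y + m)) H \<and>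
    cond_H1 (n + (n\<^sub>y + m)) (n + (n\<^sub>y + m)) H \<and> paraunitary (n + (n\<^sub>y + m)) H \<and>
    (\<forall>s i j. Re s = 0 \<longrightarrow> i < n \<longrightarrow> j < n\<^sub>y + m \<longrightarrow> H s $$ (i, j) = poly (E i j) s / poly (g * q) s)"
  proof (rule inner_dilation)
    show "Re s < 0" if "poly (g * q) s = 0" for s using that g root by auto
    show "(\<Sum>l<n\<^sub>y + m. poly (E i l) s * cnj (poly (E j l) s))
        = (if i = j then poly (g * q) s * cnj (poly (g * q) s) else 0)"
      if "Re s = 0" "i < n" "j < n" for s i j
      unfolding sum_lessThan_add using F[OF that] by (simp add: E_def gram_defect_def)
  qed
  then obtain H where H: "rational_mat (n + (n\<^sub>y + m)) (n + (n\<^sub>y + m)) H" "hardy_inf_mat (n + (n\<^sub>y + m)) (n + (n\<^sub>y + m)) H"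
    "cond_H1 (n + (n\<^sub>y + m)) (n + (n\<^sub>y + m)) H" "paraunitary (n + (n\<^sub>y + m)) H"
    "\<And>s i j. Re s = 0 \<Longrightarrow> i < n \<Longrightarrow> j < n\<^sub>y + m \<Longrightarrow> H s $$ (i, j) = poly (E i j) s / poly (g * q) s"
    by blast
  have "n + (n\<^sub>y + m) = n\<^sub>y + (n + m)" by simp
  then have "H \<in> admissible_equalizers n n\<^sub>y"
    unfolding admissible_equalizers_def using H(1-4)
    by (intro CollectI exI[of _ "n + m"] exI[of _ "n + (n\<^sub>y + m)"]) auto
  moreover have "H s $$ (i, j) = X s $$ (i, j)" if "Re s = 0" "i < n" "j < n\<^sub>y" for s i j
  proof -
    have "poly g s \<noteq> 0" using g[of s] that(1) by auto
    then show ?thesis using H(5)[of s i j] frac[of i j s] that by (simp add: E_def)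
  qed
  ultimately show ?thesis by blast
qed

lemma block11_index:
  assumes "i < r" "j < c"
  shows "block11 r c X s $$ (i, j) = X s $$ (i, j)"
  using assms by (simp add: block11_def split_block_def Let_def)

lemma block11_carrier: "block11 r c X s \<in> carrier_mat r c"
  by (simp add: block11_def split_block_def Let_def)

lemma block11_entry:
  "i < r \<Longrightarrow> j < c \<Longrightarrow> (\<lambda>s. block11 r c X s $$ (i, j)) = (\<lambda>s. X s $$ (i, j))"
  by (simp add: block11_index)

lemma axis_point_conj: "- cnj (\<i> * complex_of_real w) = \<i> * complex_of_real w"
  by (simp add: complex_eq_iff)

text \<open>On the axis \<open>- cnj s = s\<close>, so the power spectrum density depends on the axis values only.\<close>

lemma cond_PSD_cong:
  assumes "\<And>w. X (\<i> * complex_of_real w) = Y (\<i> * complex_of_real w)"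
  shows "cond_PSD n \<Phi> \<gamma> X = cond_PSD n \<Phi> \<gamma> Y"
  unfolding cond_PSD_def error_psd_def sys_conj_def axis_point_conj assms ..

lemma strict_subset_contr: "filters_strict n n\<^sub>y \<Phi> \<gamma> \<subseteq> filters_contr n n\<^sub>y \<Phi> \<gamma>"
proof
  fix X assume X: "X \<in> filters_strict n n\<^sub>y \<Phi> \<gamma>"
  have "loewner_le n (X (\<i> * complex_of_real w) * mat_adjoint (X (\<i> * complex_of_real w))) (1\<^sub>m n)" for w
  proof -
    define M where "M = 1\<^sub>m n - X (\<i> * complex_of_real w) * mat_adjoint (X (\<i> * complex_of_real w))"
    have "loewner_less n (axis_value X (ereal w) * mat_adjoint (axis_value X (ereal w))) (1\<^sub>m n)"
      using X unfolding filters_strict_def by blast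
    then have M: "pos_def n M" by (simp add: loewner_less_def M_def axis_value_real)
    have "Re ((M *\<^sub>v v) \<bullet>c v) \<ge> 0" if v: "v \<in> carrier_vec n" for v
    proof (cases "v = 0\<^sub>v n")
      case True
      have "M *\<^sub>v 0\<^sub>v n \<in> carrier_vec n" using M by (auto simp: pos_def_def)
      then have "(M *\<^sub>v v) \<bullet>c v = 0" by (simp add: True)
      then show ?thesis by simp
    next
      case False
      then show ?thesis using M v by (auto simp: pos_def_def less_imp_le)
    qed
    then show ?thesis using M by (simp add: loewner_le_def pos_semidef_def pos_def_def M_def)
  qed
  then show "X \<in> filters_contr n n\<^sub>y \<Phi> \<gamma>"
    using X unfolding filters_contr_def filters_strict_def by (auto intro: proper_rational_imp_rational)
qed

text \<open>The diagonal of \<open>I - Y Y\<^sup>*\<close> is nonnegative.\<close>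

lemma loewner_le_entry_bound:
  assumes Y: "Y \<in> carrier_mat n p" and le: "loewner_le n (Y * mat_adjoint Y) (1\<^sub>m n)" and ij: "i < n" "j < p"
  shows "cmod (Y $$ (i, j)) \<le> 1"
proof -
  define M where "M = 1\<^sub>m n - Y * mat_adjoint Y"
  have M: "M \<in> carrier_mat n n" using Y by (auto simp: M_def)
  have u: "unit_vec n i \<in> carrier_vec n" by simp
  have "(M *\<^sub>v unit_vec n i) \<bullet>c unit_vec n i = M $$ (i, i)"
  proof -
    have "qform n (\<lambda>a b. M $$ (a, b)) (vec_index (unit_vec n i))
        = (\<Sum>a<n. if a = i then (\<Sum>b<n. if b = i then M $$ (i, b) else 0) else 0)"
      unfolding qform_def using ij by (intro sum.cong refl) (auto simp: mult_delta_left mult_delta_right)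
    also have "\<dots> = M $$ (i, i)" using ij by simp
    finally show ?thesis unfolding qform_vec[OF M u] .
  qed
  then have "Re (M $$ (i, i)) \<ge> 0"
    using le u unfolding loewner_le_def pos_semidef_def M_def[symmetric] by metis
  moreover have "M $$ (i, i) = 1 - complex_of_real (\<Sum>l<p. (cmod (Y $$ (i, l)))\<^sup>2)"
    unfolding M_def gram_defect_eq_index[OF Y ij(1) ij(1)] gram_defect_def
    by (simp add: complex_norm_square[symmetric])
  ultimately have "(\<Sum>l<p. (cmod (Y $$ (i, l)))\<^sup>2) \<le> 1" by simp
  moreover have "(cmod (Y $$ (i, j)))\<^sup>2 \<le> (\<Sum>l<p. (cmod (Y $$ (i, l)))\<^sup>2)"
    using ij(2) by (intro member_le_sum) auto
  ultimately have "(cmod (Y $$ (i, j)))\<^sup>2 \<le> 1\<^sup>2" by simp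
  then show ?thesis by (rule power2_le_imp_le) simp
qed

text \<open>Contractivity on the axis bounds the entries there, which for stable rational functions forces
  properness and hence boundedness on the half-plane.\<close>

lemma contr_subset_hardy: "filters_contr n n\<^sub>y \<Phi> \<gamma> \<subseteq> filters_hardy n n\<^sub>y \<Phi> \<gamma>"
proof
  fix X assume X: "X \<in> filters_contr n n\<^sub>y \<Phi> \<gamma>"
  then have rat: "rational_mat n n\<^sub>y X" and H1: "cond_H1 n n\<^sub>y X" by (auto simp: filters_contr_def)
  have "hardy_inf_mat n n\<^sub>y X"
    unfolding hardy_inf_mat_def
  proof (intro allI impI)
    fix i j assume ij: "i < n" "j < n\<^sub>y"
    obtain p q where pq: "q \<noteq> 0" "(\<lambda>s. X s $$ (i, j)) = (\<lambda>s. poly p s / poly q s)" and "coprime p q"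
      using rat ij unfolding rational_mat_def rational_fun_def by blast
    have nz: "poly q s \<noteq> 0" if "Re s \<ge> 0" for s
      using stable_denominator[OF H1 ij pq(1) \<open>coprime p q\<close> pq(2) that] .
    have "degree p \<le> degree q"
    proof (rule poly_frac_proper_if_bounded[OF pq(1)])
      show "filterlim (\<lambda>k. \<i> * complex_of_real (real k)) at_infinity sequentially"
        by (rule filterlim_compose[OF filterlim_imaginary_at_infinity(1) filterlim_real_sequentially])
      fix k
      have "cmod (X (\<i> * complex_of_real (real k)) $$ (i, j)) \<le> 1"
      proof (rule loewner_le_entry_bound[OF _ _ ij])
        show "X (\<i> * complex_of_real (real k)) \<in> carrier_mat n n\<^sub>y" using rat unfolding rational_mat_def by blast
        show "loewner_le n (X (\<i> * complex_of_real (real k)) * mat_adjoint (X (\<i> * complex_of_real (real k)))) (1\<^sub>m n)"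
          using X unfolding filters_contr_def by blast
      qed
      then show "cmod (poly p (\<i> * complex_of_real (real k)) / poly q (\<i> * complex_of_real (real k))) \<le> 1"
        using fun_cong[OF pq(2)] by metis
    qed
    then show "hardy_inf (\<lambda>s. X s $$ (i, j))" unfolding pq(2) by (intro proper_poly_frac_hardy nz)
  qed
  then show "X \<in> filters_hardy n n\<^sub>y \<Phi> \<gamma>" using X by (auto simp: filters_hardy_def filters_contr_def)
qed

lemma hardy_imp_proper:
  assumes "rational_mat r c X" "hardy_inf_mat r c X"
  shows "proper_rational_mat r c X"
  unfolding proper_rational_mat_def
proof (intro conjI allI impI)
  show "X s \<in> carrier_mat r c" for s using assms(1) by (simp add: rational_mat_def)
  fix i j assume ij: "i < r" "j < c"
  obtain p q where pq: "q \<noteq> 0" "coprime p q" "(\<lambda>s. X s $$ (i, j)) = (\<lambda>s. poly p s / poly q s)"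
    using assms(1) ij unfolding rational_mat_def rational_fun_def by blast
  have "hardy_inf (\<lambda>s. poly p s / poly q s)" using assms(2) ij unfolding hardy_inf_mat_def pq(3)[symmetric] by blast
  then obtain B where B: "\<And>s. Re s > 0 \<Longrightarrow> cmod (poly p s / poly q s) \<le> B"
    unfolding hardy_inf_def bounded_iff by (auto simp: image_iff)
  have "degree p \<le> degree q"
    by (rule poly_frac_proper_if_bounded[OF pq(1) filterlim_of_nat_Suc]) (rule B, simp)
  then show "proper_rational_fun (\<lambda>s. X s $$ (i, j))"
    unfolding proper_rational_fun_def pq(3) using pq(1,2) by blast
qed

lemma admissible_block_hardy:
  assumes "H \<in> admissible_equalizers n n\<^sub>y" "cond_PSD n \<Phi> \<gamma> (block11 n n\<^sub>y H)"
  shows "block11 n n\<^sub>y H \<in> filters_hardy n n\<^sub>y \<Phi> \<gamma>"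
proof -
  obtain n\<^sub>z k where "k = n\<^sub>y + n\<^sub>z" and k: "n \<le> k" "rational_mat k k H" "hardy_inf_mat k k H" "cond_H1 k k H"
    using assms(1) unfolding admissible_equalizers_def by blast
  then have k': "n\<^sub>y \<le> k" by simp
  have e: "(\<lambda>s. block11 n n\<^sub>y H s $$ (i, j)) = (\<lambda>s. H s $$ (i, j))" "i < k" "j < k" if "i < n" "j < n\<^sub>y" for i j
    using block11_entry[OF that] that k(1) k' by simp_all
  have "rational_mat n n\<^sub>y (block11 n n\<^sub>y H)"
    using k(2) e unfolding rational_mat_def by (simp add: block11_carrier)
  moreover have "hardy_inf_mat n n\<^sub>y (block11 n n\<^sub>y H)"
    using k(3) e unfolding hardy_inf_mat_def by simp
  moreover have "cond_H1 n n\<^sub>y (block11 n n\<^sub>y H)"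
    unfolding cond_H1_def
  proof (intro conjI allI impI)
    fix s assume "mat_pole n n\<^sub>y (block11 n n\<^sub>y H) s"
    then obtain i j where ij: "i < n" "j < n\<^sub>y" "is_pole (\<lambda>s. block11 n n\<^sub>y H s $$ (i, j)) s"
      unfolding mat_pole_def by blast
    then have "mat_pole k k H s" using e[OF ij(1,2)] unfolding mat_pole_def by auto
    then show "Re s < 0" using k(4) unfolding cond_H1_def by blast
  next
    obtain \<tau> where "\<tau> > 0" "mat_analytic_on k k H {s. Re s > - \<tau>}"
      using k(4) unfolding cond_H1_def by blast
    then show "\<exists>\<tau>>0. mat_analytic_on n n\<^sub>y (block11 n n\<^sub>y H) {s. Re s > - \<tau>}"
      using e unfolding mat_analytic_on_def by (intro exI[of _ \<tau>]) simp
  qed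
  ultimately show ?thesis using assms(2) by (simp add: filters_hardy_def)
qed

section \<open>Behaviour of the channel at infinity\<close>

text \<open>Values at infinity are defined as limits, so it is the existence of limits that has to be
  propagated through the construction of \<open>\<Phi>\<close>.\<close>

definition mat_conv :: "nat \<Rightarrow> nat \<Rightarrow> (real \<Rightarrow> complex mat) \<Rightarrow> real filter \<Rightarrow> bool" where
  "mat_conv r c Y F \<longleftrightarrow> (\<forall>w. Y w \<in> carrier_mat r c) \<and>
     (\<forall>i<r. \<forall>j<c. \<exists>l. ((\<lambda>w. Y w $$ (i, j)) \<longlongrightarrow> l) F)"

lemma mat_conv_const: "M \<in> carrier_mat r c \<Longrightarrow> mat_conv r c (\<lambda>_. M) F"
  unfolding mat_conv_def by (auto intro: tendsto_const)

lemma mat_conv_add: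
  assumes "mat_conv r c X F" "mat_conv r c Y F"
  shows "mat_conv r c (\<lambda>w. X w + Y w) F"
  unfolding mat_conv_def
proof (intro conjI allI impI)
  show "X w + Y w \<in> carrier_mat r c" for w using assms by (simp add: mat_conv_def)
  fix i j assume ij: "i < r" "j < c"
  obtain a b where "((\<lambda>w. X w $$ (i, j)) \<longlongrightarrow> a) F" "((\<lambda>w. Y w $$ (i, j)) \<longlongrightarrow> b) F"
    using assms ij unfolding mat_conv_def by blast
  then have "((\<lambda>w. X w $$ (i, j) + Y w $$ (i, j)) \<longlongrightarrow> a + b) F" by (rule tendsto_add)
  moreover have "Y w \<in> carrier_mat r c" for w using assms(2) by (simp add: mat_conv_def)
  then have "(X w + Y w) $$ (i, j) = X w $$ (i, j) + Y w $$ (i, j)" for w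
    using ij by (metis carrier_matD index_add_mat(1))
  ultimately show "\<exists>l. ((\<lambda>w. (X w + Y w) $$ (i, j)) \<longlongrightarrow> l) F" by auto
qed

lemma mat_conv_uminus:
  assumes "mat_conv r c X F"
  shows "mat_conv r c (\<lambda>w. - X w) F"
  unfolding mat_conv_def
proof (intro conjI allI impI)
  have X: "X w \<in> carrier_mat r c" for w using assms by (simp add: mat_conv_def)
  then show "- X w \<in> carrier_mat r c" for w by simp
  fix i j assume ij: "i < r" "j < c"
  obtain a where "((\<lambda>w. X w $$ (i, j)) \<longlongrightarrow> a) F" using assms ij unfolding mat_conv_def by blast
  then have "((\<lambda>w. - X w $$ (i, j)) \<longlongrightarrow> - a) F" by (rule tendsto_minus)
  moreover have "(- X w) $$ (i, j) = - X w $$ (i, j)" for w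
    using X[of w] ij by (intro index_uminus_mat) auto
  ultimately show "\<exists>l. ((\<lambda>w. (- X w) $$ (i, j)) \<longlongrightarrow> l) F" by auto
qed

lemma mult_mat_index:
  assumes "X \<in> carrier_mat r k" "Y \<in> carrier_mat k c" "i < r" "j < c"
  shows "(X * Y) $$ (i, j) = (\<Sum>l<k. X $$ (i, l) * Y $$ (l, j))"
  using assms by (simp add: scalar_prod_def lessThan_atLeast0)

lemma mat_conv_mult:
  assumes "mat_conv r k X F" "mat_conv k c Y F"
  shows "mat_conv r c (\<lambda>w. X w * Y w) F"
  unfolding mat_conv_def
proof (intro conjI allI impI)
  have X: "X w \<in> carrier_mat r k" and Y: "Y w \<in> carrier_mat k c" for w
    using assms by (simp_all add: mat_conv_def)
  show "X w * Y w \<in> carrier_mat r c" for w using X Y by (rule mult_carrier_mat)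
  fix i j assume ij: "i < r" "j < c"
  have "\<forall>l<k. \<exists>a. ((\<lambda>w. X w $$ (i, l)) \<longlongrightarrow> a) F" "\<forall>l<k. \<exists>a. ((\<lambda>w. Y w $$ (l, j)) \<longlongrightarrow> a) F"
    using assms ij unfolding mat_conv_def by auto
  then obtain a b where ab: "\<And>l. l < k \<Longrightarrow> ((\<lambda>w. X w $$ (i, l)) \<longlongrightarrow> a l) F"
      "\<And>l. l < k \<Longrightarrow> ((\<lambda>w. Y w $$ (l, j)) \<longlongrightarrow> b l) F"
    by metis
  have "((\<lambda>w. \<Sum>l<k. X w $$ (i, l) * Y w $$ (l, j)) \<longlongrightarrow> (\<Sum>l<k. a l * b l)) F"
    by (intro tendsto_intros ab) auto
  then show "\<exists>l. ((\<lambda>w. (X w * Y w) $$ (i, j)) \<longlongrightarrow> l) F"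
    unfolding mult_mat_index[OF X Y ij] by blast
qed

lemma mat_conv_adjoint:
  assumes "mat_conv r c X F"
  shows "mat_conv c r (\<lambda>w. mat_adjoint (X w)) F"
  unfolding mat_conv_def
proof (intro conjI allI impI)
  have X: "X w \<in> carrier_mat r c" for w using assms by (simp add: mat_conv_def)
  then show "mat_adjoint (X w) \<in> carrier_mat c r" for w by simp
  fix i j assume ij: "i < c" "j < r"
  obtain a where "((\<lambda>w. X w $$ (j, i)) \<longlongrightarrow> a) F" using assms ij unfolding mat_conv_def by blast
  then have "((\<lambda>w. cnj (X w $$ (j, i))) \<longlongrightarrow> cnj a) F" by (rule tendsto_cnj)
  moreover have "mat_adjoint (X w) $$ (i, j) = cnj (X w $$ (j, i))" for w
    using X[of w] ij by (intro mat_adjoint_index) auto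
  ultimately show "\<exists>l. ((\<lambda>w. mat_adjoint (X w) $$ (i, j)) \<longlongrightarrow> l) F" by auto
qed

lemma mat_conv_four_block:
  assumes "mat_conv r1 c1 P F" "mat_conv r1 c2 Q F" "mat_conv r2 c1 R F" "mat_conv r2 c2 S F"
  shows "mat_conv (r1 + r2) (c1 + c2) (\<lambda>w. four_block_mat (P w) (Q w) (R w) (S w)) F"
  unfolding mat_conv_def
proof (intro conjI allI impI)
  have car: "P w \<in> carrier_mat r1 c1" "Q w \<in> carrier_mat r1 c2" "R w \<in> carrier_mat r2 c1" "S w \<in> carrier_mat r2 c2" for w
    using assms by (simp_all add: mat_conv_def)
  show "four_block_mat (P w) (Q w) (R w) (S w) \<in> carrier_mat (r1 + r2) (c1 + c2)" for w
    using car(1,4) by (rule four_block_carrier_mat)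
  fix i j assume ij: "i < r1 + r2" "j < c1 + c2"
  have dims: "dim_row (P w) = r1" "dim_col (P w) = c1" "dim_row (S w) = r2" "dim_col (S w) = c2" for w
    using car(1,4)[of w] by auto
  have idx: "four_block_mat (P w) (Q w) (R w) (S w) $$ (i, j) =
      (if i < r1 then if j < c1 then P w $$ (i, j) else Q w $$ (i, j - c1)
       else if j < c1 then R w $$ (i - r1, j) else S w $$ (i - r1, j - c1))" for w
    using ij dims by (subst index_mat_four_block) auto
  have "i < r1 \<or> i - r1 < r2" "j < c1 \<or> j - c1 < c2" using ij by auto
  then show "\<exists>l. ((\<lambda>w. four_block_mat (P w) (Q w) (R w) (S w) $$ (i, j)) \<longlongrightarrow> l) F"
    unfolding idx using assms unfolding mat_conv_def by (cases "i < r1"; cases "j < c1") auto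
qed

lemma mat_conv_block11:
  assumes "mat_conv R C (\<lambda>w. G (f w)) F" "r \<le> R" "c \<le> C"
  shows "mat_conv r c (\<lambda>w. block11 r c G (f w)) F"
  using assms unfolding mat_conv_def by (auto simp: block11_carrier block11_index)

lemma mat_conv_block12:
  assumes "mat_conv R (c + c') (\<lambda>w. G (f w)) F" "r \<le> R"
  shows "mat_conv r c' (\<lambda>w. block12 r c G (f w)) F"
  unfolding mat_conv_def
proof (intro conjI allI impI)
  have dim: "dim_col (G (f w)) = c + c'" for w
    using assms(1) unfolding mat_conv_def by (metis carrier_matD(2))
  then have eq: "block12 r c G (f w) = Matrix.mat r c' (\<lambda>(i, j). G (f w) $$ (i, j + c))" for w
    by (simp add: block12_def split_block_def Let_def)
  then show "block12 r c G (f w) \<in> carrier_mat r c'" for w by simp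
  fix i j assume "i < r" "j < c'"
  then show "\<exists>l. ((\<lambda>w. block12 r c G (f w) $$ (i, j)) \<longlongrightarrow> l) F"
    using assms unfolding eq mat_conv_def by simp
qed

lemma resolvent_exists:
  fixes A :: "complex mat" and s :: complex
  assumes A: "A \<in> carrier_mat \<nu> \<nu>" and s: "\<not> eigenvalue A s"
  obtains R where "mat_inverse (s \<cdot>\<^sub>m 1\<^sub>m \<nu> - A) = Some R" "R \<in> carrier_mat \<nu> \<nu>"
    "(s \<cdot>\<^sub>m 1\<^sub>m \<nu> - A) * R = 1\<^sub>m \<nu>"
proof -
  define K where "K = s \<cdot>\<^sub>m 1\<^sub>m \<nu> - A"
  have K: "K \<in> carrier_mat \<nu> \<nu>" unfolding K_def using A by (intro carrier_matI) auto
  have "K = (-1) \<cdot>\<^sub>m char_matrix A s"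
    using A by (intro eq_matI) (auto simp: K_def char_matrix_def)
  moreover have "det (char_matrix A s) \<noteq> 0" using eigenvalue_det[OF A] s by blast
  ultimately have "Determinant.det K \<noteq> 0" by (simp add: det_smult)
  then have "K \<in> Units (ring_mat TYPE(complex) \<nu> ())" by (rule det_non_zero_imp_unit[OF K])
  then obtain R where R: "mat_inverse K = Some R" using mat_inverse(1)[OF K] by fastforce
  then show ?thesis using that mat_inverse(2)[OF K R] unfolding K_def by blast
qed

text \<open>The identity \<open>s R = I + A R\<close>, summed over all entries in absolute value, bounds the entry sum
  of \<open>R\<close> by \<open>\<nu>\<^sup>2 / (\<bar>s\<bar> - a)\<close>.\<close>

lemma resolvent_entry_bound:
  fixes A R :: "complex mat" and s :: complex
  assumes A: "A \<in> carrier_mat \<nu> \<nu>" and R: "R \<in> carrier_mat \<nu> \<nu>" and inv: "(s \<cdot>\<^sub>m 1\<^sub>m \<nu> - A) * R = 1\<^sub>m \<nu>"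
  defines "a \<equiv> \<Sum>i<\<nu>. \<Sum>j<\<nu>. cmod (A $$ (i, j))"
  assumes s: "cmod s > a" and ij: "i < \<nu>" "j < \<nu>"
  shows "cmod (R $$ (i, j)) \<le> (real \<nu>)\<^sup>2 / (cmod s - a)"
proof -
  define r where "r = (\<Sum>i<\<nu>. \<Sum>j<\<nu>. cmod (R $$ (i, j)))"
  have row: "cmod s * cmod (R $$ (i, j)) \<le> 1 + (\<Sum>k<\<nu>. cmod (A $$ (i, k)) * cmod (R $$ (k, j)))"
    if ij: "i < \<nu>" "j < \<nu>" for i j
  proof -
    have K: "s \<cdot>\<^sub>m 1\<^sub>m \<nu> - A \<in> carrier_mat \<nu> \<nu>" using A by (intro carrier_matI) auto
    have "(if i = j then 1 else 0) = (\<Sum>k<\<nu>. (s \<cdot>\<^sub>m 1\<^sub>m \<nu> - A) $$ (i, k) * R $$ (k, j))"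
      using mult_mat_index[OF K R ij] ij unfolding inv by simp
    also have "\<dots> = (\<Sum>k<\<nu>. (if k = i then s * R $$ (k, j) else 0) - A $$ (i, k) * R $$ (k, j))"
      using A ij by (intro sum.cong refl) (auto simp: algebra_simps)
    also have "\<dots> = s * R $$ (i, j) - (\<Sum>k<\<nu>. A $$ (i, k) * R $$ (k, j))"
      using ij by (simp add: sum_subtractf)
    finally have "s * R $$ (i, j) = (if i = j then 1 else 0) + (\<Sum>k<\<nu>. A $$ (i, k) * R $$ (k, j))"
      by (simp add: algebra_simps)
    then have "cmod (s * R $$ (i, j)) \<le> cmod (if i = j then 1 else 0) + cmod (\<Sum>k<\<nu>. A $$ (i, k) * R $$ (k, j))"
      by (metis norm_triangle_ineq)
    also have "\<dots> \<le> 1 + (\<Sum>k<\<nu>. cmod (A $$ (i, k) * R $$ (k, j)))"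
      by (intro add_mono norm_sum) simp
    finally show ?thesis by (simp add: norm_mult)
  qed
  have "cmod s * r \<le> (\<Sum>i<\<nu>. \<Sum>j<\<nu>. 1 + (\<Sum>k<\<nu>. cmod (A $$ (i, k)) * cmod (R $$ (k, j))))"
    unfolding r_def sum_distrib_left by (intro sum_mono row) auto
  also have "\<dots> = (real \<nu>)\<^sup>2 + (\<Sum>i<\<nu>. \<Sum>k<\<nu>. cmod (A $$ (i, k)) * (\<Sum>j<\<nu>. cmod (R $$ (k, j))))"
  proof -
    have "(\<Sum>j<\<nu>. \<Sum>k<\<nu>. cmod (A $$ (i, k)) * cmod (R $$ (k, j))) = (\<Sum>k<\<nu>. cmod (A $$ (i, k)) * (\<Sum>j<\<nu>. cmod (R $$ (k, j))))" for i
      unfolding sum_distrib_left by (rule sum.swap)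
    then show ?thesis by (simp add: sum.distrib power2_eq_square)
  qed
  also have "\<dots> \<le> (real \<nu>)\<^sup>2 + (\<Sum>i<\<nu>. \<Sum>k<\<nu>. cmod (A $$ (i, k)) * r)"
  proof -
    have "(\<Sum>j<\<nu>. cmod (R $$ (k, j))) \<le> r" if "k < \<nu>" for k
      unfolding r_def using that
      by (intro member_le_sum[of k "{..<\<nu>}" "\<lambda>k. \<Sum>j<\<nu>. cmod (R $$ (k, j))"]) (auto intro: sum_nonneg)
    then show ?thesis by (intro add_mono sum_mono mult_left_mono) auto
  qed
  also have "\<dots> = (real \<nu>)\<^sup>2 + a * r" by (simp add: a_def sum_distrib_right)
  finally have "r * (cmod s - a) \<le> (real \<nu>)\<^sup>2" by (simp add: algebra_simps)
  then have "r \<le> (real \<nu>)\<^sup>2 / (cmod s - a)" using s by (simp add: pos_le_divide_eq)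
  moreover have "cmod (R $$ (i, j)) \<le> r"
  proof -
    have "cmod (R $$ (i, j)) \<le> (\<Sum>j<\<nu>. cmod (R $$ (i, j)))"
      using ij(2) by (intro member_le_sum) auto
    also have "\<dots> \<le> r"
      unfolding r_def using ij(1)
      by (intro member_le_sum[of i "{..<\<nu>}" "\<lambda>k. \<Sum>j<\<nu>. cmod (R $$ (k, j))"]) (auto intro: sum_nonneg)
    finally show ?thesis .
  qed
  ultimately show ?thesis by simp
qed

lemma mat_conv_transfer_function:
  assumes ss: "state_space \<nu> m p A B C D" and hurwitz: "hurwitz A"
    and F: "filterlim (\<lambda>w. \<i> * complex_of_real w) at_infinity F"
  shows "mat_conv p m (\<lambda>w. transfer_function A B C D (\<i> * complex_of_real w)) F"
proof -
  have car: "A \<in> carrier_mat \<nu> \<nu>" "B \<in> carrier_mat \<nu> m" "C \<in> carrier_mat p \<nu>" "D \<in> carrier_mat p m"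
    using ss by (auto simp: state_space_def)
  define s where "s w = \<i> * complex_of_real w" for w
  define R where "R w = the (mat_inverse (s w \<cdot>\<^sub>m 1\<^sub>m \<nu> - A))" for w
  have R: "R w \<in> carrier_mat \<nu> \<nu>" "(s w \<cdot>\<^sub>m 1\<^sub>m \<nu> - A) * R w = 1\<^sub>m \<nu>" for w
  proof -
    have "\<not> eigenvalue A (s w)" using hurwitz by (auto simp: hurwitz_def s_def)
    then show "R w \<in> carrier_mat \<nu> \<nu>" "(s w \<cdot>\<^sub>m 1\<^sub>m \<nu> - A) * R w = 1\<^sub>m \<nu>"
      using resolvent_exists[OF car(1)] unfolding R_def by (metis option.sel)+
  qed
  define a where "a = (\<Sum>i<\<nu>. \<Sum>j<\<nu>. cmod (A $$ (i, j)))"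
  have "mat_conv \<nu> \<nu> R F"
    unfolding mat_conv_def
  proof (intro conjI allI impI R(1))
    fix i j assume ij: "i < \<nu>" "j < \<nu>"
    have norm_inf: "filterlim (\<lambda>w. cmod (s w)) at_top F"
      using F unfolding filterlim_at_infinity_conv_norm_at_top s_def .
    have "((\<lambda>w. (real \<nu>)\<^sup>2 / (cmod (s w) - a)) \<longlongrightarrow> 0) F"
    proof (rule real_tendsto_divide_at_top[OF tendsto_const])
      show "filterlim (\<lambda>w. cmod (s w) - a) at_top F"
        using filterlim_tendsto_add_at_top[OF tendsto_const[of "- a"] norm_inf] by simp
    qed
    moreover have "eventually (\<lambda>w. norm (R w $$ (i, j)) \<le> (real \<nu>)\<^sup>2 / (cmod (s w) - a)) F"
    proof -
      have "eventually (\<lambda>w. cmod (s w) > a) F" using norm_inf by (simp add: filterlim_at_top_dense)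
      then show ?thesis
        by eventually_elim (unfold a_def, rule resolvent_entry_bound[OF car(1) R], use ij in auto)
    qed
    ultimately have "((\<lambda>w. R w $$ (i, j)) \<longlongrightarrow> 0) F" by (rule Lim_null_comparison[rotated])
    then show "\<exists>l. ((\<lambda>w. R w $$ (i, j)) \<longlongrightarrow> l) F" by blast
  qed
  then have "mat_conv p m (\<lambda>w. D + C * R w * B) F"
    by (intro mat_conv_add mat_conv_mult[of _ \<nu>] mat_conv_const car)
  then show ?thesis
    unfolding transfer_function_def R_def s_def using car(1) by simp
qed

lemma mat_conv_channel_Phi:
  assumes channel: "channel n n\<^sub>w n\<^sub>y n\<^sub>d \<nu> A B C D"
    and S: "Su \<in> carrier_mat n n" "Sw \<in> carrier_mat n\<^sub>w n\<^sub>w"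
    and F: "filterlim (\<lambda>w. \<i> * complex_of_real w) at_infinity F"
  shows "mat_conv (n\<^sub>y + n) (n\<^sub>y + n) (\<lambda>w. channel_Phi n n\<^sub>y A B C D Su Sw (\<i> * complex_of_real w)) F"
proof -
  define G where "G = transfer_function A B C D"
  have G: "mat_conv (n\<^sub>y + n\<^sub>d) (n + n\<^sub>w) (\<lambda>w. G (\<i> * complex_of_real w)) F"
    unfolding G_def using channel F
    by (intro mat_conv_transfer_function) (auto simp: channel_def minimal_realization_def)
  have G11: "mat_conv n\<^sub>y n (\<lambda>w. block11 n\<^sub>y n G (\<i> * complex_of_real w)) F"
    by (rule mat_conv_block11[of "n\<^sub>y + n\<^sub>d" "n + n\<^sub>w" G "\<lambda>w. \<i> * complex_of_real w", OF G]) simp_all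
  have G12: "mat_conv n\<^sub>y n\<^sub>w (\<lambda>w. block12 n\<^sub>y n G (\<i> * complex_of_real w)) F"
    by (rule mat_conv_block12[of "n\<^sub>y + n\<^sub>d" n n\<^sub>w G "\<lambda>w. \<i> * complex_of_real w", OF G]) simp
  have St: "mat_conv n n (\<lambda>_. Su\<^sup>T) F" "mat_conv n\<^sub>w n\<^sub>w (\<lambda>_. Sw\<^sup>T) F"
    "mat_conv n n (\<lambda>_. 1\<^sub>m n + Su\<^sup>T) F" "mat_conv n n (\<lambda>_. Su\<^sup>T + 2 \<cdot>\<^sub>m 1\<^sub>m n) F"
    using S by (intro mat_conv_const; simp)+
  note G11' = mat_conv_adjoint[OF G11] and G12' = mat_conv_adjoint[OF G12]
  show ?thesis
    unfolding channel_Phi_def Let_def Phi_def Psi_def sys_conj_def axis_point_conj G_def[symmetric]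
    by (rule mat_conv_four_block mat_conv_add mat_conv_uminus mat_conv_mult[OF G11 St(3)] mat_conv_mult[OF St(3) G11']
        mat_conv_mult[OF mat_conv_mult[OF G11 St(1)] G11'] mat_conv_mult[OF mat_conv_mult[OF G12 St(2)] G12'] St(4))+
qed

section \<open>The multiplier condition\<close>

text \<open>The entries of the block row \<open>[x I]\<close>, with \<open>p\<close> columns in \<open>x\<close>.\<close>

definition frame :: "nat \<Rightarrow> complex mat \<Rightarrow> nat \<Rightarrow> nat \<Rightarrow> complex" where
  "frame p x a i = (if i < p then x $$ (a, i) else if i - p = a then 1 else 0)"

text \<open>The entries of \<open>[x I] M [x I]\<^sup>*\<close>, which is the power spectrum density at a point of the axis.\<close>

definition compress :: "nat \<Rightarrow> nat \<Rightarrow> complex mat \<Rightarrow> complex mat \<Rightarrow> nat \<Rightarrow> nat \<Rightarrow> complex" where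
  "compress n p x M a b = (\<Sum>i<p + n. \<Sum>j<p + n. frame p x a i * M $$ (i, j) * cnj (frame p x b j))"

lemma qform_compress:
  "qform n (compress n p x M) v
   = qform (p + n) (\<lambda>i j. M $$ (i, j)) (\<lambda>i. \<Sum>a<n. cnj (frame p x a i) * v a)"
proof -
  have "qform n (compress n p x M) v
      = (\<Sum>a<n. \<Sum>b<n. \<Sum>i<p + n. \<Sum>j<p + n. cnj (v a) * frame p x a i * M $$ (i, j) * (cnj (frame p x b j) * v b))"
    unfolding qform_def compress_def sum_distrib_left sum_distrib_right
    by (intro sum.cong refl) (simp add: mult_ac)
  also have "\<dots> = (\<Sum>a<n. \<Sum>i<p + n. \<Sum>j<p + n. \<Sum>b<n. cnj (v a) * frame p x a i * M $$ (i, j) * (cnj (frame p x b j) * v b))"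
    by (rule sum.cong[OF refl], rule trans[OF sum.swap], rule sum.cong[OF refl], rule sum.swap)
  also have "\<dots> = (\<Sum>i<p + n. \<Sum>j<p + n. \<Sum>a<n. \<Sum>b<n. cnj (v a) * frame p x a i * M $$ (i, j) * (cnj (frame p x b j) * v b))"
    by (rule trans[OF sum.swap], rule sum.cong[OF refl], rule sum.swap)
  also have "\<dots> = (\<Sum>i<p + n. \<Sum>j<p + n. cnj (\<Sum>a<n. cnj (frame p x a i) * v a) * M $$ (i, j) * (\<Sum>b<n. cnj (frame p x b j) * v b))"
    unfolding cnj_sum sum_distrib_left sum_distrib_right
    by (rule sum.cong[OF refl], rule sum.cong[OF refl], rule trans[OF sum.swap], rule sum.cong[OF refl], rule sum.cong[OF refl])
      (simp add: mult_ac)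
  finally show ?thesis by (simp add: qform_def)
qed

lemma error_psd_axis_index:
  assumes X: "X (\<i> * complex_of_real w) \<in> carrier_mat n p"
    and Phi: "\<Phi> (\<i> * complex_of_real w) \<in> carrier_mat (p + n) (p + n)" and ab: "a < n" "b < n"
  shows "error_psd n \<Phi> X (\<i> * complex_of_real w) $$ (a, b)
    = compress n p (X (\<i> * complex_of_real w)) (\<Phi> (\<i> * complex_of_real w)) a b"
proof -
  define x where "x = X (\<i> * complex_of_real w)"
  define M where "M = \<Phi> (\<i> * complex_of_real w)"
  define L where "L = four_block_mat x (1\<^sub>m n) (0\<^sub>m 0 (dim_col x)) (0\<^sub>m 0 n)"
  define R where "R = mat_adjoint x @\<^sub>r 1\<^sub>m n"
  have x: "x \<in> carrier_mat n p" and M: "M \<in> carrier_mat (p + n) (p + n)" using X Phi by (simp_all add: x_def M_def)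
  have L: "L \<in> carrier_mat n (p + n)" using x by (auto simp: L_def)
  have R: "R \<in> carrier_mat (p + n) n" using x by (auto simp: R_def intro!: carrier_append_rows)
  have L_idx: "L $$ (a, i) = frame p x a i" if "i < p + n" for i
    using x ab that by (auto simp: L_def frame_def)
  have R_idx: "R $$ (j, b) = cnj (frame p x b j)" if "j < p + n" for j
    using x ab that by (auto simp: R_def append_rows_def frame_def)
  have LM: "L * M \<in> carrier_mat n (p + n)" using L M by (rule mult_carrier_mat)
  have "error_psd n \<Phi> X (\<i> * complex_of_real w) = L * M * R"
    by (simp only: error_psd_def sys_conj_def axis_point_conj L_def M_def R_def x_def)
  also have "(L * M * R) $$ (a, b) = (\<Sum>j<p + n. (\<Sum>i<p + n. L $$ (a, i) * M $$ (i, j)) * R $$ (j, b))"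
    unfolding mult_mat_index[OF LM R ab] using mult_mat_index[OF L M ab(1)] by (intro sum.cong refl) simp
  also have "\<dots> = (\<Sum>j<p + n. \<Sum>i<p + n. frame p x a i * M $$ (i, j) * cnj (frame p x b j))"
    unfolding sum_distrib_right by (intro sum.cong refl) (simp add: L_idx R_idx)
  also have "\<dots> = compress n p x M a b" unfolding compress_def by (rule sum.swap)
  finally show ?thesis by (simp add: x_def M_def)
qed

lemma qform_diagonal:
  "qform k (\<lambda>i j. if i = j then d i else 0) w = (\<Sum>i<k. d i * complex_of_real ((cmod (w i))\<^sup>2))"
proof -
  have "qform k (\<lambda>i j. if i = j then d i else 0) w = (\<Sum>i<k. cnj (w i) * d i * w i)"
    unfolding qform_def by (intro sum.cong refl) (simp add: mult_delta_left mult_delta_right)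
  also have "\<dots> = (\<Sum>i<k. d i * complex_of_real ((cmod (w i))\<^sup>2))"
    unfolding complex_norm_square by (simp add: mult_ac)
  finally show ?thesis .
qed

lemma qform_linear:
  "qform k (\<lambda>i j. M i j - N i j) w = qform k M w - qform k N w"
  "qform k (\<lambda>i j. c * M i j) w = c * qform k M w"
  unfolding qform_def by (simp_all add: algebra_simps sum_subtractf sum_distrib_left)

lemma qform_cong:
  "(\<And>i j. i < k \<Longrightarrow> j < k \<Longrightarrow> M i j = N i j) \<Longrightarrow> qform k M w = qform k N w"
  by (simp add: qform_def)

text \<open>The matrix \<open>\<theta> (M - g diag(0, I)) - diag(I, -I)\<close> of the multiplier condition, with \<open>g\<close> in the
  place of \<open>\<gamma>\<^sup>2\<close>.\<close>

definition multiplier :: "nat \<Rightarrow> nat \<Rightarrow> real \<Rightarrow> real \<Rightarrow> complex mat \<Rightarrow> complex mat" where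
  "multiplier n p \<theta> g M = complex_of_real \<theta> \<cdot>\<^sub>m (M - complex_of_real g \<cdot>\<^sub>m
       four_block_mat (0\<^sub>m p p) (0\<^sub>m p n) (0\<^sub>m n p) (1\<^sub>m n))
     - four_block_mat (1\<^sub>m p) (0\<^sub>m p n) (0\<^sub>m n p) (- 1\<^sub>m n)"

lemma multiplier_index:
  assumes "M \<in> carrier_mat (p + n) (p + n)" "i < p + n" "j < p + n"
  shows "multiplier n p \<theta> g M $$ (i, j)
    = complex_of_real \<theta> * (M $$ (i, j) - complex_of_real g * (if i = j then if i < p then 0 else 1 else 0))
      - (if i = j then if i < p then 1 else - 1 else 0)"
  using assms by (auto simp: multiplier_def)

text \<open>The S-procedure: compressing the multiplier matrix by \<open>[x I]\<close> gives
  \<open>\<theta> (P - g I) + I - x x\<^sup>* > 0\<close>, where the first term is nonpositive. The bound on \<open>P\<close> is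
  assumed in the weak form in which it survives the passage to the limit at infinity.\<close>

lemma contraction_from_multiplier:
  assumes x: "x \<in> carrier_mat n p" and M: "M \<in> carrier_mat (p + n) (p + n)" and \<theta>: "\<theta> > 0"
    and pd: "pos_def (p + n) (multiplier n p \<theta> g M)"
    and bound: "\<And>v. Re (qform n (compress n p x M) v) \<le> g * (\<Sum>a<n. (cmod (v a))\<^sup>2)"
  shows "loewner_less n (x * mat_adjoint x) (1\<^sub>m n)"
  unfolding contraction_iff_kernel[OF x] pd_kernel_def
proof (intro conjI allI impI)
  show "herm_kernel n (gram_defect p 1 (\<lambda>i l. x $$ (i, l)))"
    by (simp add: herm_kernel_def gram_defect_def cnj_sum mult.commute)
  fix v :: "nat \<Rightarrow> complex" assume v: "\<exists>i<n. v i \<noteq> 0"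
  \<comment> \<open>The vector \<open>[x I]\<^sup>* v\<close>; its lower part is \<open>v\<close>, so it does not vanish.\<close>
  define w where "w i = (\<Sum>a<n. cnj (frame p x a i) * v a)" for i
  define nv where "nv = (\<Sum>a<n. (cmod (v a))\<^sup>2)"
  define nx where "nx = (\<Sum>i<p. (cmod (w i))\<^sup>2)"
  have w_low: "w (p + a) = v a" if "a < n" for a
    using that by (simp add: w_def frame_def mult_delta_left if_distrib[of cnj] cong: if_cong)
  have nw: "(\<Sum>i<p + n. d i * complex_of_real ((cmod (w i))\<^sup>2)) = c * complex_of_real nx + e * complex_of_real nv"
    if "\<And>i. i < p \<Longrightarrow> d i = c" "\<And>i. d (p + i) = e" for d c e
    unfolding sum_lessThan_add nx_def nv_def of_real_sum sum_distrib_left using that w_low by simp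
  have "qform (p + n) (\<lambda>i j. multiplier n p \<theta> g M $$ (i, j)) w
      = qform (p + n) (\<lambda>i j. complex_of_real \<theta> * (M $$ (i, j) - complex_of_real g * (if i = j then if i < p then 0 else 1 else 0))
          - (if i = j then if i < p then 1 else - 1 else 0)) w"
    by (rule qform_cong) (rule multiplier_index[OF M])
  also have "\<dots> = complex_of_real \<theta> * (qform n (compress n p x M) v - complex_of_real g * complex_of_real nv)
      - (complex_of_real nx - complex_of_real nv)"
  proof -
    have k: "qform (p + n) (\<lambda>i j. if i = j then if i < p then 0 else 1 else 0) w = complex_of_real nv"
      unfolding qform_diagonal by (subst nw[of _ 0 1]) simp_all
    have j: "qform (p + n) (\<lambda>i j. if i = j then if i < p then 1 else - 1 else 0) w = complex_of_real nx - complex_of_real nv"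
      unfolding qform_diagonal by (subst nw[of _ 1 "-1"]) simp_all
    have f: "qform (p + n) (\<lambda>i j. M $$ (i, j)) w = qform n (compress n p x M) v"
      unfolding qform_compress w_def ..
    show ?thesis unfolding qform_linear k j f ..
  qed
  finally have eq: "Re (qform (p + n) (\<lambda>i j. multiplier n p \<theta> g M $$ (i, j)) w)
      = \<theta> * (Re (qform n (compress n p x M) v) - g * nv) - (nx - nv)" by simp
  have "\<exists>i<p + n. w i \<noteq> 0" using v w_low by (metis add_strict_left_mono)
  then have "Re (qform (p + n) (\<lambda>i j. multiplier n p \<theta> g M $$ (i, j)) w) > 0"
    using pd unfolding pos_def_iff_kernel pd_kernel_def by blast
  moreover have "\<theta> * (Re (qform n (compress n p x M) v) - g * nv) \<le> 0"
    using bound[of v] \<theta> by (simp add: nv_def mult_nonneg_nonpos)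
  ultimately have "nx < nv" using eq by linarith
  moreover have "qform n (gram_defect p 1 (\<lambda>i l. x $$ (i, l))) v = complex_of_real nv - complex_of_real nx"
  proof -
    have "qform n (\<lambda>i j. \<Sum>l<p. x $$ (i, l) * cnj (x $$ (j, l))) v
        = (\<Sum>i<n. \<Sum>j<n. \<Sum>l<p. cnj (v i) * x $$ (i, l) * (cnj (x $$ (j, l)) * v j))"
      unfolding qform_def sum_distrib_left sum_distrib_right by (intro sum.cong refl) (simp add: mult_ac)
    also have "\<dots> = (\<Sum>l<p. \<Sum>i<n. \<Sum>j<n. cnj (v i) * x $$ (i, l) * (cnj (x $$ (j, l)) * v j))"
      by (subst sum.swap[of _ "{..<p}" "{..<n}"]) (intro sum.cong refl sum.swap)
    also have "\<dots> = (\<Sum>l<p. cnj (w l) * w l)"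
      unfolding w_def cnj_sum sum_product by (intro sum.cong refl) (simp add: frame_def)
    also have "\<dots> = complex_of_real nx"
      unfolding nx_def of_real_sum complex_norm_square by (simp add: mult.commute)
    finally have 1: "qform n (\<lambda>i j. \<Sum>l<p. x $$ (i, l) * cnj (x $$ (j, l))) v = complex_of_real nx" .
    have 2: "qform n (\<lambda>i j. if i = j then 1 * cnj 1 else 0) v = complex_of_real nv"
      unfolding qform_diagonal nv_def by simp
    show ?thesis unfolding gram_defect_def qform_linear 1 2 ..
  qed
  ultimately show "Re (qform n (gram_defect p 1 (\<lambda>i l. x $$ (i, l))) v) > 0" by simp
qed

lemma psd_bound:
  assumes PSD: "cond_PSD n \<Phi> \<gamma> X"
    and X: "X (\<i> * complex_of_real w) \<in> carrier_mat n p"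
    and Phi: "\<Phi> (\<i> * complex_of_real w) \<in> carrier_mat (p + n) (p + n)"
  shows "Re (qform n (compress n p (X (\<i> * complex_of_real w)) (\<Phi> (\<i> * complex_of_real w))) v)
    \<le> \<gamma>\<^sup>2 * (\<Sum>a<n. (cmod (v a))\<^sup>2)"
proof (cases "\<exists>a<n. v a \<noteq> 0")
  case True
  define P where "P = error_psd n \<Phi> X (\<i> * complex_of_real w)"
  define K where "K = compress n p (X (\<i> * complex_of_real w)) (\<Phi> (\<i> * complex_of_real w))"
  have pd: "pos_def n (complex_of_real (\<gamma>\<^sup>2) \<cdot>\<^sub>m 1\<^sub>m n - P)"
    using PSD unfolding cond_PSD_def loewner_less_def P_def by blast
  then have P: "dim_row P = n" "dim_col P = n" by (auto simp: pos_def_def)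
  have "qform n (\<lambda>a b. (complex_of_real (\<gamma>\<^sup>2) \<cdot>\<^sub>m 1\<^sub>m n - P) $$ (a, b)) v
      = qform n (\<lambda>a b. (if a = b then complex_of_real (\<gamma>\<^sup>2) else 0) - K a b) v"
  proof (rule qform_cong)
    fix a b assume ab: "a < n" "b < n"
    have "P $$ (a, b) = K a b" unfolding P_def K_def by (rule error_psd_axis_index[of X w n p \<Phi>, OF X Phi ab])
    then show "(complex_of_real (\<gamma>\<^sup>2) \<cdot>\<^sub>m 1\<^sub>m n - P) $$ (a, b) = (if a = b then complex_of_real (\<gamma>\<^sup>2) else 0) - K a b"
      using ab P by simp
  qed
  also have "\<dots> = complex_of_real (\<gamma>\<^sup>2 * (\<Sum>a<n. (cmod (v a))\<^sup>2)) - qform n K v"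
    unfolding qform_linear qform_diagonal by (simp add: sum_distrib_left)
  finally have "Re (qform n (\<lambda>a b. (complex_of_real (\<gamma>\<^sup>2) \<cdot>\<^sub>m 1\<^sub>m n - P) $$ (a, b)) v)
      = \<gamma>\<^sup>2 * (\<Sum>a<n. (cmod (v a))\<^sup>2) - Re (qform n K v)"
    by (simp only: minus_complex.sel Re_complex_of_real)
  moreover have "Re (qform n (\<lambda>a b. (complex_of_real (\<gamma>\<^sup>2) \<cdot>\<^sub>m 1\<^sub>m n - P) $$ (a, b)) v) > 0"
    using pd True unfolding pos_def_iff_kernel pd_kernel_def by blast
  ultimately show ?thesis by (simp add: K_def)
next
  case False
  then show ?thesis by (simp add: qform_def)
qed

lemma axis_limits_exist:
  assumes "mat_conv r c (\<lambda>w. Y (\<i> * complex_of_real w)) F"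
    and F: "F = at_top \<and> e = PInfty \<or> F = at_bot \<and> e = MInfty"
  shows "axis_value Y e \<in> carrier_mat r c"
    "\<And>i j. i < r \<Longrightarrow> j < c \<Longrightarrow> ((\<lambda>w. Y (\<i> * complex_of_real w) $$ (i, j)) \<longlongrightarrow> axis_value Y e $$ (i, j)) F"
proof -
  have "\<forall>i j. \<exists>l. i < r \<longrightarrow> j < c \<longrightarrow> ((\<lambda>w. Y (\<i> * complex_of_real w) $$ (i, j)) \<longlongrightarrow> l) F"
    using assms(1) unfolding mat_conv_def by blast
  then obtain L where L: "\<And>i j. i < r \<Longrightarrow> j < c \<Longrightarrow> ((\<lambda>w. Y (\<i> * complex_of_real w) $$ (i, j)) \<longlongrightarrow> L i j) F"
    by metis
  have "Y (\<i> * complex_of_real 0) \<in> carrier_mat r c" using assms(1) unfolding mat_conv_def by blast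
  then have "axis_value Y e = Matrix.mat r c (\<lambda>(i, j). L i j)"
    using axis_value_infinity[OF _ L F] by simp
  then show "axis_value Y e \<in> carrier_mat r c"
    "\<And>i j. i < r \<Longrightarrow> j < c \<Longrightarrow> ((\<lambda>w. Y (\<i> * complex_of_real w) $$ (i, j)) \<longlongrightarrow> axis_value Y e $$ (i, j)) F"
    using L by auto
qed

lemma mat_conv_proper_stable:
  assumes "proper_rational_mat r c X" "cond_H1 r c X"
    and F: "filterlim (\<lambda>w. \<i> * complex_of_real w) at_infinity F"
  shows "mat_conv r c (\<lambda>w. X (\<i> * complex_of_real w)) F"
  unfolding mat_conv_def
proof (intro conjI allI impI)
  show "X (\<i> * complex_of_real w) \<in> carrier_mat r c" for w using assms(1) by (simp add: proper_rational_mat_def)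
  fix i j assume ij: "i < r" "j < c"
  obtain p q where pq: "degree p \<le> degree q" "\<And>s. X s $$ (i, j) = poly p s / poly q s" "poly q 0 \<noteq> 0"
    using proper_stable_entry[OF assms(1,2) ij] by (metis order_refl zero_complex.sel(1))
  then have "q \<noteq> 0" by auto
  from filterlim_compose[OF proper_poly_frac_tendsto[OF pq(1) this] F]
  show "\<exists>l. ((\<lambda>w. X (\<i> * complex_of_real w) $$ (i, j)) \<longlongrightarrow> l) F" unfolding pq(2) by blast
qed

text \<open>At finite frequencies and, after passing to limits, at infinity, the multiplier condition turns
  the performance bound into strict contractivity. The level \<open>\<gamma>\<close> may be smaller than the one for
  which the multiplier condition is given; the comparison of the infima needs this.\<close>

lemma hardy_subset_strict:
  assumes conv: "mat_conv (n\<^sub>y + n) (n\<^sub>y + n) (\<lambda>w. \<Phi> (\<i> * complex_of_real w)) at_top"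
      "mat_conv (n\<^sub>y + n) (n\<^sub>y + n) (\<lambda>w. \<Phi> (\<i> * complex_of_real w)) at_bot"
    and \<theta>: "\<theta> > 0" and pd: "\<And>w. pos_def (n\<^sub>y + n) (multiplier n n\<^sub>y \<theta> g (axis_value \<Phi> w))"
    and g: "\<gamma>\<^sup>2 \<le> g"
  shows "filters_hardy n n\<^sub>y \<Phi> \<gamma> \<subseteq> filters_strict n n\<^sub>y \<Phi> \<gamma>"
proof
  fix X assume "X \<in> filters_hardy n n\<^sub>y \<Phi> \<gamma>"
  then have rat: "rational_mat n n\<^sub>y X" and hardy: "hardy_inf_mat n n\<^sub>y X"
    and H1: "cond_H1 n n\<^sub>y X" and PSD: "cond_PSD n \<Phi> \<gamma> X"
    by (auto simp: filters_hardy_def)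
  have proper: "proper_rational_mat n n\<^sub>y X" by (rule hardy_imp_proper[OF rat hardy])
  have X: "X s \<in> carrier_mat n n\<^sub>y" for s using rat by (simp add: rational_mat_def)
  have Phi: "\<Phi> (\<i> * complex_of_real w) \<in> carrier_mat (n\<^sub>y + n) (n\<^sub>y + n)" for w
    using conv(1) unfolding mat_conv_def by blast
  have bound: "Re (qform n (compress n n\<^sub>y (X (\<i> * complex_of_real w)) (\<Phi> (\<i> * complex_of_real w))) v)
      \<le> g * (\<Sum>a<n. (cmod (v a))\<^sup>2)" for w v
    proof (rule order_trans)
    show "\<gamma>\<^sup>2 * (\<Sum>a<n. (cmod (v a))\<^sup>2) \<le> g * (\<Sum>a<n. (cmod (v a))\<^sup>2)"
      by (intro mult_right_mono g sum_nonneg) simp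
  qed (rule psd_bound[OF PSD X Phi])
  have infinite: "loewner_less n (axis_value X e * mat_adjoint (axis_value X e)) (1\<^sub>m n)"
    if F: "F = at_top \<and> e = PInfty \<or> F = at_bot \<and> e = MInfty" for F :: "real filter" and e
  proof -
    have F': "filterlim (\<lambda>w. \<i> * complex_of_real w) at_infinity F"
      "mat_conv (n\<^sub>y + n) (n\<^sub>y + n) (\<lambda>w. \<Phi> (\<i> * complex_of_real w)) F"
      using F filterlim_imaginary_at_infinity conv by auto
    have F_nt: "F \<noteq> bot"
      using F by (elim disjE conjE) (simp_all only: trivial_limit_at_top_linorder trivial_limit_at_bot_linorder not_False_eq_True)
    note Xlim = axis_limits_exist[OF mat_conv_proper_stable[OF proper H1 F'(1)] F]
    note Plim = axis_limits_exist[OF F'(2) F]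
    show ?thesis
    proof (rule contraction_from_multiplier[OF Xlim(1) Plim(1) \<theta> pd])
      fix v
      have frame: "((\<lambda>w. frame n\<^sub>y (X (\<i> * complex_of_real w)) a i) \<longlongrightarrow> frame n\<^sub>y (axis_value X e) a i) F" if "a < n" for a i
        unfolding frame_def using Xlim(2)[OF that] by auto
      have "((\<lambda>w. Re (qform n (compress n n\<^sub>y (X (\<i> * complex_of_real w)) (\<Phi> (\<i> * complex_of_real w))) v))
        \<longlongrightarrow> Re (qform n (compress n n\<^sub>y (axis_value X e) (axis_value \<Phi> e)) v)) F"
        unfolding qform_def compress_def by (intro tendsto_intros frame Plim(2)) auto
      then show "Re (qform n (compress n n\<^sub>y (axis_value X e) (axis_value \<Phi> e)) v) \<le> g * (\<Sum>a<n. (cmod (v a))\<^sup>2)"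
        by (rule tendsto_upperbound[OF _ _ F_nt]) (use bound in simp)
    qed
  qed
  have "loewner_less n (axis_value X w * mat_adjoint (axis_value X w)) (1\<^sub>m n)" for w
  proof (cases w)
    case (real r)
    show ?thesis
      unfolding real axis_value_real
      by (rule contraction_from_multiplier[OF X Phi \<theta> _ bound]) (use pd[of "ereal r"] in \<open>simp add: axis_value_real\<close>)
  next
    case PInf
    then show ?thesis using infinite[of at_top PInfty] by simp
  next
    case MInf
    then show ?thesis using infinite[of at_bot MInfty] by simp
  qed
  then show "X \<in> filters_strict n n\<^sub>y \<Phi> \<gamma>"
    using proper H1 PSD by (simp add: filters_strict_def)
qed

theorem theorem2:
  fixes n n\<^sub>w n\<^sub>y n\<^sub>d \<nu> :: nat
    and A B C D Su Sw :: "complex mat"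
    and \<Phi> :: "complex \<Rightarrow> complex mat"
    and \<gamma> :: real
  assumes "channel n n\<^sub>w n\<^sub>y n\<^sub>d \<nu> A B C D"
    and "pos_def n Su" and "pos_def n\<^sub>w Sw"
    and "\<Phi> = channel_Phi n n\<^sub>y A B C D Su Sw"
    and "\<gamma> > 0"
    and "filters_strict n n\<^sub>y \<Phi> \<gamma> \<noteq> {}"
    and "\<exists>\<theta>::real. \<theta> > 0 \<and> (\<forall>w::ereal. pos_def (n\<^sub>y + n)
           (complex_of_real \<theta> \<cdot>\<^sub>m (axis_value \<Phi> w - complex_of_real (\<gamma>\<^sup>2) \<cdot>\<^sub>m
               four_block_mat (0\<^sub>m n\<^sub>y n\<^sub>y) (0\<^sub>m n\<^sub>y n) (0\<^sub>m n n\<^sub>y) (1\<^sub>m n))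
            - four_block_mat (1\<^sub>m n\<^sub>y) (0\<^sub>m n\<^sub>y n) (0\<^sub>m n n\<^sub>y) (- 1\<^sub>m n)))"
  shows "filters_strict n n\<^sub>y \<Phi> \<gamma> = filters_hardy n n\<^sub>y \<Phi> \<gamma> \<and>
    gamma_opt n n\<^sub>y \<Phi> = gamma_hardy n n\<^sub>y \<Phi> \<and>
    gamma_hardy n n\<^sub>y \<Phi> = gamma_contr n n\<^sub>y \<Phi> \<and>
    gamma_contr n n\<^sub>y \<Phi> = gamma_strict n n\<^sub>y \<Phi>"
proof -
  obtain \<theta> :: real where \<theta>: "\<theta> > 0"
    and pd: "\<And>w. pos_def (n\<^sub>y + n) (multiplier n n\<^sub>y \<theta> (\<gamma>\<^sup>2) (axis_value \<Phi> w))"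
    using assms(7) unfolding multiplier_def by blast
  have S: "Su \<in> carrier_mat n n" "Sw \<in> carrier_mat n\<^sub>w n\<^sub>w" using assms(2,3) by (simp_all add: pos_def_def)
  note conv = mat_conv_channel_Phi[OF assms(1) S, folded assms(4)]
  have hardy_strict: "filters_hardy n n\<^sub>y \<Phi> \<gamma>' \<subseteq> filters_strict n n\<^sub>y \<Phi> \<gamma>'" if "0 < \<gamma>'" "\<gamma>' \<le> \<gamma>" for \<gamma>'
    by (rule hardy_subset_strict[OF conv conv \<theta> pd])
      (use that filterlim_imaginary_at_infinity in \<open>auto intro: power_mono\<close>)
  have strict_hardy: "filters_strict n n\<^sub>y \<Phi> \<gamma>' \<subseteq> filters_hardy n n\<^sub>y \<Phi> \<gamma>'" for \<gamma>'
    using strict_subset_contr contr_subset_hardy by blast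
  have eq: "filters_strict n n\<^sub>y \<Phi> \<gamma> = filters_hardy n n\<^sub>y \<Phi> \<gamma>"
    using hardy_strict[OF assms(5)] strict_hardy by blast
  have hardy_contr: "gamma_hardy n n\<^sub>y \<Phi> \<le> gamma_contr n n\<^sub>y \<Phi>"
    unfolding gamma_hardy_def gamma_contr_def using contr_subset_hardy by (intro INF_superset_mono) blast+
  have contr_strict: "gamma_contr n n\<^sub>y \<Phi> \<le> gamma_strict n n\<^sub>y \<Phi>"
    unfolding gamma_contr_def gamma_strict_def using strict_subset_contr by (intro INF_superset_mono) blast+
  have strict_le_hardy: "gamma_strict n n\<^sub>y \<Phi> \<le> gamma_hardy n n\<^sub>y \<Phi>"
    unfolding gamma_hardy_def
  proof (rule INF_greatest)
    fix \<gamma>' assume \<gamma>': "\<gamma>' \<in> {\<gamma>::real. \<gamma> > 0 \<and> filters_hardy n n\<^sub>y \<Phi> \<gamma> \<noteq> {}}"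
    show "gamma_strict n n\<^sub>y \<Phi> \<le> ereal \<gamma>'"
    \<comment> \<open>Levels above \<open>\<gamma>\<close> do not affect the infimum, because the strict problem is feasible at \<open>\<gamma>\<close>.\<close>
    proof (cases "\<gamma>' \<le> \<gamma>")
      case True
      then have "filters_strict n n\<^sub>y \<Phi> \<gamma>' \<noteq> {}" using \<gamma>' hardy_strict[of \<gamma>'] by blast
      then show ?thesis unfolding gamma_strict_def using \<gamma>' by (intro INF_lower) simp
    next
      case False
      have "gamma_strict n n\<^sub>y \<Phi> \<le> ereal \<gamma>"
        unfolding gamma_strict_def using assms(5,6) by (intro INF_lower) simp
      then show ?thesis using False by (meson ereal_less_eq(3) le_cases order_trans)
    qed
  qed
  have hardy_opt: "gamma_hardy n n\<^sub>y \<Phi> \<le> gamma_opt n n\<^sub>y \<Phi>"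
    unfolding gamma_hardy_def gamma_opt_def using admissible_block_hardy by (intro INF_superset_mono) blast+
  have "\<exists>H\<in>admissible_equalizers n n\<^sub>y. cond_PSD n \<Phi> \<gamma>' (block11 n n\<^sub>y H)"
    if strict: "X \<in> filters_strict n n\<^sub>y \<Phi> \<gamma>'" for X \<gamma>'
  proof -
    have X: "proper_rational_mat n n\<^sub>y X" "cond_H1 n n\<^sub>y X" "cond_PSD n \<Phi> \<gamma>' X"
      "\<And>w. loewner_less n (axis_value X w * mat_adjoint (axis_value X w)) (1\<^sub>m n)"
      using strict by (auto simp: filters_strict_def)
    obtain H where H: "H \<in> admissible_equalizers n n\<^sub>y"
      "\<And>s i j. Re s = 0 \<Longrightarrow> i < n \<Longrightarrow> j < n\<^sub>y \<Longrightarrow> H s $$ (i, j) = X s $$ (i, j)"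
      using strict_contraction_dilates[OF X(1,2,4)] by blast
    have "block11 n n\<^sub>y H s = X s" if "Re s = 0" for s
    proof (rule eq_matI)
      have "X s \<in> carrier_mat n n\<^sub>y" using X(1) by (simp add: proper_rational_mat_def)
      then show "dim_row (block11 n n\<^sub>y H s) = dim_row (X s)" "dim_col (block11 n n\<^sub>y H s) = dim_col (X s)"
        "\<And>i j. i < dim_row (X s) \<Longrightarrow> j < dim_col (X s) \<Longrightarrow> block11 n n\<^sub>y H s $$ (i, j) = X s $$ (i, j)"
        using block11_carrier[of n n\<^sub>y H s] H(2)[OF that] by (auto simp: block11_index)
    qed
    then have "cond_PSD n \<Phi> \<gamma>' (block11 n n\<^sub>y H) = cond_PSD n \<Phi> \<gamma>' X" by (intro cond_PSD_cong) simp
    then show ?thesis using H(1) X(3) by blast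
  qed
  then have opt_strict: "gamma_opt n n\<^sub>y \<Phi> \<le> gamma_strict n n\<^sub>y \<Phi>"
    unfolding gamma_opt_def gamma_strict_def by (intro INF_superset_mono) blast+
  show ?thesis
    using eq hardy_contr contr_strict strict_le_hardy hardy_opt opt_strict by (metis antisym order_trans)
qed

end
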